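(* Let $N\ge5$, $k\ge0$ be integers and $m=\lfloor N/2\rfloor$. Let $P_NV_NQ_N=D_N=\operatorname{diag}(d_1,\dots,d_m)$, $P_N,Q_N\in\operatorname{GL}_m(\mathbb Z)$, be a Smith normal form of the class matrix $V_N$, and put $$\boldsymbol\alpha_N=-P_N\left(\tfrac1{12}\mathbf g+A_N\mathbf a^{(1)}\right)=(\alpha_1,\dots,\alpha_m)^T,\qquad \omega_i=e^{2\pi i/d_i}\ \ (1\le i\le m),$$ where $\omega_i$ denotes the primitive $d_i$-th root of unity $\exp(2\pi\sqrt{-1}/d_i)$. For $\mathbf j=(j_1,\dots,j_m)$ with $0\le j_i\le d_i-1$ define $$\xi(\mathbf j)=\prod_{i=1}^m\omega_i^{j_i\alpha_i},\qquad \chi_r(\mathbf j)=\prod_{i=1}^m\omega_i^{j_i(P_N)_{i,r+1}}\ (0\le r\le m-1),\qquad \chi_m(\mathbf j)=1,$$ $$W_{\mathbf j}(n)=\sum_{\substack{(v_0,\dots,v_m)\in\mathbb Z_{\ge0}^{m+1}\\ \sum_{r=0}^m\mu_rv_r=n}}\ \prod_{r=0}^m\chi_r(\mathbf j)^{v_r},$$ where the $i$-th cusp orbit corresponds to the pair $(g_i,a_i)$ and $$\mu_i=\begin{cases}\varphi(N)/2,&(g_i,a_i)=(1,1),\\ \varphi(N/2)/2,&(g_i,a_i)=(2,1)\ \text{(if }2\mid N),\\ \varphi(N/g_i),&g_i>2.\end{cases}$$ Then $$|L_N(k)|=\frac1{d_1\cdots d_m}\sum_{j_1=0}^{d_1-1}\cdots\sum_{j_m=0}^{d_m-1}\xi(\mathbf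 j)^k\,W_{\mathbf j}(kR_N),\qquad R_N=\frac1{24}\sum_{d\mid N}d\,\varphi(d)\,\varphi(N/d).$$
   Context: Notation: $q=e^{2\pi i\tau}$, $\operatorname{Im}\tau>0$; $(x_1,\dots,x_s;q)_\infty=\prod_{i=1}^s\prod_{n\ge0}(1-x_iq^n)$; $\varphi$ is Euler's function; $m=\lfloor N/2\rfloor$. Products: for an even integer $a_0\ge0$ and $\mathbf a=(a_1,\dots,a_m)\in\mathbb Z^m$, $$f^{(N)}_{\mathbf a}(\tau)=q^{\frac N{24}S_1-\frac1{2N}S_2}(q^N;q^N)_\infty^{a_0}\prod_{j=1}^m(q^j,q^{N-j};q^N)_\infty^{a_j},\quad S_1=a_0+2\sum_{j=1}^m a_j,\quad S_2=\sum_{j=1}^m j(N-j)a_j.$$ For an integer $k\ge0$, $L_N(k)$ is the set of all $\mathbf a\in\mathbb Z^m$ such that, with $a_0=2k$, $f^{(N)}_{\mathbf a}\in M_k(\Gamma_1(N))$, the space of holomorphic modular forms of weight $k$ on $\Gamma_1(N)$. Cusps: the cusps of $X_1(N)$ are the $\Gamma_1(N)$-classes $[a/c]$, $\gcd(a,c)=1$, and $g([a/c])=\gcd(c,N)$. Every cusp can be written $[a/(gu)]$ with $g\mid N$, $u$ a unit mod $N/g$, $a\in(\mathbb Z/g\mathbb Z)^\times/\{\pm1\}$, $\gcd(a,gu)=1$. The group $\mathrm{Gal}(\mathbb Q(e^{2\pi i/N})/\mathbb Q)\cong(\mathbb Z/N\mathbb Z)^\times$ acts by $\sigma_x[a/(gu)]=[a/(xgu)]$;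 the orbits correspond to the pairs $(g,a)$ with $g\mid N$, $a\in(\mathbb Z/g\mathbb Z)^\times/\{\pm1\}$, and there are $m+1$ of them. Order these pairs as $(g_i,a_i)$, $0\le i\le m$, and fix corresponding orbit representatives $\mathfrak c_0,\dots,\mathfrak c_m$ with $\mathfrak c_m=[1/N]=[i\infty]$. Put $\mathbf g=(g(\mathfrak c_0),\dots,g(\mathfrak c_{m-1}))^T$. Matrix $A_N$: writing $\mathfrak c_r=[a/c]$, $g=g(\mathfrak c_r)$, $A_N$ is the $m\times m$ matrix with rows indexed by $0\le r\le m-1$, columns by $1\le j\le m$, and entries $\frac g2B_2(\langle ja/g\rangle)$, where $B_2(x)=x^2-x+\frac16$ and $\langle x\rangle=x-\lfloor x\rfloor$. Matrix $B_N$: $B_5=\begin{pmatrix}16&-5\\-4&5\end{pmatrix}$. If $N\ge6$, put $M=N\gcd(2,N)$, let $r_N\in\{0,1,2\}$ with $r_N\equiv2M\pmod3$, $a_N=\frac{-M+5r_N}3$, $b_N=\frac{M-8r_N}3$, let $\mathbf e_1,\dots,\mathbf e_m$ be the standard basis of $\mathbb Z^m$, and let $j_1<\dots<j_r$ be the multiples of $3$ in $\{3,\dots,m\}$. The columns of $B_N$ are the $m$ vectors $16\mathbf e_1-4\mathbf e_2$; $\ a_N\mathbf e_1+b_N\mathbf e_2+r_N\mathbf e_3$; $\ \frac{j^2-4}3\mathbf e_1-\frac{j^2-1}3\mathbf e_2+\mathbf e_j$ for $3\le j\le m$, $3\nmid j$; $\ (j_1^2-4)\mathbf e_1-(j_1^2-1)\mathbf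 e_2+3\mathbf e_{j_1}$; and $\frac{j_t^2-j_1^2}3(\mathbf e_1-\mathbf e_2)-\mathbf e_{j_1}+\mathbf e_{j_t}$ for $2\le t\le r$. Class matrix: $V_N=A_NB_N$, an integer $m\times m$ matrix presenting the $\mathbb Q$-rational cuspidal divisor class group of $X_1(N)$. Vector $\mathbf a^{(1)}\in\mathbb Z^m$: $(-3,2)^T$ if $N=5$, and $(-3,3,-1,0,\dots,0)^T$ if $N\ge6$. The vector $\boldsymbol\alpha_N$ is integral. *)

theory Defs
  imports
    "HOL-Analysis.Analysis"
    "HOL-Number_Theory.Totient"
    "Jordan_Normal_Form.Matrix"
begin

unbundle no vec_syntax
hide_const (open) Finite_Cartesian_Product.vec Finite_Cartesian_Product.mat
  Finite_Cartesian_Product.row Finite_Cartesian_Product.column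

text \<open>The index range \<open>1, \<dots>, m\<close> of the entries of vectors and of the columns of matrices
  is shifted to \<open>0, \<dots>, m - 1\<close> throughout; here \<open>m = N div 2\<close>. Cusp orbits are
  numbered \<open>0, \<dots>, m\<close>, so they need no shift.\<close>

section \<open>Modular forms on \<open>\<Gamma>\<^sub>1(N)\<close>\<close>

text \<open>A matrix with rows \<open>(p, q)\<close> and \<open>(r, s)\<close> is the tuple \<open>(p, q, r, s)\<close>.\<close>

definition SL2Z :: "(int \<times> int \<times> int \<times> int) set" where
  "SL2Z = {(p, q, r, s). p * s - q * r = 1}"

definition Gamma1 :: "nat \<Rightarrow> (int \<times> int \<times> int \<times> int) set" where
  "Gamma1 N = {(p, q, r, s) \<in> SL2Z.
     p mod int N = 1 mod int N \<and> s mod int N = 1 mod int N \<and> r mod int N = 0}"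

definition slash :: "nat \<Rightarrow> int \<times> int \<times> int \<times> int \<Rightarrow> (complex \<Rightarrow> complex) \<Rightarrow> complex \<Rightarrow> complex" where
  "slash k = (\<lambda>(p, q, r, s) f \<tau>.
     f ((of_int p * \<tau> + of_int q) / (of_int r * \<tau> + of_int s)) / (of_int r * \<tau> + of_int s) ^ k)"

text \<open>Holomorphy at all cusps: as \<open>\<Gamma>(N)\<close> is normal in \<open>SL\<^sub>2(\<int>)\<close> and contained in
  \<open>\<Gamma>\<^sub>1(N)\<close>, every \<open>slash k \<gamma> f\<close> has period \<open>N\<close>; its Fourier expansion in
  \<open>exp (2\<pi>i\<tau> / N)\<close> must have no negative exponents. Values of \<open>f\<close> outside the upper half-plane
  are irrelevant.\<close>

definition modular_forms :: "nat \<Rightarrow> nat \<Rightarrow> (complex \<Rightarrow> complex) set" where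
  "modular_forms N k = {f.
     f holomorphic_on {\<tau>. Im \<tau> > 0} \<and>
     (\<forall>\<gamma>\<in>Gamma1 N. \<forall>\<tau>. Im \<tau> > 0 \<longrightarrow> slash k \<gamma> f \<tau> = f \<tau>) \<and>
     (\<forall>\<gamma>\<in>SL2Z. \<exists>b :: nat \<Rightarrow> complex. \<forall>\<tau>. Im \<tau> > 0 \<longrightarrow>
        (\<lambda>n. b n * exp (2 * of_real pi * \<i> * of_nat n * \<tau> / of_nat N)) sums slash k \<gamma> f \<tau>)}"

section \<open>The products and the set \<open>L\<^sub>N(k)\<close>\<close>

definition qpoch_inf :: "complex \<Rightarrow> complex \<Rightarrow> complex" where
  "qpoch_inf x q = (\<Prod>n. 1 - x * q ^ n)"

definition product_form :: "nat \<Rightarrow> nat \<Rightarrow> int vec \<Rightarrow> complex \<Rightarrow> complex" where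
  "product_form N a\<^sub>0 a \<tau> =
     (let m = N div 2;
          q = exp (2 * of_real pi * \<i> * \<tau>);
          S1 = int a\<^sub>0 + 2 * (\<Sum>j = 1..m. a $ (j - 1));
          S2 = (\<Sum>j = 1..m. int (j * (N - j)) * a $ (j - 1));
          e = real N / 24 * real_of_int S1 - 1 / (2 * real N) * real_of_int S2
      in exp (2 * of_real pi * \<i> * \<tau> * of_real e) * qpoch_inf (q ^ N) (q ^ N) ^ a\<^sub>0 *
         (\<Prod>j = 1..m. (qpoch_inf (q ^ j) (q ^ N) * qpoch_inf (q ^ (N - j)) (q ^ N)) powi (a $ (j - 1))))"

definition L_set :: "nat \<Rightarrow> nat \<Rightarrow> int vec set" where
  "L_set N k = {a \<in> carrier_vec (N div 2). product_form N (2 * k) a \<in> modular_forms N k}"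

section \<open>Cusps of \<open>X\<^sub>1(N)\<close> and their Galois orbits\<close>

text \<open>An element \<open>a/c\<close> of \<open>\<rat> \<union> {i\<infinity>}\<close> in lowest terms is a coprime pair \<open>(a, c)\<close> up to
  sign, with \<open>i\<infinity> = 1/0\<close>; hence the sign \<open>e\<close>.\<close>

definition cusp :: "nat \<Rightarrow> int \<Rightarrow> int \<Rightarrow> (int \<times> int) set" where
  "cusp N a c = {(e * (p * a + q * c), e * (r * a + s * c)) | e p q r s.
     e \<in> {1, -1} \<and> (p, q, r, s) \<in> Gamma1 N}"

definition cusps :: "nat \<Rightarrow> (int \<times> int) set set" where
  "cusps N = {cusp N a c | a c. coprime a c}"

text \<open>\<open>\<sigma>\<^sub>x [a/c] = [a/(xc)]\<close>, where the representative of the cusp is chosen such that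
  \<open>a\<close> is coprime to \<open>x\<close>. This is \<open>[a/(gu)] \<mapsto> [a/(xgu)]\<close> with \<open>c = gu\<close>, \<open>g = gcd c N\<close>.\<close>

definition galois_act :: "nat \<Rightarrow> int \<Rightarrow> (int \<times> int) set \<Rightarrow> (int \<times> int) set" where
  "galois_act N x C = (THE C'. \<exists>a c. coprime a c \<and> coprime a (x * c) \<and>
     C = cusp N a c \<and> C' = cusp N a (x * c))"

definition galois_orbit :: "nat \<Rightarrow> (int \<times> int) set \<Rightarrow> (int \<times> int) set set" where
  "galois_orbit N C = {galois_act N x C | x. coprime x (int N)}"

text \<open>\<open>[a r / c r]\<close>, for \<open>r = 0, \<dots>, m\<close>, represents each Galois orbit exactly once, and the
  last of these cusps is \<open>i\<infinity>\<close>. The pair attached to the \<open>r\<close>-th orbit is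
  \<open>g = gcd (c r) N\<close> together with the class of \<open>a r\<close> in \<open>(\<int>/g)\<^sup>\<times>/{\<plusminus>1}\<close>.\<close>

definition cusp_orbit_reps :: "nat \<Rightarrow> (nat \<Rightarrow> int) \<Rightarrow> (nat \<Rightarrow> int) \<Rightarrow> bool" where
  "cusp_orbit_reps N a c \<longleftrightarrow>
     (\<forall>r\<le>N div 2. coprime (a r) (c r)) \<and>
     bij_betw (\<lambda>r. galois_orbit N (cusp N (a r) (c r))) {..N div 2} (galois_orbit N ` cusps N) \<and>
     cusp N (a (N div 2)) (c (N div 2)) = cusp N 1 (int N)"

definition cusp_g :: "nat \<Rightarrow> (nat \<Rightarrow> int) \<Rightarrow> nat \<Rightarrow> nat" where
  "cusp_g N c r = nat (gcd (c r) (int N))"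

text \<open>For \<open>g = 1\<close> and \<open>g = 2\<close> the group \<open>(\<int>/g)\<^sup>\<times>/{\<plusminus>1}\<close> is trivial, so the conditions
  \<open>(g, a) = (1, 1)\<close> and \<open>(g, a) = (2, 1)\<close> just say \<open>g = 1\<close> and \<open>g = 2\<close>.\<close>

definition cusp_mu :: "nat \<Rightarrow> (nat \<Rightarrow> int) \<Rightarrow> nat \<Rightarrow> rat" where
  "cusp_mu N c r =
     (let g = cusp_g N c r
      in if g = 1 then of_nat (totient N) / 2
         else if g = 2 then of_nat (totient (N div 2)) / 2
         else of_nat (totient (N div g)))"

section \<open>The matrices \<open>A\<^sub>N\<close>, \<open>B\<^sub>N\<close>, \<open>V\<^sub>N\<close>\<close>

definition bernoulli2 :: "rat \<Rightarrow> rat" where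
  "bernoulli2 x = x\<^sup>2 - x + 1 / 6"

definition A_mat :: "nat \<Rightarrow> (nat \<Rightarrow> int) \<Rightarrow> (nat \<Rightarrow> int) \<Rightarrow> rat mat" where
  "A_mat N a c = mat (N div 2) (N div 2) (\<lambda>(r, j).
     let g = of_nat (cusp_g N c r)
     in g / 2 * bernoulli2 (frac (of_nat (j + 1) * of_int (a r) / g)))"

definition basis_vec :: "nat \<Rightarrow> nat \<Rightarrow> int vec" where
  "basis_vec N j = unit_vec (N div 2) (j - 1)"

text \<open>All divisions by \<open>3\<close> below are exact.\<close>

definition B_cols :: "nat \<Rightarrow> int vec list" where
  "B_cols N =
     (let m = N div 2;
          e = basis_vec N;
          M = int N * gcd 2 (int N);
          r = (2 * M) mod 3;
          a = (- M + 5 * r) div 3;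
          b = (M - 8 * r) div 3;
          js = filter (\<lambda>j. 3 dvd j) [3..<m + 1];
          j1 = hd js
      in [16 \<cdot>\<^sub>v e 1 - 4 \<cdot>\<^sub>v e 2,
          a \<cdot>\<^sub>v e 1 + b \<cdot>\<^sub>v e 2 + r \<cdot>\<^sub>v e 3]
         @ map (\<lambda>j. (((int j)\<^sup>2 - 4) div 3) \<cdot>\<^sub>v e 1 - (((int j)\<^sup>2 - 1) div 3) \<cdot>\<^sub>v e 2 + e j)
             (filter (\<lambda>j. \<not> 3 dvd j) [3..<m + 1])
         @ [((int j1)\<^sup>2 - 4) \<cdot>\<^sub>v e 1 - ((int j1)\<^sup>2 - 1) \<cdot>\<^sub>v e 2 + 3 \<cdot>\<^sub>v e j1]
         @ map (\<lambda>j. (((int j)\<^sup>2 - (int j1)\<^sup>2) div 3) \<cdot>\<^sub>v (e 1 - e 2) - e j1 + e j) (tl js))"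

text \<open>Only meant for \<open>N \<ge> 5\<close>, as is \<open>a1_vec\<close>.\<close>

definition B_mat :: "nat \<Rightarrow> int mat" where
  "B_mat N = (if N = 5 then mat_of_rows_list 2 [[16, -5], [-4, 5]]
              else mat_of_cols (N div 2) (B_cols N))"

definition class_mat :: "nat \<Rightarrow> (nat \<Rightarrow> int) \<Rightarrow> (nat \<Rightarrow> int) \<Rightarrow> rat mat" where
  "class_mat N a c = A_mat N a c * map_mat of_int (B_mat N)"

definition smith_normal_form ::
  "nat \<Rightarrow> rat mat \<Rightarrow> int mat \<Rightarrow> int mat \<Rightarrow> (nat \<Rightarrow> nat) \<Rightarrow> bool" where
  "smith_normal_form m V P Q d \<longleftrightarrow>
     P \<in> carrier_mat m m \<and> invertible_mat P \<and>
     Q \<in> carrier_mat m m \<and> invertible_mat Q \<and>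
     map_mat of_int P * V * map_mat of_int Q =
       mat m m (\<lambda>(i, j). if i = j then of_nat (d i) else 0) \<and>
     (\<forall>i. Suc i < m \<longrightarrow> d i dvd d (Suc i))"

section \<open>The ingredients of the counting formula\<close>

definition a1_vec :: "nat \<Rightarrow> int vec" where
  "a1_vec N = (if N = 5 then vec_of_list [-3, 2]
     else (-3) \<cdot>\<^sub>v basis_vec N 1 + 3 \<cdot>\<^sub>v basis_vec N 2 - basis_vec N 3)"

definition alpha_vec :: "nat \<Rightarrow> (nat \<Rightarrow> int) \<Rightarrow> (nat \<Rightarrow> int) \<Rightarrow> int mat \<Rightarrow> rat vec" where
  "alpha_vec N a c P =
     - (map_mat of_int P *\<^sub>v
        ((1 / 12) \<cdot>\<^sub>v vec (N div 2) (\<lambda>r. of_nat (cusp_g N c r))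
         + A_mat N a c *\<^sub>v map_vec of_int (a1_vec N)))"

definition omega :: "(nat \<Rightarrow> nat) \<Rightarrow> nat \<Rightarrow> complex" where
  "omega d i = exp (2 * of_real pi * \<i> / of_nat (d i))"

text \<open>The entries of \<open>alpha_vec\<close> are integers, so the floor only changes their type.\<close>

definition xi :: "nat \<Rightarrow> (nat \<Rightarrow> int) \<Rightarrow> (nat \<Rightarrow> int) \<Rightarrow> int mat \<Rightarrow> (nat \<Rightarrow> nat) \<Rightarrow> (nat \<Rightarrow> nat) \<Rightarrow> complex" where
  "xi N a c P d j = (\<Prod>i<N div 2. omega d i powi (int (j i) * \<lfloor>alpha_vec N a c P $ i\<rfloor>))"

definition chi :: "nat \<Rightarrow> int mat \<Rightarrow> (nat \<Rightarrow> nat) \<Rightarrow> nat \<Rightarrow> (nat \<Rightarrow> nat) \<Rightarrow> complex" where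
  "chi N P d r j = (if r < N div 2
     then \<Prod>i<N div 2. omega d i powi (int (j i) * P $$ (i, r))
     else 1)"

definition W :: "nat \<Rightarrow> (nat \<Rightarrow> int) \<Rightarrow> int mat \<Rightarrow> (nat \<Rightarrow> nat) \<Rightarrow> (nat \<Rightarrow> nat) \<Rightarrow> rat \<Rightarrow> complex" where
  "W N c P d j n =
     (\<Sum>v \<in> {v \<in> {..N div 2} \<rightarrow>\<^sub>E UNIV. (\<Sum>r\<le>N div 2. cusp_mu N c r * of_nat (v r)) = n}.
        \<Prod>r\<le>N div 2. chi N P d r j ^ v r)"

definition R_num :: "nat \<Rightarrow> rat" where
  "R_num N = 1 / 24 * of_nat (\<Sum>e | e dvd N. e * totient e * totient (N div e))"

end

theory Submission
  imports Defs "HOL-Complex_Analysis.Complex_Analysis"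
begin

unbundle no vec_syntax
unbundle no Formal_Power_Series.fps_syntax
unbundle no Formal_Laurent_Series.fps_syntax
hide_const (open) Finite_Cartesian_Product.vec Finite_Cartesian_Product.mat
  Finite_Cartesian_Product.row Finite_Cartesian_Product.column

text \<open>The product is a power of \<open>\<eta>\<^sup>2\<close> times Klein forms at \<open>N\<tau>\<close>. The transformation law of
  the Klein forms follows from Liouville's theorem, that of \<open>\<eta>\<^sup>2\<^sup>4\<close> from the Klein forms at the
  points of order \<open>2\<close>. So the product is modular iff \<open>12\<close> divides \<open>k + \<Sum>a\<^sub>j\<close>,
  \<open>N gcd(2, N)\<close> divides \<open>\<Sum>j\<^sup>2a\<^sub>j\<close> (together: \<open>a\<close> lies in the coset of \<open>k a\<^sup>(\<^sup>1\<^sup>)\<close> modulo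
  the columns of \<open>B\<^sub>N\<close>), and all orders at cusps are nonnegative. The orders on this coset are
  integers constant on Galois orbits, their sum with weights \<open>\<mu>\<^sub>r\<close> is \<open>k R\<^sub>N\<close>, and a tuple of
  integers with this sum arises from a (unique) \<open>a\<close> iff it satisfies congruences modulo the
  \<open>d\<^sub>i\<close>. These are detected by the characters of \<open>\<Prod>\<^sub>i \<int>/d\<^sub>i\<close>. The \<open>d\<^sub>i\<close> are positive
  since \<open>A\<^sub>N\<close> is nonsingular, which follows from the finite Fourier expansion of \<open>B\<^sub>2\<close>.\<close>

section \<open>q-products and the Jacobi theta function\<close>

text \<open>The multiplier of \<open>eta2\<close> is a twelfth root of unity that is never computed.
  Only \<open>eta2 ^ 12\<close> enters: on \<Gamma>_1(N) because 12 divides k + sum a_j, and at a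
  cusp because the slashed product is expanded only after taking its twelfth power. Hence the factor
  12 in all exponents at cusps, and the need to extract a holomorphic twelfth root afterwards.

  V_N has m rows although there are m + 1 orbits of cusps: the order at the last cusp is determined
  by the others through the weighted sum, whose weights are positive. For the same reason chi_m = 1
  in the formula. That the weighted sum does not depend on a comes down to the values B_2(<jx/N>)
  summing to 0 over the points (x, y) of exact order N in (Z/N)^2, whenever N does not divide
  j.\<close>

definition ep :: "complex \<Rightarrow> complex" where
  "ep z = exp (2 * of_real pi * \<i> * z)"

lemma ep_add: "ep (x + y) = ep x * ep y"
  by (simp add: ep_def exp_add ring_distribs)

lemma ep_diff: "ep (x - y) = ep x / ep y"
  by (simp add: ep_def exp_diff ring_distribs)

lemma ep_minus: "ep (- x) = 1 / ep x"
  by (simp add: ep_def exp_minus field_simps)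

lemma ep_0 [simp]: "ep 0 = 1"
  by (simp add: ep_def)

lemma ep_nonzero [simp]: "ep x \<noteq> 0"
  by (simp add: ep_def)

lemma ep_eq_1_iff: "ep z = 1 \<longleftrightarrow> z \<in> \<int>"
proof -
  have "ep z = 1 \<longleftrightarrow> (\<exists>n::int. 2 * of_real pi * \<i> * z = of_int (2 * n) * of_real pi * \<i>)"
    unfolding ep_def by (subst exp_eq_1) (auto simp: complex_eq_iff)
  also have "\<dots> \<longleftrightarrow> (\<exists>n::int. z = of_int n)"
    by simp
  finally show ?thesis by (auto simp: Ints_def)
qed

lemma ep_Ints: "z \<in> \<int> \<Longrightarrow> ep z = 1"
  by (simp add: ep_eq_1_iff)

lemma ep_cong: "x - y \<in> \<int> \<Longrightarrow> ep x = ep y"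
  using ep_diff[of x y] by (simp add: ep_Ints)

lemma ep_of_int [simp]: "ep (of_int n) = 1"
  by (simp add: ep_Ints)

lemma ep_1 [simp]: "ep 1 = 1"
  by (simp add: ep_Ints)

lemma ep_half: "ep (1 / 2) = - 1"
  by (simp add: ep_def)

lemma ep_power: "ep x ^ n = ep (of_nat n * x)"
  by (induction n) (simp_all add: ep_add ring_distribs)

lemma ep_powi: "ep x powi n = ep (of_int n * x)"
proof (cases "n \<ge> 0")
  case True
  then show ?thesis by (simp add: power_int_def ep_power)
next
  case False
  then have "ep x powi n = 1 / ep x ^ nat (- n)"
    by (simp add: power_int_def divide_simps)
  then show ?thesis using False by (simp add: ep_power flip: ep_minus)
qed

lemma norm_ep: "norm (ep z) = exp (- 2 * pi * Im z)"
  by (simp add: ep_def)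

lemma norm_ep_less_1: "norm (ep z) < 1 \<longleftrightarrow> Im z > 0"
  by (simp add: norm_ep zero_less_mult_iff)

lemma ep_holomorphic [holomorphic_intros]:
  "f holomorphic_on S \<Longrightarrow> (\<lambda>z. ep (f z)) holomorphic_on S"
  unfolding ep_def by (intro holomorphic_intros)

section \<open>Infinite q-products\<close>

lemma qpoch_convergent:
  assumes "norm (q :: complex) < 1"
  shows "convergent_prod (\<lambda>n. 1 - x * q ^ n)"
proof -
  have "summable (\<lambda>n. norm x * norm q ^ n)"
    using assms by (intro summable_mult summable_geometric) auto
  then have "abs_convergent_prod (\<lambda>n. 1 + (- (x * q ^ n)))"
    by (intro summable_imp_abs_convergent_prod) (simp add: norm_mult norm_power)
  then show ?thesis
    using abs_convergent_prod_imp_convergent_prod by fastforce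
qed

lemma qpoch_LIMSEQ:
  assumes "norm q < 1"
  shows "(\<lambda>n. \<Prod>k<n. 1 - x * q ^ k) \<longlonglongrightarrow> qpoch_inf x q"
proof -
  have "(\<lambda>n. \<Prod>k\<le>n. 1 - x * q ^ k) \<longlonglongrightarrow> qpoch_inf x q"
    unfolding qpoch_inf_def by (rule convergent_prod_LIMSEQ[OF qpoch_convergent[OF assms]])
  then have "(\<lambda>n. \<Prod>k<Suc n. 1 - x * q ^ k) \<longlonglongrightarrow> qpoch_inf x q"
    by (simp only: lessThan_Suc_atMost)
  then show ?thesis
    by (rule filterlim_sequentially_Suc[THEN iffD1])
qed

lemma qpoch_rec:
  assumes "norm q < 1"
  shows "qpoch_inf x q = (1 - x) * qpoch_inf (x * q) q"
proof -
  have "(\<lambda>n. (1 - x) * (\<Prod>k<n. 1 - (x * q) * q ^ k)) \<longlonglongrightarrow> (1 - x) * qpoch_inf (x * q) q"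
    by (intro tendsto_intros qpoch_LIMSEQ assms)
  moreover have "(1 - x) * (\<Prod>k<n. 1 - (x * q) * q ^ k) = (\<Prod>k<Suc n. 1 - x * q ^ k)" for n
    by (subst prod.lessThan_Suc_shift) (simp add: mult_ac)
  moreover have "(\<lambda>n. \<Prod>k<Suc n. 1 - x * q ^ k) \<longlonglongrightarrow> qpoch_inf x q"
    by (rule filterlim_sequentially_Suc[THEN iffD2, OF qpoch_LIMSEQ[OF assms]])
  ultimately show ?thesis using LIMSEQ_unique by (simp only:) blast
qed

lemma qpoch_eq_0_iff:
  assumes "norm q < 1"
  shows "qpoch_inf x q = 0 \<longleftrightarrow> (\<exists>n. x * q ^ n = 1)"
proof -
  have "(\<lambda>n. 1 - x * q ^ n) has_prod qpoch_inf x q"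
    unfolding qpoch_inf_def by (rule convergent_prod_has_prod[OF qpoch_convergent[OF assms]])
  then have "qpoch_inf x q = 0 \<longleftrightarrow> 0 \<in> range (\<lambda>n. 1 - x * q ^ n)"
    by (rule has_prod_eq_0_iff)
  then show ?thesis by (auto simp: image_iff)
qed

lemma qpoch_nonzero:
  assumes "norm q < 1" "norm x < 1"
  shows "qpoch_inf x q \<noteq> 0"
proof -
  have "norm (x * q ^ n) < 1" for n
  proof -
    have "norm x * norm q ^ n \<le> norm x * 1"
      by (intro mult_left_mono power_le_one) (use assms in auto)
    then show ?thesis using assms by (simp add: norm_mult norm_power)
  qed
  then show ?thesis using qpoch_eq_0_iff[OF assms(1)] by (metis norm_one less_irrefl)
qed

text \<open>Together with \<open>qpoch_split\<close> this yields the identity of Euler used in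
  \<open>klein_half_product\<close>.\<close>

lemma qpoch_mult_minus:
  assumes "norm q < 1"
  shows "qpoch_inf x q * qpoch_inf (- x) q = qpoch_inf (x ^ 2) (q ^ 2)"
proof -
  have "(\<lambda>n. (\<Prod>k<n. 1 - x * q ^ k) * (\<Prod>k<n. 1 - (- x) * q ^ k))
      \<longlonglongrightarrow> qpoch_inf x q * qpoch_inf (- x) q"
    by (intro tendsto_intros qpoch_LIMSEQ assms)
  moreover have "(\<Prod>k<n. 1 - x * q ^ k) * (\<Prod>k<n. 1 - (- x) * q ^ k) =
      (\<Prod>k<n. 1 - x ^ 2 * (q ^ 2) ^ k)" for n
    unfolding prod.distrib[symmetric]
    by (intro prod.cong) (simp_all add: algebra_simps power2_eq_square power_mult_distrib)
  moreover have "norm (q ^ 2) < 1"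
    using assms by (simp add: norm_power power_less_one_iff)
  ultimately have "(\<lambda>n. \<Prod>k<n. 1 - x ^ 2 * (q ^ 2) ^ k) \<longlonglongrightarrow> qpoch_inf x q * qpoch_inf (- x) q"
    by (simp only:)
  then show ?thesis
    by (rule LIMSEQ_unique) (rule qpoch_LIMSEQ, fact)
qed

lemma qpoch_split:
  assumes "norm q < 1"
  shows "qpoch_inf x (q ^ 2) * qpoch_inf (x * q) (q ^ 2) = qpoch_inf x q"
proof -
  have q2: "norm (q ^ 2) < 1"
    using assms by (simp add: norm_power power_less_one_iff)
  have "(\<lambda>n. (\<Prod>k<n. 1 - x * (q ^ 2) ^ k) * (\<Prod>k<n. 1 - (x * q) * (q ^ 2) ^ k))
      \<longlonglongrightarrow> qpoch_inf x (q ^ 2) * qpoch_inf (x * q) (q ^ 2)"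
    by (intro tendsto_intros qpoch_LIMSEQ q2)
  moreover have "(\<Prod>k<n. 1 - x * (q ^ 2) ^ k) * (\<Prod>k<n. 1 - (x * q) * (q ^ 2) ^ k) =
      (\<Prod>k<2 * n. 1 - x * q ^ k)" for n
    by (induction n) (simp_all add: mult_ac flip: power_mult)
  moreover have "(\<lambda>n. \<Prod>k<2 * n. 1 - x * q ^ k) \<longlonglongrightarrow> qpoch_inf x q"
    using LIMSEQ_subseq_LIMSEQ[OF qpoch_LIMSEQ[OF assms, of x], of "\<lambda>n. 2 * n"]
    by (simp add: o_def strict_mono_def)
  ultimately show ?thesis using LIMSEQ_unique by (simp only:) blast
qed

text \<open>Both arguments may vary, because the products occur as functions of z, of \<tau> and of
  the variable of the unit disc. On a closed disc the maxima of |X| and |Q| give a geometric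
  majorant.\<close>

lemma qpoch_holomorphic:
  assumes S: "open S" and X: "X holomorphic_on S" and Q: "Q holomorphic_on S"
    and less: "\<And>w. w \<in> S \<Longrightarrow> norm (Q w) < 1"
  shows "(\<lambda>w. qpoch_inf (X w) (Q w)) holomorphic_on S"
proof (rule holomorphic_uniform_sequence[OF S])
  show "(\<lambda>w. \<Prod>k<n. 1 - X w * Q w ^ k) holomorphic_on S" for n
    by (intro holomorphic_intros X Q)
next
  fix z assume "z \<in> S"
  then obtain d where d: "d > 0" "cball z d \<subseteq> S"
    using S open_contains_cball by metis
  let ?A = "cball z d"
  have cont: "continuous_on ?A X" "continuous_on ?A Q"
    using X Q d holomorphic_on_imp_continuous_on holomorphic_on_subset by blast+
  obtain y where y: "y \<in> ?A" "\<And>w. w \<in> ?A \<Longrightarrow> norm (Q w) \<le> norm (Q y)"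
    using continuous_attains_sup[of ?A "\<lambda>w. norm (Q w)"] cont d
    by (metis compact_cball continuous_on_norm centre_in_cball empty_iff less_eq_real_def)
  obtain y' where y': "\<And>w. w \<in> ?A \<Longrightarrow> norm (X w) \<le> norm (X y')"
    using continuous_attains_sup[of ?A "\<lambda>w. norm (X w)"] cont d
    by (metis compact_cball continuous_on_norm centre_in_cball empty_iff less_eq_real_def)
  have r: "norm (Q y) < 1" using y d less by blast
  have "uniformly_convergent_on ?A (\<lambda>n w. \<Sum>k<n. norm (- (X w * Q w ^ k)))"
  proof (rule Weierstrass_m_test')
    fix k w assume w: "w \<in> ?A"
    have "norm (X w) * norm (Q w) ^ k \<le> norm (X y') * norm (Q y) ^ k"
      by (intro mult_mono power_mono y y' w) auto
    then show "norm (norm (- (X w * Q w ^ k))) \<le> norm (X y') * norm (Q y) ^ k"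
      by (simp add: norm_mult norm_power)
  next
    show "summable (\<lambda>k. norm (X y') * norm (Q y) ^ k)"
      using r by (intro summable_mult summable_geometric) auto
  qed
  then have "uniformly_convergent_on ?A (\<lambda>n w. \<Prod>k<n. 1 + - (X w * Q w ^ k))"
    by (intro uniformly_convergent_on_prod continuous_intros cont) auto
  then obtain l where l: "uniform_limit ?A (\<lambda>n w. \<Prod>k<n. 1 - X w * Q w ^ k) l sequentially"
    by (auto simp: uniformly_convergent_on_def)
  have "l w = qpoch_inf (X w) (Q w)" if "w \<in> ?A" for w
    using tendsto_uniform_limitI[OF l that] qpoch_LIMSEQ[of "Q w" "X w"] less that d
    using LIMSEQ_unique by blast
  then have "uniform_limit ?A (\<lambda>n w. \<Prod>k<n. 1 - X w * Q w ^ k) (\<lambda>w. qpoch_inf (X w) (Q w)) sequentially"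
    using l by (subst uniform_limit_cong'[where g = "\<lambda>n w. \<Prod>k<n. 1 - X w * Q w ^ k" and i = l]) simp_all
  then show "\<exists>d>0. cball z d \<subseteq> S \<and>
      uniform_limit (cball z d) (\<lambda>n w. \<Prod>k<n. 1 - X w * Q w ^ k) (\<lambda>w. qpoch_inf (X w) (Q w)) sequentially"
    using d by blast
qed

section \<open>Entire elliptic functions\<close>

lemma period_int:
  assumes "\<And>z :: complex. R (z + p) = R z"
  shows "R (z + of_int n * p) = R z"
proof (induction n rule: int_induct[where k = 0])
  case (step1 i)
  then show ?case using assms[of "z + of_int i * p"] by (simp add: ring_distribs add_ac)
next
  case (step2 i)
  then show ?case using assms[of "z + of_int (i - 1) * p"] by (simp add: algebra_simps)
qed simp

text \<open>All values are taken on the compact fundamental parallelogram K, so the function is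
  bounded and Liouville's theorem applies.\<close>

lemma doubly_periodic_constant:
  assumes \<tau>: "Im \<tau> > 0" and R: "R holomorphic_on UNIV"
    and p: "\<And>z. R (z + 1) = R z" "\<And>z. R (z + \<tau>) = R z"
  shows "R z = R 0"
proof -
  define K where "K = (\<lambda>(a, b). of_real a + of_real b * \<tau>) ` ({0..1::real} \<times> {0..1::real})"
  have "compact K"
    unfolding K_def case_prod_beta
    by (intro compact_continuous_image continuous_intros compact_Times) auto
  then have "bounded (R ` K)"
    using R by (intro compact_imp_bounded compact_continuous_image)
      (auto intro: holomorphic_on_imp_continuous_on continuous_on_subset)
  moreover have "range R \<subseteq> R ` K"
  proof
    fix y assume "y \<in> range R"
    then obtain z where y: "y = R z" by auto
    define b where "b = Im z / Im \<tau>"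
    define a where "a = Re z - b * Re \<tau>"
    have z: "z = of_real a + of_real b * \<tau>"
      using \<tau> by (simp add: complex_eq_iff a_def b_def)
    define z' where "z' = of_real (frac a) + of_real (frac b) * \<tau>"
    have "z = z' + of_int \<lfloor>a\<rfloor> * 1 + of_int \<lfloor>b\<rfloor> * \<tau>"
      unfolding z z'_def frac_def by (simp add: complex_eq_iff algebra_simps)
    then have "R z = R z'"
      using period_int[of R, OF p(1), of "z'" "\<lfloor>a\<rfloor>"] period_int[of R, OF p(2), of "z' + of_int \<lfloor>a\<rfloor> * 1" "\<lfloor>b\<rfloor>"] by simp
    moreover have "z' \<in> K"
      unfolding K_def z'_def using frac_lt_1 by (fastforce intro: less_imp_le)
    ultimately show "y \<in> R ` K" using y by blast
  qed
  ultimately have "bounded (range R)" using bounded_subset by blast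
  then show ?thesis using Liouville_theorem[OF R] by (metis UNIV_I constant_on_def)
qed

text \<open>The quotient of the two functions extends to an entire elliptic function.\<close>

lemma quasi_elliptic_proportional:
  assumes \<tau>: "Im \<tau> > 0" and f: "f holomorphic_on UNIV" and g: "g holomorphic_on UNIV"
    and 1: "\<And>z. f (z + 1) = u z * f z" "\<And>z. g (z + 1) = u z * g z" "\<And>z. u z \<noteq> 0"
    and 2: "\<And>z. f (z + \<tau>) = v z * f z" "\<And>z. g (z + \<tau>) = v z * g z" "\<And>z. v z \<noteq> 0"
    and zeros: "\<And>z. g z = 0 \<Longrightarrow> \<exists>m n. z = of_int m + of_int n * \<tau>"
    and 0: "f 0 = 0" "g 0 = 0" "(f has_field_derivative f') (at 0)"
      "(g has_field_derivative g') (at 0)" "g' \<noteq> 0"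
  shows "g' * f z = f' * g z"
proof -
  \<comment> \<open>The zeros of \<open>g\<close> are lattice points; by periodicity the limit of
    \<open>f / g\<close> there is its limit at 0, which is \<open>f' / g'\<close> since the zero at
    0 is simple.\<close>
  define R where "R = (\<lambda>z. if g z = 0 then f' / g' else f z / g z)"
  have p: "R (z + 1) = R z" "R (z + \<tau>) = R z" for z
    by (auto simp: R_def 1 2)
  have cont_g: "continuous_on UNIV g" using g holomorphic_on_imp_continuous_on by blast
  define V where "V = {z. g z \<noteq> 0}"
  have "open V"
    unfolding V_def using open_Collect_neq[OF cont_g continuous_on_const, of 0] by simp
  have R_V: "R holomorphic_on V"
  proof (rule holomorphic_transform[of "\<lambda>z. f z / g z"])
    show "(\<lambda>z. f z / g z) holomorphic_on V"
      by (intro holomorphic_intros holomorphic_on_subset[OF f] holomorphic_on_subset[OF g])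
        (auto simp: V_def)
  qed (auto simp: R_def V_def)
  have lim_g: "((\<lambda>z. g z / z) \<longlongrightarrow> g') (at 0)"
    using 0(4) 0(2) by (simp add: has_field_derivative_iff)
  have lim_f: "((\<lambda>z. f z / z) \<longlongrightarrow> f') (at 0)"
    using 0(3) 0(1) by (simp add: has_field_derivative_iff)
  have ev: "eventually (\<lambda>z. g z / z \<noteq> 0) (at 0)"
    using tendsto_imp_eventually_ne[OF lim_g 0(5)] .
  then have ev': "eventually (\<lambda>z. g z \<noteq> 0) (at 0)"
    by eventually_elim auto
  have "((\<lambda>z. (f z / z) / (g z / z)) \<longlongrightarrow> f' / g') (at 0)"
    by (intro tendsto_intros lim_f lim_g 0)
  moreover have "eventually (\<lambda>z. (f z / z) / (g z / z) = R z) (at 0)"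
    using ev by eventually_elim (auto simp: R_def)
  ultimately have lim_R: "(R \<longlongrightarrow> R 0) (at 0)"
    using 0(2) tendsto_cong by (fastforce simp: R_def)
  obtain e where e: "e > 0" "\<And>z. z \<noteq> 0 \<Longrightarrow> dist z 0 < e \<Longrightarrow> g z \<noteq> 0"
    using ev' by (auto simp: eventually_at)
  have R_0: "R holomorphic_on ball 0 e"
  proof (rule no_isolated_singularity'[where K = "{0}"])
    show "(R \<longlongrightarrow> R z) (at z within ball 0 e)" if "z \<in> {0}" for z
      using lim_R that tendsto_within_subset by blast
    show "R holomorphic_on ball 0 e - {0}"
      using e by (intro holomorphic_on_subset[OF R_V]) (auto simp: V_def dist_commute)
  qed auto
  have "R field_differentiable at z" for z
  proof (cases "g z = 0")
    case False
    then show ?thesis using R_V \<open>open V\<close> holomorphic_on_imp_differentiable_at[of R V z] by (simp add: V_def)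
  next
    case True
    then obtain m n where z: "z = of_int m + of_int n * \<tau>" using zeros by blast
    \<comment> \<open>Translation by the lattice point z moves the question to the removable
      singularity at 0.\<close>
    have eq: "R = (\<lambda>y. R (y - z))"
    proof
      fix y
      show "R y = R (y - z)"
        using period_int[of R, OF p(1), of "y - z" m] period_int[of R, OF p(2), of "y - z + of_int m * 1" n]
        by (simp add: z)
    qed
    obtain D where "(R has_field_derivative D) (at (z - z))"
      using holomorphic_on_imp_differentiable_at[OF R_0, of 0] e
      by (auto simp: field_differentiable_def)
    then have "((\<lambda>y. R (y - z)) has_field_derivative D * 1) (at z)"
      by (rule DERIV_chain2) (auto intro!: derivative_eq_intros)
    then show ?thesis using eq field_differentiable_def by metis
  qed
  then have "R holomorphic_on UNIV"
    by (simp add: holomorphic_on_def)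
  then have "R z = R 0" using doubly_periodic_constant[OF \<tau>] p by blast
  then have "R z = f' / g'" by (simp add: R_def 0)
  \<comment> \<open>Where \<open>g\<close> vanishes, R carries no information on \<open>f\<close>,
    so the identity there needs that \<open>f\<close> vanishes at all lattice points too.\<close>
  moreover have "f z = 0" if "g z = 0"
  proof -
    obtain m n where z: "z = of_int m + of_int n * \<tau>" using zeros[OF \<open>g z = 0\<close>] by blast
    have q1: "(f (y + 1) = 0) = (f y = 0)" "(f (y + \<tau>) = 0) = (f y = 0)" for y by (auto simp: 1 2)
    show ?thesis
      using period_int[of "\<lambda>z. f z = 0", OF q1(1), of "0" m] period_int[of "\<lambda>z. f z = 0", OF q1(2), of "of_int m * 1" n]
      by (simp add: z 0)
  qed
  ultimately show ?thesis using 0(5) by (auto simp: R_def field_simps split: if_splits)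
qed

section \<open>The Jacobi theta function\<close>

text \<open>Up to a constant this is \<theta>_1 / \<eta>^3, a Jacobi form of weight -1 and index
  1/2. Dividing by \<eta>^3 removes the multiplier and makes the derivative at 0 independent of
  \<tau>.\<close>

definition jtheta :: "complex \<Rightarrow> complex \<Rightarrow> complex" where
  "jtheta z \<tau> = - ep (- z / 2) * qpoch_inf (ep z) (ep \<tau>) * qpoch_inf (ep \<tau> / ep z) (ep \<tau>) /
     qpoch_inf (ep \<tau>) (ep \<tau>) ^ 2"

lemma qpoch_self_nonzero: "Im \<tau> > 0 \<Longrightarrow> qpoch_inf (ep \<tau>) (ep \<tau>) \<noteq> 0"
  by (intro qpoch_nonzero) (simp_all add: norm_ep_less_1)

lemma jtheta_add_1: "jtheta (z + 1) \<tau> = ep (1 / 2) * jtheta z \<tau>"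
proof -
  have "ep (- (z + 1) / 2) = ep (1 / 2) * ep (- z / 2)"
    unfolding ep_add[symmetric] by (rule ep_cong) (simp add: field_simps)
  then show ?thesis
    by (simp add: jtheta_def ep_add)
qed

lemma jtheta_add_tau:
  assumes "Im \<tau> > 0"
  shows "jtheta (z + \<tau>) \<tau> = ep (1 / 2 - z - \<tau> / 2) * jtheta z \<tau>"
proof -
  have q: "norm (ep \<tau>) < 1" using assms by (simp add: norm_ep_less_1)
  have 1: "qpoch_inf (ep z) (ep \<tau>) = (1 - ep z) * qpoch_inf (ep z * ep \<tau>) (ep \<tau>)"
    by (rule qpoch_rec[OF q])
  have 2: "qpoch_inf (1 / ep z) (ep \<tau>) = (1 - 1 / ep z) * qpoch_inf (ep \<tau> / ep z) (ep \<tau>)"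
    using qpoch_rec[OF q, of "1 / ep z"] by simp
  have 3: "ep (- (z + \<tau>) / 2) = ep (- z / 2) * ep (- \<tau> / 2)"
    unfolding ep_add[symmetric] by (simp add: field_simps)
  have 4: "ep (1 / 2 - z - \<tau> / 2) = - ep (- \<tau> / 2) / ep z"
    using ep_half by (simp add: ep_diff ep_minus)
  show ?thesis
    unfolding jtheta_def ep_add 1 3 4 by (simp add: 2 field_simps)
qed

text \<open>The l-fold shift by \<tau> collects the exponents -(z + i \<tau>) - \<tau>/2 for i < l,
  which add up to -l z - l^2 \<tau>/2.\<close>

lemma jtheta_add_lattice:
  assumes "Im \<tau> > 0"
  shows "jtheta (z + of_int l * \<tau> + of_int n) \<tau> =
    ep (of_int (l + n) / 2 - of_int l * z - of_int l ^ 2 * \<tau> / 2) * jtheta z \<tau>"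
proof -
  have 1: "jtheta (z + of_int n) \<tau> = ep (of_int n / 2) * jtheta z \<tau>" for z n
  proof (induction n rule: int_induct[where k = 0])
    case (step1 i)
    have "jtheta (z + of_int (i + 1)) \<tau> = jtheta ((z + of_int i) + 1) \<tau>"
      by (simp add: add_ac)
    also have "\<dots> = (ep (1 / 2) * ep (of_int i / 2)) * jtheta z \<tau>"
      by (simp only: jtheta_add_1 step1 mult.assoc)
    finally show ?case unfolding ep_add[symmetric] by (simp add: add_divide_distrib add_ac)
  next
    case (step2 i)
    have "ep (1 / 2) * jtheta (z + of_int (i - 1)) \<tau> = jtheta ((z + of_int (i - 1)) + 1) \<tau>"
      by (simp only: jtheta_add_1)
    also have "\<dots> = ep (of_int i / 2) * jtheta z \<tau>"
      using step2 by simp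
    also have "of_int i / 2 = (1 / 2 + of_int (i - 1) / 2 :: complex)"
      by (simp add: field_simps)
    finally show ?case by (simp only: ep_add mult.assoc mult_cancel_left ep_nonzero simp_thms)
  qed simp
  have 2: "jtheta (z + of_int l * \<tau>) \<tau> = ep (of_int l / 2 - of_int l * z - of_int l ^ 2 * \<tau> / 2) * jtheta z \<tau>"
  proof (induction l rule: int_induct[where k = 0])
    case (step1 i)
    have "jtheta (z + of_int (i + 1) * \<tau>) \<tau> = jtheta ((z + of_int i * \<tau>) + \<tau>) \<tau>"
      by (simp add: algebra_simps)
    also have "\<dots> = ep (1 / 2 - (z + of_int i * \<tau>) - \<tau> / 2) *
        ep (of_int i / 2 - of_int i * z - of_int i ^ 2 * \<tau> / 2) * jtheta z \<tau>"
      by (simp add: jtheta_add_tau[OF assms] step1)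
    also have "ep (1 / 2 - (z + of_int i * \<tau>) - \<tau> / 2) *
        ep (of_int i / 2 - of_int i * z - of_int i ^ 2 * \<tau> / 2) =
        ep (of_int (i + 1) / 2 - of_int (i + 1) * z - of_int (i + 1) ^ 2 * \<tau> / 2)"
      unfolding ep_add[symmetric] by (rule arg_cong[of _ _ ep]) (simp add: field_simps power2_eq_square)
    finally show ?case .
  next
    case (step2 i)
    let ?A = "ep (1 / 2 - (z + of_int (i - 1) * \<tau>) - \<tau> / 2)"
    have "?A * jtheta (z + of_int (i - 1) * \<tau>) \<tau> = jtheta ((z + of_int (i - 1) * \<tau>) + \<tau>) \<tau>"
      by (simp add: jtheta_add_tau[OF assms])
    also have "\<dots> = jtheta (z + of_int i * \<tau>) \<tau>"
      by (simp add: algebra_simps)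
    also have "\<dots> = ep (of_int i / 2 - of_int i * z - of_int i ^ 2 * \<tau> / 2) * jtheta z \<tau>"
      by (rule step2)
    also have "ep (of_int i / 2 - of_int i * z - of_int i ^ 2 * \<tau> / 2) =
        ?A * ep (of_int (i - 1) / 2 - of_int (i - 1) * z - of_int (i - 1) ^ 2 * \<tau> / 2)"
      unfolding ep_add[symmetric] by (rule arg_cong[of _ _ ep]) (simp add: field_simps power2_eq_square)
    finally show ?case by (simp only: mult.assoc mult_cancel_left ep_nonzero simp_thms)
  qed simp
  have "jtheta (z + of_int l * \<tau> + of_int n) \<tau> =
     (ep (of_int n / 2) * ep (of_int l / 2 - of_int l * z - of_int l ^ 2 * \<tau> / 2)) * jtheta z \<tau>"
    by (simp add: 1 2)
  then show ?thesis unfolding ep_add[symmetric] by (simp add: add_divide_distrib algebra_simps)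
qed

lemma jtheta_holomorphic:
  assumes "Im \<tau> > 0"
  shows "(\<lambda>z. jtheta z \<tau>) holomorphic_on UNIV"
  unfolding jtheta_def
  by (intro holomorphic_intros qpoch_holomorphic)
    (use assms in \<open>simp_all add: norm_ep_less_1 qpoch_self_nonzero\<close>)

lemma jtheta_eq_0:
  assumes "Im \<tau> > 0" "jtheta z \<tau> = 0"
  shows "\<exists>m n. z = of_int m + of_int n * \<tau>"
proof -
  have q: "norm (ep \<tau>) < 1" using assms by (simp add: norm_ep_less_1)
  have "qpoch_inf (ep z) (ep \<tau>) = 0 \<or> qpoch_inf (ep \<tau> / ep z) (ep \<tau>) = 0"
    using assms qpoch_self_nonzero[OF assms(1)] by (auto simp: jtheta_def)
  then obtain n where "ep z * ep \<tau> ^ n = 1 \<or> ep \<tau> / ep z * ep \<tau> ^ n = 1"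
    using qpoch_eq_0_iff[OF q] by auto
  then have "z + of_nat n * \<tau> \<in> \<int> \<or> \<tau> - z + of_nat n * \<tau> \<in> \<int>"
    by (simp add: ep_power flip: ep_add ep_diff ep_eq_1_iff)
  then consider m where "z + of_nat n * \<tau> = of_int m" | m where "\<tau> - z + of_nat n * \<tau> = of_int m"
    by (auto simp: Ints_def)
  then show ?thesis
  proof cases
    case 1
    then have "z = of_int m + of_int (- int n) * \<tau>" by (simp add: algebra_simps)
    then show ?thesis by blast
  next
    case 2
    then have "z = of_int (- m) + of_int (int n + 1) * \<tau>" by (simp add: algebra_simps)
    then show ?thesis by blast
  qed
qed

lemma jtheta_0:
  assumes "Im \<tau> > 0"
  shows "jtheta 0 \<tau> = 0"
proof -
  have "qpoch_inf 1 (ep \<tau>) = 0"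
    using qpoch_rec[of "ep \<tau>" 1] assms by (simp add: norm_ep_less_1)
  then show ?thesis by (simp add: jtheta_def)
qed

lemma ep_has_field_derivative:
  "(ep has_field_derivative (2 * of_real pi * \<i> * ep z)) (at z)"
  unfolding ep_def by (auto intro!: derivative_eq_intros)

text \<open>The simple zero sits in the factor \<open>1 - ep z\<close>; of the cofactor U only the
  value -1 at 0 matters.\<close>

lemma jtheta_deriv_0:
  assumes "Im \<tau> > 0"
  shows "((\<lambda>z. jtheta z \<tau>) has_field_derivative (2 * of_real pi * \<i>)) (at 0)"
proof -
  define U where "U = (\<lambda>z. - ep (- z / 2) * qpoch_inf (ep z * ep \<tau>) (ep \<tau>) *
    qpoch_inf (ep \<tau> / ep z) (ep \<tau>) / qpoch_inf (ep \<tau>) (ep \<tau>) ^ 2)"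
  have q: "norm (ep \<tau>) < 1" using assms by (simp add: norm_ep_less_1)
  have "U holomorphic_on UNIV" unfolding U_def
    by (intro holomorphic_intros qpoch_holomorphic)
      (use assms in \<open>simp_all add: norm_ep_less_1 qpoch_self_nonzero\<close>)
  then obtain D where D: "(U has_field_derivative D) (at 0)"
    by (meson UNIV_I holomorphic_on_imp_differentiable_at open_UNIV field_differentiable_def)
  have "((\<lambda>z. (1 - ep z) * U z) has_field_derivative
      (1 - ep 0) * D + (0 - 2 * of_real pi * \<i> * ep 0) * U 0) (at 0)"
    by (intro DERIV_mult' DERIV_diff DERIV_const D ep_has_field_derivative)
  moreover have "(1 - ep z) * U z = jtheta z \<tau>" for z
    using qpoch_rec[OF q, of "ep z"] by (simp add: jtheta_def U_def)
  moreover have "U 0 = - 1"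
    using qpoch_self_nonzero[OF assms] by (simp add: U_def power2_eq_square)
  ultimately show ?thesis by simp
qed

lemma mobius_Im:
  fixes p q r s :: int
  assumes "p * s - q * r = 1" "Im \<tau> > 0"
  shows "of_int r * \<tau> + of_int s \<noteq> (0 :: complex)"
    and "Im ((of_int p * \<tau> + of_int q) / (of_int r * \<tau> + of_int s)) > 0"
proof -
  show nz: "of_int r * \<tau> + of_int s \<noteq> (0 :: complex)"
  proof
    assume 0: "of_int r * \<tau> + of_int s = (0 :: complex)"
    then have "Im (of_int r * \<tau> + of_int s) = 0" by simp
    then have "r = 0" using assms by simp
    then show False using 0 assms by simp
  qed
  have "Im ((of_int p * \<tau> + of_int q) / (of_int r * \<tau> + of_int s)) =
     of_int (p * s - q * r) * Im \<tau> / (norm (of_int r * \<tau> + of_int s)) ^ 2"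
    by (simp add: Im_divide cmod_def algebra_simps)
  then show "Im ((of_int p * \<tau> + of_int q) / (of_int r * \<tau> + of_int s)) > 0"
    using assms nz by simp
qed

text \<open>Modulo 2 the two numbers are (p + 1)(r + 1) and (q + 1)(s + 1), which are even because
  no column of the matrix is 0 modulo 2. In \<open>jtheta_modular\<close> they make the signs of the
  quasi-periods match.\<close>

lemma SL2_parity:
  fixes p q r s :: int
  assumes "p * s - q * r = 1"
  shows "even (p - r - r * p - 1)" "even (s + q + q * s + 1)"
proof -
  have *: "odd (p * s - q * r)" using assms by simp
  show "even (p - r - r * p - 1)" "even (s + q + q * s + 1)"
    using * by auto
qed

text \<open>With the Gaussian factor and z / J as argument, the theta function of \<tau>' acquires
  the quasi-periods of the theta function of \<tau>. Hence the two are proportional, and the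
  derivatives at 0 show that the factor is 1.\<close>

lemma jtheta_modular:
  fixes p q r s :: int
  assumes det: "p * s - q * r = 1" and \<tau>: "Im \<tau> > 0"
  defines "J \<equiv> of_int r * \<tau> + of_int s"
  defines "\<tau>' \<equiv> (of_int p * \<tau> + of_int q) / J"
  shows "jtheta (z / J) \<tau>' = ep (of_int r * z ^ 2 / (2 * J)) / J * jtheta z \<tau>"
proof -
  have J: "J \<noteq> 0" and \<tau>': "Im \<tau>' > 0"
    unfolding \<tau>'_def J_def using mobius_Im[OF det \<tau>] by auto
  have J\<tau>': "J * \<tau>' = of_int p * \<tau> + of_int q" by (simp add: \<tau>'_def J)
  have det': "of_int p * of_int s = 1 + of_int q * (of_int r :: complex)"
    using det by (metis add.commute diff_eq_eq of_int_1 of_int_add of_int_mult)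
  define f where "f = (\<lambda>z. J * ep (- of_int r * z ^ 2 / (2 * J)) * jtheta (z / J) \<tau>')"
  have holo: "(\<lambda>z. jtheta (z / J) \<tau>') holomorphic_on UNIV"
    using holomorphic_on_compose[of "\<lambda>z. z / J" UNIV "\<lambda>z. jtheta z \<tau>'"] J
      holomorphic_on_subset[OF jtheta_holomorphic[OF \<tau>']]
    by (force simp: o_def intro!: holomorphic_intros)
  have regroup: "x * y * t = u * (x * y' * h)" if "t = e * h" "y * e = u * y'" for x y t e h u y' :: complex
  proof -
    have "x * y * (e * h) = x * (y * e) * h" by (simp only: mult.assoc)
    then show ?thesis unfolding that by (simp only: mult_ac)
  qed
  have "2 * of_real pi * \<i> * f z = 2 * of_real pi * \<i> * jtheta z \<tau>"
  proof (rule quasi_elliptic_proportional[where f = f and g = "\<lambda>z. jtheta z \<tau>" and u = "\<lambda>_. ep (1 / 2)"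
        and v = "\<lambda>z. ep (1 / 2 - z - \<tau> / 2)" and \<tau> = \<tau>])
    show "f holomorphic_on UNIV" unfolding f_def
      by (intro holomorphic_intros holo) (use J in auto)
    show "(\<lambda>z. jtheta z \<tau>) holomorphic_on UNIV" by (rule jtheta_holomorphic[OF \<tau>])
    show "jtheta (z + 1) \<tau> = ep (1 / 2) * jtheta z \<tau>" for z by (rule jtheta_add_1)
    show "jtheta (z + \<tau>) \<tau> = ep (1 / 2 - z - \<tau> / 2) * jtheta z \<tau>" for z by (rule jtheta_add_tau[OF \<tau>])
    show "f (z + 1) = ep (1 / 2) * f z" for z
    proof -
      \<comment> \<open>1/J is the lattice point -r \<tau>' + p of \<tau>', and \<tau>/J below is s
        \<tau>' - q; so \<open>jtheta_add_lattice\<close> describes both shifts.\<close>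
      have "J * (of_int (- r) * \<tau>' + of_int p) = 1"
        using det' by (simp add: ring_distribs J\<tau>' mult.left_commute[of J]) (simp add: J_def algebra_simps)
      then have "(z + 1) / J = z / J + of_int (- r) * \<tau>' + of_int p"
        using J by (simp add: field_simps)
      then have "jtheta ((z + 1) / J) \<tau>' =
          ep (of_int (- r + p) / 2 - of_int (- r) * (z / J) - of_int (- r) ^ 2 * \<tau>' / 2) * jtheta (z / J) \<tau>'"
        using jtheta_add_lattice[OF \<tau>'] by presburger
      moreover have "ep (- of_int r * (z + 1) ^ 2 / (2 * J)) *
          ep (of_int (- r + p) / 2 - of_int (- r) * (z / J) - of_int (- r) ^ 2 * \<tau>' / 2) =
          ep (1 / 2) * ep (- of_int r * z ^ 2 / (2 * J))"
        unfolding ep_add[symmetric]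
      proof (rule ep_cong)
        obtain k where k: "p - r - r * p - 1 = 2 * k" using SL2_parity[OF det] by (metis evenE)
        have k': "of_int p - of_int r - of_int r * of_int p - 1 = 2 * (of_int k :: complex)"
          using arg_cong[OF k, of of_int] by simp
        have "of_int r + of_int r ^ 2 * (of_int p * \<tau> + of_int q) = of_int r * of_int p * J"
          using arg_cong[OF det', of "\<lambda>x. x * of_int r"]
          by (simp add: J_def power2_eq_square algebra_simps)
        then have "of_int r + of_int r ^ 2 * (J * \<tau>') = of_int r * of_int p * J"
          by (simp add: J\<tau>')
        then have *: "of_int r / J + of_int r ^ 2 * \<tau>' = of_int r * of_int p"
          using J by (simp add: field_simps)
        have "- of_int r * (z + 1) ^ 2 / (2 * J) = - of_int r * z ^ 2 / (2 * J) - of_int r * z / J - (of_int r / J) / 2"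
          using J by (simp add: field_simps power2_eq_square)
        then have "- of_int r * (z + 1) ^ 2 / (2 * J) +
            (of_int (- r + p) / 2 - of_int (- r) * (z / J) - of_int (- r) ^ 2 * \<tau>' / 2) -
            (1 / 2 + - of_int r * z ^ 2 / (2 * J)) = (of_int p - of_int r - 1) / 2 - (of_int r / J + of_int r ^ 2 * \<tau>') / 2"
          by (simp add: diff_divide_distrib add_divide_distrib)
        also have "\<dots> = (of_int p - of_int r - of_int r * of_int p - 1) / 2"
          unfolding * by (simp add: diff_divide_distrib)
        finally have "- of_int r * (z + 1) ^ 2 / (2 * J) +
            (of_int (- r + p) / 2 - of_int (- r) * (z / J) - of_int (- r) ^ 2 * \<tau>' / 2) -
            (1 / 2 + - of_int r * z ^ 2 / (2 * J)) = (of_int p - of_int r - of_int r * of_int p - 1) / 2" .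
        then show "- of_int r * (z + 1) ^ 2 / (2 * J) +
            (of_int (- r + p) / 2 - of_int (- r) * (z / J) - of_int (- r) ^ 2 * \<tau>' / 2) -
            (1 / 2 + - of_int r * z ^ 2 / (2 * J)) \<in> \<int>"
          unfolding k' by simp
      qed
      ultimately show ?thesis unfolding f_def by (rule regroup)
    qed
    show "f (z + \<tau>) = ep (1 / 2 - z - \<tau> / 2) * f z" for z
    proof -
      have "J * (of_int s * \<tau>' + of_int (- q)) = \<tau>"
        using det' by (simp add: ring_distribs J\<tau>' mult.left_commute[of J]) (simp add: J_def algebra_simps)
      then have "(z + \<tau>) / J = z / J + of_int s * \<tau>' + of_int (- q)"
        using J by (simp add: field_simps)
      then have "jtheta ((z + \<tau>) / J) \<tau>' =
          ep (of_int (s + - q) / 2 - of_int s * (z / J) - of_int s ^ 2 * \<tau>' / 2) * jtheta (z / J) \<tau>'"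
        using jtheta_add_lattice[OF \<tau>'] by presburger
      moreover have "ep (- of_int r * (z + \<tau>) ^ 2 / (2 * J)) *
          ep (of_int (s + - q) / 2 - of_int s * (z / J) - of_int s ^ 2 * \<tau>' / 2) =
          ep (1 / 2 - z - \<tau> / 2) * ep (- of_int r * z ^ 2 / (2 * J))"
        unfolding ep_add[symmetric]
      proof (rule ep_cong)
        obtain k where k: "s + q + q * s + 1 = 2 * k" using SL2_parity[OF det] by (metis evenE)
        have k': "of_int s + of_int q + of_int q * of_int s + 1 = 2 * (of_int k :: complex)"
          using arg_cong[OF k, of of_int] by simp
        have e1: "of_int r * \<tau> ^ 2 + of_int s ^ 2 * (J * \<tau>') = J * (\<tau> + of_int q * of_int s)"
          unfolding J\<tau>' using arg_cong[OF det', of "\<lambda>x. x * of_int s * \<tau>"]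
          by (simp add: J_def power2_eq_square algebra_simps)
        have "J * (- of_int r * (z + \<tau>) ^ 2 / (2 * J) +
            (of_int (s + - q) / 2 - of_int s * (z / J) - of_int s ^ 2 * \<tau>' / 2) -
            (1 / 2 - z - \<tau> / 2 + - of_int r * z ^ 2 / (2 * J))) =
            - of_int r * z * \<tau> - (of_int r * \<tau> ^ 2 + of_int s ^ 2 * (J * \<tau>')) / 2 + J * (of_int s - of_int q) / 2
              - of_int s * z - J * (1 / 2 - z - \<tau> / 2)"
          using J by (simp add: field_simps power2_eq_square)
        also have "\<dots> = J * ((of_int s - of_int q - of_int q * of_int s - 1) / 2)"
          unfolding e1 by (simp add: J_def field_simps)
        also have "of_int s - of_int q - of_int q * of_int s - 1 = 2 * (of_int s - (of_int k :: complex))"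
          using k' by (simp add: algebra_simps)
        finally have "- of_int r * (z + \<tau>) ^ 2 / (2 * J) +
            (of_int (s + - q) / 2 - of_int s * (z / J) - of_int s ^ 2 * \<tau>' / 2) -
            (1 / 2 - z - \<tau> / 2 + - of_int r * z ^ 2 / (2 * J)) = 2 * (of_int s - of_int k) / 2"
          using J by (simp only: mult_left_cancel[OF J])
        also have "\<dots> = of_int (s - k)" by simp
        finally show "- of_int r * (z + \<tau>) ^ 2 / (2 * J) +
            (of_int (s + - q) / 2 - of_int s * (z / J) - of_int s ^ 2 * \<tau>' / 2) -
            (1 / 2 - z - \<tau> / 2 + - of_int r * z ^ 2 / (2 * J)) \<in> \<int>"
          by (simp only: Ints_of_int)
      qed
      ultimately show ?thesis unfolding f_def by (rule regroup)
    qed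
    show "\<exists>m n. z = of_int m + of_int n * \<tau>" if "jtheta z \<tau> = 0" for z
      by (rule jtheta_eq_0[OF \<tau> that])
    show "f 0 = 0" by (simp add: f_def jtheta_0[OF \<tau>'])
    show "jtheta 0 \<tau> = 0" by (rule jtheta_0[OF \<tau>])
    show "((\<lambda>z. jtheta z \<tau>) has_field_derivative (2 * of_real pi * \<i>)) (at 0)"
      by (rule jtheta_deriv_0[OF \<tau>])
    have d: "((\<lambda>z. jtheta (z / J) \<tau>') has_field_derivative (2 * of_real pi * \<i>) * (1 / J)) (at 0)"
      by (rule DERIV_chain2[of "\<lambda>z. jtheta z \<tau>'"])
        (use jtheta_deriv_0[OF \<tau>'] J in \<open>auto intro!: derivative_eq_intros\<close>)
    have "(\<lambda>z. J * ep (- of_int r * z ^ 2 / (2 * J))) holomorphic_on UNIV"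
      by (intro holomorphic_intros) (use J in auto)
    then obtain D where "((\<lambda>z. J * ep (- of_int r * z ^ 2 / (2 * J))) has_field_derivative D) (at 0)"
      by (meson UNIV_I holomorphic_on_imp_differentiable_at open_UNIV field_differentiable_def)
    \<comment> \<open>The factor J cancels 1/J from the chain rule, and the unknown derivative D is
      multiplied by the value 0 of the theta function.\<close>
    from DERIV_mult'[OF this d] show "(f has_field_derivative (2 * of_real pi * \<i>)) (at 0)"
      using J by (simp add: f_def jtheta_0[OF \<tau>'])
  qed (use \<tau> in auto)
  then have "f z = jtheta z \<tau>" by simp
  then show ?thesis using J by (simp add: f_def ep_minus field_simps)
qed

section \<open>Klein forms and the eta function\<close>

text \<open>The exponential prefactor absorbs the index of the Jacobi form: a matrix then acts on
  the row (v1, v2) alone, and only the weight -1 remains.\<close>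

definition klein :: "complex \<Rightarrow> complex \<Rightarrow> complex \<Rightarrow> complex" where
  "klein v1 v2 \<tau> = ep (v1 * (v1 * \<tau> + v2) / 2) * jtheta (v1 * \<tau> + v2) \<tau>"

text \<open>If (w1, w2) is the transformed row and z = w1 \<tau> + w2, then v1 \<tau>' + v2 = z/J
  and v1 + r z = w1 J. The latter says that the Gaussian factor of \<open>jtheta_modular\<close>
  turns the old prefactor into the new one.\<close>

lemma klein_modular:
  fixes p q r s :: int
  assumes det: "p * s - q * r = 1" and \<tau>: "Im \<tau> > 0"
  shows "klein v1 v2 ((of_int p * \<tau> + of_int q) / (of_int r * \<tau> + of_int s)) =
    klein (v1 * of_int p + v2 * of_int r) (v1 * of_int q + v2 * of_int s) \<tau> / (of_int r * \<tau> + of_int s)"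
proof -
  define J where "J = of_int r * \<tau> + of_int s"
  define \<tau>' where "\<tau>' = (of_int p * \<tau> + of_int q) / J"
  define w1 where "w1 = v1 * of_int p + v2 * of_int r"
  define w2 where "w2 = v1 * of_int q + v2 * of_int s"
  define z where "z = w1 * \<tau> + w2"
  have J: "J \<noteq> 0" unfolding J_def using mobius_Im[OF det \<tau>] by auto
  have det': "of_int p * of_int s = 1 + of_int q * (of_int r :: complex)"
    using det by (metis add.commute diff_eq_eq of_int_1 of_int_add of_int_mult)
  have zJ: "v1 * \<tau>' + v2 = z / J"
    using J by (simp add: \<tau>'_def z_def w1_def w2_def field_simps) (simp add: J_def algebra_simps)
  have "w1 * of_int s - w2 * of_int r = v1"
    using arg_cong[OF det', of "\<lambda>x. x * v1"] by (simp add: w1_def w2_def algebra_simps)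
  then have "v1 + of_int r * z = w1 * J"
    by (simp add: z_def J_def algebra_simps)
  then have "v1 * z / J + of_int r * z ^ 2 / J = w1 * z"
    using J by (simp add: field_simps power2_eq_square) (metis mult.commute mult.left_commute ring_class.ring_distribs(1))
  then have "v1 * (z / J) / 2 + of_int r * z ^ 2 / (2 * J) = w1 * z / 2"
    by (metis (no_types, opaque_lifting) add_divide_distrib divide_divide_eq_left mult.commute times_divide_eq_right)
  then have "ep (v1 * (z / J) / 2) * ep (of_int r * z ^ 2 / (2 * J)) = ep (w1 * z / 2)"
    by (simp only: ep_add[symmetric])
  then have "klein v1 v2 \<tau>' = klein w1 w2 \<tau> / J"
    using jtheta_modular[OF det \<tau>, of z]
    unfolding klein_def zJ by (simp flip: J_def \<tau>'_def z_def)
  then show ?thesis by (simp add: J_def \<tau>'_def w1_def w2_def)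
qed

lemma klein_add_int:
  assumes "Im \<tau> > 0"
  shows "klein (v1 + of_int l1) (v2 + of_int l2) \<tau> =
    ep ((of_int (l1 * l2 + l1 + l2) + of_int l2 * v1 - of_int l1 * v2) / 2) * klein v1 v2 \<tau>"
proof -
  have z: "(v1 + of_int l1) * \<tau> + (v2 + of_int l2) = (v1 * \<tau> + v2) + of_int l1 * \<tau> + of_int l2"
    by (simp add: algebra_simps)
  show ?thesis
    unfolding klein_def z jtheta_add_lattice[OF assms] mult.assoc[symmetric] ep_add[symmetric]
    by (rule arg_cong[of _ _ "\<lambda>x. ep x * _"]) (simp add: field_simps power2_eq_square)
qed

text \<open>The square of Dedekind's \<eta>; every pair of products in j and N - j, and a_0 = 2k,
  contribute even powers only.\<close>

definition eta2 :: "complex \<Rightarrow> complex" where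
  "eta2 \<tau> = ep (\<tau> / 12) * qpoch_inf (ep \<tau>) (ep \<tau>) ^ 2"

lemma eta2_nonzero: "Im \<tau> > 0 \<Longrightarrow> eta2 \<tau> \<noteq> 0"
  by (simp add: eta2_def qpoch_self_nonzero)

text \<open>At the three points of order 2 the Klein forms are squares of q-products over \<eta>^2,
  up to constants and powers of q. By Euler's identity these q-products multiply to 1, so that only
  a power of \<eta> is left.\<close>

lemma klein_half_product:
  assumes "Im \<tau> > 0"
  shows "(klein (1 / 2) 0 \<tau> * klein 0 (1 / 2) \<tau> * klein (1 / 2) (1 / 2) \<tau>) ^ 4 * eta2 \<tau> ^ 12 = - 16"
proof -
  define q where "q = ep \<tau>"
  define p where "p = ep (\<tau> / 2)"
  define h where "h = qpoch_inf q q"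
  have h: "h \<noteq> 0" using qpoch_self_nonzero[OF assms] by (simp add: h_def q_def)
  have q: "norm q < 1" and p: "norm p < 1"
    using assms by (simp_all add: q_def p_def norm_ep_less_1)
  have pq: "p ^ 2 = q" by (simp add: p_def q_def ep_power)
  \<comment> \<open>Euler's identity (-q; q)(q; q^2) = 1, where (q; q^2) = (p; q)(-p; q) for p^2 =
    q.\<close>
  have "qpoch_inf q q * qpoch_inf (- q) q = qpoch_inf (q ^ 2) (q ^ 2)"
    by (rule qpoch_mult_minus[OF q])
  moreover have "qpoch_inf q (q ^ 2) * qpoch_inf (q ^ 2) (q ^ 2) = qpoch_inf q q"
    using qpoch_split[OF q, of q] by (simp add: power2_eq_square)
  moreover have "qpoch_inf p q * qpoch_inf (- p) q = qpoch_inf q (q ^ 2)"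
    using qpoch_mult_minus[OF q, of p] by (simp add: pq)
  ultimately have "h * qpoch_inf (- q) q * (qpoch_inf p q * qpoch_inf (- p) q) = h"
    by (simp add: h_def mult_ac)
  then have euler: "qpoch_inf (- q) q * qpoch_inf p q * qpoch_inf (- p) q = 1"
    using h by (simp add: mult.assoc)
  have qp: "q / p = p" using pq by (simp add: power2_eq_square p_def field_simps)
  have k1: "klein (1 / 2) 0 \<tau> = - ep (- \<tau> / 8) * qpoch_inf p q ^ 2 / h ^ 2"
  proof -
    have "ep (\<tau> / 8) * ep (- \<tau> / 4) = ep (- \<tau> / 8)"
      unfolding ep_add[symmetric] by simp
    then show ?thesis
      by (simp add: klein_def jtheta_def qp flip: p_def q_def h_def) (simp add: power2_eq_square)
  qed
  have k2: "klein 0 (1 / 2) \<tau> = - 2 * ep (- 1 / 4) * qpoch_inf (- q) q ^ 2 / h ^ 2"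
    using qpoch_rec[OF q, of "- 1"]
    by (simp add: klein_def jtheta_def ep_half flip: q_def h_def) (simp add: power2_eq_square)
  have k3: "klein (1 / 2) (1 / 2) \<tau> = - ep (- (\<tau> + 1) / 8) * qpoch_inf (- p) q ^ 2 / h ^ 2"
  proof -
    have "ep ((\<tau> + 1) / 8) * ep (- (\<tau> + 1) / 4) = ep (- (\<tau> + 1) / 8)"
      unfolding ep_add[symmetric] by (rule arg_cong[of _ _ ep]) (simp add: field_simps)
    moreover have "ep (\<tau> / 2 + 1 / 2) = - p" using ep_half by (simp add: p_def ep_add)
    moreover have "q / - p = - p" using qp by (metis divide_minus_right)
    ultimately show ?thesis
      by (simp add: klein_def jtheta_def flip: q_def h_def)
        (simp add: power2_eq_square field_simps)
  qed
  have "klein (1 / 2) 0 \<tau> * klein 0 (1 / 2) \<tau> * klein (1 / 2) (1 / 2) \<tau> =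
      - 2 * (ep (- \<tau> / 8) * ep (- 1 / 4) * ep (- (\<tau> + 1) / 8)) *
      (qpoch_inf (- q) q * qpoch_inf p q * qpoch_inf (- p) q) ^ 2 / h ^ 6"
    unfolding k1 k2 k3 by (simp add: field_simps power2_eq_square power_numeral_reduce)
  also have "ep (- \<tau> / 8) * ep (- 1 / 4) * ep (- (\<tau> + 1) / 8) = ep (- \<tau> / 4 - 3 / 8)"
    unfolding ep_add[symmetric] by (rule arg_cong[of _ _ ep]) (simp add: field_simps)
  finally have "(klein (1 / 2) 0 \<tau> * klein 0 (1 / 2) \<tau> * klein (1 / 2) (1 / 2) \<tau>) ^ 4 =
      16 * ep (- \<tau> - 3 / 2) / h ^ 24"
    unfolding euler by (simp add: power_mult_distrib power_divide ep_power algebra_simps flip: power_mult)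
  moreover have "ep (- \<tau> - 3 / 2) = - 1 / q"
  proof -
    have "ep (- \<tau> - 3 / 2) = ep (1 / 2 - \<tau>)" by (rule ep_cong) (simp add: field_simps)
    then show ?thesis using ep_half by (simp add: ep_diff q_def)
  qed
  moreover have "eta2 \<tau> ^ 12 = q * h ^ 24"
    by (simp add: eta2_def power_mult_distrib ep_power q_def h_def flip: power_mult)
  ultimately show ?thesis using h by (simp add: q_def)
qed

text \<open>At half-integral arguments the factor in \<open>klein_add_int\<close> is a fourth root
  of unity; hence the fourth powers here and in \<open>klein_half_product\<close>.\<close>

lemma klein_half_even_shift:
  assumes "Im \<tau> > 0" "even (u1 - u1')" "even (u2 - u2')"
  shows "klein (of_int u1 / 2) (of_int u2 / 2) \<tau> ^ 4 = klein (of_int u1' / 2) (of_int u2' / 2) \<tau> ^ 4"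
proof -
  obtain l1 l2 where l: "u1 = u1' + 2 * l1" "u2 = u2' + 2 * l2"
    using assms(2,3) by (metis evenE diff_add_cancel add.commute)
  have "klein (of_int u1 / 2) (of_int u2 / 2) \<tau> =
      klein (of_int u1' / 2 + of_int l1) (of_int u2' / 2 + of_int l2) \<tau>"
    by (simp add: l add_divide_distrib)
  also have "\<dots> ^ 4 = ep (of_int (2 * (l1 * l2 + l1 + l2) + l2 * u1' - l1 * u2')) *
      klein (of_int u1' / 2) (of_int u2' / 2) \<tau> ^ 4"
    unfolding klein_add_int[OF assms(1)] power_mult_distrib ep_power
    by (rule arg_cong[of _ _ "\<lambda>x. ep x * _"]) (simp add: field_simps)
  finally show ?thesis by (simp only: ep_of_int mult_1)
qed

text \<open>The matrix permutes the three points of order 2, so the product X of the fourth powers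
  of their Klein forms has weight -12 and trivial multiplier; \<eta>^24 is -16 / X.\<close>

lemma eta2_modular:
  fixes p q r s :: int
  assumes det: "p * s - q * r = 1" and \<tau>: "Im \<tau> > 0"
  shows "eta2 ((of_int p * \<tau> + of_int q) / (of_int r * \<tau> + of_int s)) ^ 12 =
    (of_int r * \<tau> + of_int s) ^ 12 * eta2 \<tau> ^ 12"
proof -
  define J where "J = of_int r * \<tau> + of_int s"
  define \<tau>' where "\<tau>' = (of_int p * \<tau> + of_int q) / J"
  have J: "J \<noteq> 0" and \<tau>': "Im \<tau>' > 0"
    unfolding \<tau>'_def J_def using mobius_Im[OF det \<tau>] by auto
  define K where "K = (\<lambda>(u1 :: int) (u2 :: int) \<tau>. klein (of_int u1 / 2) (of_int u2 / 2) \<tau> ^ 4)"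
  have KJ: "K u1 u2 \<tau>' = K (u1 * p + u2 * r) (u1 * q + u2 * s) \<tau> / J ^ 4" for u1 u2
    using klein_modular[OF det \<tau>, of "of_int u1 / 2" "of_int u2 / 2"]
    by (simp add: K_def \<tau>'_def J_def power_divide add_divide_distrib)
  have K_mod: "K u1 u2 \<tau> = K (u1 mod 2) (u2 mod 2) \<tau>" for u1 u2
    unfolding K_def by (rule klein_half_even_shift[OF \<tau>]) auto
  have par: "odd (p * s - q * r)" using det by simp
  \<comment> \<open>Modulo 2, the rows of the matrix and their sum are the three nonzero vectors in
    some order.\<close>
  have perm: "K p q \<tau> * K r s \<tau> * K (p + r) (q + s) \<tau> = K 1 0 \<tau> * K 0 1 \<tau> * K 1 1 \<tau>"
    unfolding K_mod[of p q] K_mod[of r s] K_mod[of "p + r"]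
    using par by (cases "even p"; cases "even q"; cases "even r"; cases "even s")
      (simp_all add: even_iff_mod_2_eq_zero[THEN iffD1] odd_iff_mod_2_eq_one[THEN iffD1] mod_add_eq[symmetric, of _ _ 2] mult_ac)
  define X where "X = (\<lambda>\<tau>. K 1 0 \<tau> * K 0 1 \<tau> * K 1 1 \<tau>)"
  have "X \<tau>' * J ^ 12 = X \<tau>"
    using perm by (simp add: X_def KJ J field_simps flip: power_add)
  moreover have X: "X \<tau> * eta2 \<tau> ^ 12 = - 16" and X': "X \<tau>' * eta2 \<tau>' ^ 12 = - 16"
    using klein_half_product[OF \<tau>] klein_half_product[OF \<tau>']
    by (simp_all add: X_def K_def power_mult_distrib)
  ultimately have "X \<tau>' * (J ^ 12 * eta2 \<tau> ^ 12) = X \<tau>' * eta2 \<tau>' ^ 12"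
    by (simp add: mult.assoc[symmetric])
  moreover have "X \<tau>' \<noteq> 0" using X' by auto
  ultimately have "eta2 \<tau>' ^ 12 = J ^ 12 * eta2 \<tau> ^ 12" by simp
  then show ?thesis by (simp add: \<tau>'_def J_def)
qed

section \<open>The products as quotients of Klein forms\<close>

lemma ep_sum: "ep (sum f A) = (\<Prod>j\<in>A. ep (f j))"
  by (induction A rule: infinite_finite_induct) (simp_all add: ep_add)

lemma prod_powi_const:
  fixes x :: "'a :: field"
  assumes "x \<noteq> 0"
  shows "(\<Prod>j\<in>A. x powi f j) = x powi (\<Sum>j\<in>A. f j)"
  using assms by (induction A rule: infinite_finite_induct) (simp_all add: power_int_add)

definition klein_form :: "nat \<Rightarrow> nat \<Rightarrow> complex \<Rightarrow> complex" where
  "klein_form N j \<tau> = klein (of_nat j / of_nat N) 0 (of_nat N * \<tau>)"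

text \<open>The prefactors of \<open>klein\<close> and \<open>jtheta\<close> combine to q to the
  power j^2/(2N) - j/2 = -j(N - j)/(2N), which is the contribution of j to S_2 in the exponent of
  the product.\<close>

lemma klein_form_eq:
  assumes "Im \<tau> > 0" "0 < j" "j < N"
  shows "qpoch_inf (ep \<tau> ^ j) (ep \<tau> ^ N) * qpoch_inf (ep \<tau> ^ (N - j)) (ep \<tau> ^ N) =
    - klein_form N j \<tau> * qpoch_inf (ep \<tau> ^ N) (ep \<tau> ^ N) ^ 2 *
    ep (\<tau> * of_int (int (j * (N - j))) / (2 * of_nat N))"
proof -
  have N: "of_nat N \<noteq> (0 :: complex)" using assms by simp
  have 1: "of_nat j / of_nat N * (of_nat N * \<tau>) + 0 = of_nat j * \<tau>" using N by simp
  have 2: "ep (of_nat N * \<tau>) / ep (of_nat j * \<tau>) = ep (of_nat (N - j) * \<tau>)"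
    using assms by (simp add: of_nat_diff algebra_simps flip: ep_diff)
  have 3: "ep (of_nat j / of_nat N * (of_nat j * \<tau>) / 2) * ep (- (of_nat j * \<tau>) / 2) *
      ep (\<tau> * of_int (int (j * (N - j))) / (2 * of_nat N)) = 1"
    unfolding ep_add[symmetric]
    by (rule ep_Ints) (use assms N in \<open>simp add: of_nat_diff field_simps\<close>)
  have h: "qpoch_inf (ep (of_nat N * \<tau>)) (ep (of_nat N * \<tau>)) \<noteq> 0"
    using assms by (intro qpoch_self_nonzero) simp
  show ?thesis
    unfolding klein_form_def klein_def 1 jtheta_def ep_power 2
    using h arg_cong[OF 3, of "\<lambda>x. x * (qpoch_inf (ep (of_nat j * \<tau>)) (ep (of_nat N * \<tau>)) * qpoch_inf (ep (of_nat (N - j) * \<tau>)) (ep (of_nat N * \<tau>)))"]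
    by (simp add: mult_ac)
qed

lemma klein_form_nonzero:
  assumes "Im \<tau> > 0" "0 < j" "j < N"
  shows "klein_form N j \<tau> \<noteq> 0"
proof -
  have "norm (ep \<tau> ^ n) < 1" if "n > 0" for n
    using assms that by (simp add: ep_power norm_ep_less_1)
  then have "qpoch_inf (ep \<tau> ^ j) (ep \<tau> ^ N) * qpoch_inf (ep \<tau> ^ (N - j)) (ep \<tau> ^ N) \<noteq> 0"
    using assms by (simp add: qpoch_nonzero)
  then show ?thesis using klein_form_eq[OF assms] by auto
qed

text \<open>The fractional power of q in the definition is what makes this exact: its S_2 part
  cancels against \<open>klein_form_eq\<close>, and its S_1 part supplies the power of q in
  \<open>eta2\<close>.\<close>

lemma product_form_klein:
  fixes a :: "int vec"
  assumes \<tau>: "Im \<tau> > 0" and N: "N \<ge> 2"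
  shows "product_form N (2 * k) a \<tau> =
    eta2 (of_nat N * \<tau>) powi (int k + (\<Sum>j = 1..N div 2. a $ (j - 1))) *
    (\<Prod>j = 1..N div 2. (- klein_form N j \<tau>) powi (a $ (j - 1)))"
proof -
  define m where "m = N div 2"
  define \<alpha> where "\<alpha> = (\<lambda>j. a $ (j - 1))"
  define h where "h = qpoch_inf (ep \<tau> ^ N) (ep \<tau> ^ N)"
  \<comment> \<open>This is only the sum of the a_j; the S_1 of the definition is 2k plus twice this
    sum.\<close>
  define S1 where "S1 = (\<Sum>j = 1..m. \<alpha> j)"
  define S2 where "S2 = (\<Sum>j = 1..m. int (j * (N - j)) * \<alpha> j)"
  define e where "e = real N / 24 * real_of_int (int (2 * k) + 2 * S1) - 1 / (2 * real N) * real_of_int S2"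
  have h: "h \<noteq> 0" unfolding h_def ep_power using \<tau> N by (intro qpoch_self_nonzero) simp
  have "product_form N (2 * k) a \<tau> = exp (2 * of_real pi * \<i> * \<tau> * of_real e) * h ^ (2 * k) *
      (\<Prod>j = 1..m. (qpoch_inf (ep \<tau> ^ j) (ep \<tau> ^ N) * qpoch_inf (ep \<tau> ^ (N - j)) (ep \<tau> ^ N)) powi \<alpha> j)"
    unfolding product_form_def Let_def ep_def[symmetric] m_def[symmetric] \<alpha>_def[symmetric]
    by (simp add: h_def e_def S1_def S2_def \<alpha>_def)
  also have "exp (2 * of_real pi * \<i> * \<tau> * of_real e) = ep (\<tau> * of_real e)"
    by (simp add: ep_def mult_ac)
  also have "(\<Prod>j = 1..m. (qpoch_inf (ep \<tau> ^ j) (ep \<tau> ^ N) * qpoch_inf (ep \<tau> ^ (N - j)) (ep \<tau> ^ N)) powi \<alpha> j) =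
      (\<Prod>j = 1..m. (- klein_form N j \<tau>) powi \<alpha> j * (h powi (2 * \<alpha> j) *
        ep (\<tau> * of_int (int (j * (N - j)) * \<alpha> j) / (2 * of_nat N))))"
  proof (rule prod.cong)
    fix j assume "j \<in> {1..m}"
    then have j: "0 < j" "j < N" using N by (auto simp: m_def)
    have "(h ^ 2) powi \<alpha> j = h powi (2 * \<alpha> j)" by (simp add: power_int_power)
    moreover have "of_int (\<alpha> j) * (\<tau> * of_int (int (j * (N - j))) / (2 * of_nat N)) =
        \<tau> * of_int (int (j * (N - j)) * \<alpha> j) / (2 * of_nat N)"
      by simp
    ultimately show "(qpoch_inf (ep \<tau> ^ j) (ep \<tau> ^ N) * qpoch_inf (ep \<tau> ^ (N - j)) (ep \<tau> ^ N)) powi \<alpha> j =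
      (- klein_form N j \<tau>) powi \<alpha> j * (h powi (2 * \<alpha> j) *
        ep (\<tau> * of_int (int (j * (N - j)) * \<alpha> j) / (2 * of_nat N)))"
      unfolding klein_form_eq[OF \<tau> j] h_def[symmetric] power_int_mult_distrib ep_powi
      by (simp only: mult.assoc)
  qed simp
  also have "\<dots> = (\<Prod>j = 1..m. (- klein_form N j \<tau>) powi \<alpha> j) * (h powi (2 * S1) * ep (\<tau> * of_int S2 / (2 * of_nat N)))"
    by (simp add: prod.distrib prod_powi_const[OF h] S1_def S2_def sum_distrib_left sum_divide_distrib
        flip: ep_sum)
  also have "ep (\<tau> * of_real e) * h ^ (2 * k) *
      ((\<Prod>j = 1..m. (- klein_form N j \<tau>) powi \<alpha> j) * (h powi (2 * S1) * ep (\<tau> * of_int S2 / (2 * of_nat N)))) =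
      (ep (\<tau> * of_real e) * ep (\<tau> * of_int S2 / (2 * of_nat N))) * (h ^ (2 * k) * h powi (2 * S1)) *
      (\<Prod>j = 1..m. (- klein_form N j \<tau>) powi \<alpha> j)"
    by (simp add: mult_ac)
  also have "h ^ (2 * k) * h powi (2 * S1) = (h ^ 2) powi (int k + S1)"
  proof -
    have "h ^ (2 * k) = h powi (2 * int k)" using power_int_of_nat[of h "2 * k"] by simp
    then show ?thesis using h by (simp add: power_int_power ring_distribs power_int_add)
  qed
  also have "ep (\<tau> * of_real e) * ep (\<tau> * of_int S2 / (2 * of_nat N)) = ep (of_nat N * \<tau> / 12) powi (int k + S1)"
    unfolding ep_powi ep_add[symmetric]
    by (rule arg_cong[of _ _ ep]) (use N in \<open>simp add: e_def field_simps\<close>)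
  also have "ep (of_nat N * \<tau> / 12) powi (int k + S1) * (h ^ 2) powi (int k + S1) =
      eta2 (of_nat N * \<tau>) powi (int k + S1)"
    by (simp add: eta2_def h_def ep_power power_int_mult_distrib)
  finally show ?thesis by (simp add: S1_def m_def \<alpha>_def)
qed

lemma product_form_nonzero:
  assumes "Im \<tau> > 0" "N \<ge> 2"
  shows "product_form N (2 * k) a \<tau> \<noteq> 0"
  using assms klein_form_nonzero eta2_nonzero[of "of_nat N * \<tau>"]
  by (auto simp: product_form_klein power_int_not_zero)

lemma product_form_holomorphic:
  assumes "N \<ge> 2"
  shows "product_form N a\<^sub>0 a holomorphic_on {\<tau>. Im \<tau> > 0}"
proof -
  have op: "open {\<tau> :: complex. Im \<tau> > 0}" by (rule open_halfspace_Im_gt)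
  have *: "norm (ep \<tau> ^ n) < 1" if "n > 0" "Im \<tau> > 0" for n \<tau>
    using that by (simp add: ep_power norm_ep_less_1)
  have **: "(\<lambda>\<tau>. qpoch_inf (ep \<tau> ^ n) (ep \<tau> ^ N)) holomorphic_on {\<tau>. Im \<tau> > 0}" for n
    by (intro qpoch_holomorphic[OF op] holomorphic_intros) (use * assms in auto)
  have "qpoch_inf (ep \<tau> ^ j) (ep \<tau> ^ N) * qpoch_inf (ep \<tau> ^ (N - j)) (ep \<tau> ^ N) \<noteq> 0"
    if "Im \<tau> > 0" "j \<in> {1..N div 2}" for \<tau> j
    using that assms by (auto intro!: * dest!: qpoch_nonzero[rotated 1, THEN notE, rotated 2])
  then show ?thesis
    unfolding product_form_def Let_def ep_def[symmetric]
    by (intro holomorphic_intros **) (auto simp: mult_ac)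
qed

text \<open>j and j^2 have the same parity, so the linear sums in the roots of unity are controlled
  by the condition on the quadratic sum.\<close>

lemma sum_square_parity:
  fixes \<alpha> :: "nat \<Rightarrow> int"
  shows "even ((\<Sum>j\<in>A. (int j)\<^sup>2 * \<alpha> j) - (\<Sum>j\<in>A. int j * \<alpha> j))"
  unfolding sum_subtractf[symmetric] by (rule dvd_sum) (auto simp: power2_eq_square)

text \<open>The divisibility condition on \<open>\<Sum>j\<^sup>2a\<^sub>j\<close> makes the roots of unity in the transformation
  formulas of the Klein forms multiply to \<open>1\<close>.\<close>

lemma product_form_Gamma1:
  assumes N: "N \<ge> 2" and \<gamma>: "(p, q, r, s) \<in> Gamma1 N" and \<tau>: "Im \<tau> > 0"
    and c12: "12 dvd int k + (\<Sum>j = 1..N div 2. a $ (j - 1))"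
    and cN: "int N * gcd 2 (int N) dvd (\<Sum>j = 1..N div 2. (int j)\<^sup>2 * a $ (j - 1))"
  shows "slash k (p, q, r, s) (product_form N (2 * k) a) \<tau> = product_form N (2 * k) a \<tau>"
proof -
  define m where "m = N div 2"
  define \<alpha> where "\<alpha> = (\<lambda>j. a $ (j - 1))"
  define S1 where "S1 = (\<Sum>j = 1..m. \<alpha> j)"
  define S where "S = (\<Sum>j = 1..m. (int j)\<^sup>2 * \<alpha> j)"
  define L where "L = (\<Sum>j = 1..m. int j * \<alpha> j)"
  define J where "J = of_int r * \<tau> + of_int s"
  have det: "p * s - q * r = 1" and p: "p mod int N = 1 mod int N" and r: "r mod int N = 0"
    using \<gamma> by (auto simp: Gamma1_def SL2Z_def)
  obtain r' where r': "r = int N * r'" using r by auto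
  obtain p' where p': "p = 1 + int N * p'"
    using p by (metis mod_eq_dvd_iff add.commute diff_add_cancel dvdE)
  obtain t where t: "int k + S1 = 12 * t" using c12 by (auto simp: S1_def m_def \<alpha>_def)
  have cN': "int N dvd S" "even N \<Longrightarrow> 2 * int N dvd S"
    using cN dvd_mult_left[of "int N" "gcd 2 (int N)"] by (auto simp: S_def m_def \<alpha>_def mult_ac)
  then obtain u where u: "S = int N * u" by auto
  have \<tau>N: "Im (of_nat N * \<tau>) > 0" using \<tau> N by simp
  have J: "J \<noteq> 0" and \<tau>': "Im ((of_int p * \<tau> + of_int q) / J) > 0"
    unfolding J_def using mobius_Im[OF det \<tau>] by auto
  \<comment> \<open>N times \<gamma>\<tau> is the image of N\<tau> under the matrix with rows (p,
    Nq) and (r/N, s), again of determinant 1.\<close>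
  have det': "p * s - (int N * q) * r' = 1" using det r' by (simp add: mult_ac)
  have JN: "of_int r' * (of_nat N * \<tau>) + of_int s = J" by (simp add: J_def r')
  have mob: "of_nat N * ((of_int p * \<tau> + of_int q) / J) =
      (of_int p * (of_nat N * \<tau>) + of_int (int N * q)) / (of_int r' * (of_nat N * \<tau>) + of_int s)"
    unfolding JN by (simp add: algebra_simps)
  define x where "x = (\<lambda>j. of_int ((int j)\<^sup>2 * (p' * q) + int j * p' + int j * q) / 2 + of_int ((int j)\<^sup>2 * q) / (2 * of_nat N) :: complex)"
  have kf: "- klein_form N j ((of_int p * \<tau> + of_int q) / J) = - klein_form N j \<tau> * ep (x j) / J" for j
  proof -
    have v: "of_nat j / of_nat N * of_int p + 0 * of_int r' = of_nat j / of_nat N + (of_int (int j * p') :: complex)"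
      "of_nat j / of_nat N * of_int (int N * q) + 0 * of_int s = 0 + (of_int (int j * q) :: complex)"
      using N of_nat_eq_0_iff[of N, where 'a = complex] by (simp_all add: p' field_simps)
    have "klein_form N j ((of_int p * \<tau> + of_int q) / J) =
      ep ((of_int (int j * p' * (int j * q) + int j * p' + int j * q) + of_int (int j * q) * (of_nat j / of_nat N)
        - of_int (int j * p') * 0) / 2) * klein_form N j \<tau> / J"
      unfolding klein_form_def mob klein_modular[OF det' \<tau>N] v klein_add_int[OF \<tau>N] unfolding JN by simp
    also have "(of_int (int j * p' * (int j * q) + int j * p' + int j * q) + of_int (int j * q) * (of_nat j / of_nat N)
        - of_int (int j * p') * 0) / 2 = x j"
      by (simp add: x_def power2_eq_square add_divide_distrib mult_ac)
    finally show ?thesis by (simp only: mult.commute[of "ep (x j)"] minus_divide_left minus_mult_left)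
  qed
  have "(\<Sum>j = 1..m. of_int (\<alpha> j) * x j) =
      (of_int (p' * q) / 2 + of_int q / (2 * of_nat N)) * of_int S + of_int (p' + q) / 2 * of_int L"
    unfolding S_def L_def of_int_sum sum_distrib_left sum.distrib[symmetric]
    by (rule sum.cong) (simp_all add: x_def add_divide_distrib ring_distribs mult_ac)
  also have "\<dots> = of_int (S * (p' * q) + L * (p' + q) + u * q) / 2"
    using N of_nat_eq_0_iff[of N, where 'a = complex] by (simp add: u field_simps)
  finally have sx: "(\<Sum>j = 1..m. of_int (\<alpha> j) * x j) = of_int (S * (p' * q) + L * (p' + q) + u * q) / 2" .
  \<comment> \<open>For odd N the numbers S, L and u have the same parity, so the sum is S p'(q + 1)
    modulo 2; if p' is odd then p is even and the determinant forces q to be odd.\<close>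
  have "even (S * (p' * q) + L * (p' + q) + u * q)"
  proof -
    have SL: "even (S - L)" unfolding S_def L_def by (rule sum_square_parity)
    show ?thesis
    proof (cases "even N")
      case True
      then have "even u" using cN'(2) N u by (auto simp: mult_ac)
      moreover have "even S" using u True by simp
      ultimately show ?thesis using SL by auto
    next
      case False
      have "odd (p * s - q * (int N * r'))" unfolding det[unfolded r'] by simp
      then show ?thesis using SL u False p' by auto
    qed
  qed
  then obtain y where y: "S * (p' * q) + L * (p' + q) + u * q = 2 * y" by (elim evenE)
  have ep1: "ep (\<Sum>j = 1..m. of_int (\<alpha> j) * x j) = 1"
    unfolding sx y by simp
  have "product_form N (2 * k) a ((of_int p * \<tau> + of_int q) / J) =
    eta2 (of_nat N * ((of_int p * \<tau> + of_int q) / J)) powi (12 * t) *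
    (\<Prod>j = 1..m. (- klein_form N j \<tau> * ep (x j) / J) powi \<alpha> j)"
    using t unfolding product_form_klein[OF \<tau>' N] by (simp add: kf S1_def m_def \<alpha>_def)
  also have "eta2 (of_nat N * ((of_int p * \<tau> + of_int q) / J)) powi (12 * t) =
     (eta2 (of_nat N * ((of_int p * \<tau> + of_int q) / J)) ^ 12) powi t"
    by (simp add: power_int_power)
  also have "\<dots> = (J ^ 12 * eta2 (of_nat N * \<tau>) ^ 12) powi t"
    unfolding mob eta2_modular[OF det' \<tau>N] unfolding JN ..
  also have "\<dots> = J powi (int k + S1) * eta2 (of_nat N * \<tau>) powi (int k + S1)"
    by (simp add: power_int_mult_distrib power_int_power t)
  also have "(\<Prod>j = 1..m. (- klein_form N j \<tau> * ep (x j) / J) powi \<alpha> j) =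
     (\<Prod>j = 1..m. (- klein_form N j \<tau>) powi \<alpha> j) * ep (\<Sum>j = 1..m. of_int (\<alpha> j) * x j) / J powi S1"
    unfolding power_int_mult_distrib power_int_divide_distrib prod.distrib prod_dividef prod_powi_const[OF J]
      ep_powi ep_sum S1_def ..
  also have "J powi (int k + S1) * eta2 (of_nat N * \<tau>) powi (int k + S1) *
      ((\<Prod>j = 1..m. (- klein_form N j \<tau>) powi \<alpha> j) * ep (\<Sum>j = 1..m. of_int (\<alpha> j) * x j) / J powi S1) =
      J ^ k * (eta2 (of_nat N * \<tau>) powi (int k + S1) * (\<Prod>j = 1..m. (- klein_form N j \<tau>) powi \<alpha> j))"
    unfolding ep1 using J by (simp add: power_int_add power_int_not_zero)
  also have "eta2 (of_nat N * \<tau>) powi (int k + S1) * (\<Prod>j = 1..m. (- klein_form N j \<tau>) powi \<alpha> j) =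
     product_form N (2 * k) a \<tau>"
    unfolding product_form_klein[OF \<tau> N] by (simp add: S1_def m_def \<alpha>_def)
  finally show ?thesis using J by (simp add: slash_def J_def)
qed

section \<open>Expansions at the cusps\<close>

text \<open>F is w^e times a zero-free holomorphic function of w = ep(\<tau>/N) on the whole unit
  disc. Freeness of zeros makes the notion stable under negative powers and later provides a
  logarithm.\<close>

definition disc_exp :: "nat \<Rightarrow> int \<Rightarrow> (complex \<Rightarrow> complex) \<Rightarrow> bool" where
  "disc_exp N e F \<longleftrightarrow> (\<exists>G. G holomorphic_on ball 0 1 \<and> (\<forall>w\<in>ball 0 1. G w \<noteq> 0) \<and>
     (\<forall>\<tau>. Im \<tau> > 0 \<longrightarrow> F \<tau> = ep (\<tau> / of_nat N) powi e * G (ep (\<tau> / of_nat N))))"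

lemma disc_expI:
  assumes "G holomorphic_on ball 0 1" "\<And>w. norm w < 1 \<Longrightarrow> G w \<noteq> 0"
    "\<And>\<tau>. Im \<tau> > 0 \<Longrightarrow> F \<tau> = ep (\<tau> / of_nat N) powi e * G (ep (\<tau> / of_nat N))"
  shows "disc_exp N e F"
  unfolding disc_exp_def using assms by (intro exI[of _ G]) auto

lemma disc_expE:
  assumes "disc_exp N e F"
  obtains G where "G holomorphic_on ball 0 1" "\<And>w. norm w < 1 \<Longrightarrow> G w \<noteq> 0"
    "\<And>\<tau>. Im \<tau> > 0 \<Longrightarrow> F \<tau> = ep (\<tau> / of_nat N) powi e * G (ep (\<tau> / of_nat N))"
  using assms unfolding disc_exp_def by auto

lemma disc_exp_const: "c \<noteq> 0 \<Longrightarrow> disc_exp N 0 (\<lambda>_. c)"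
  by (rule disc_expI[of "\<lambda>_. c"]) auto

lemma disc_exp_cong:
  assumes "disc_exp N e F" "e' = e" "\<And>\<tau>. Im \<tau> > 0 \<Longrightarrow> F' \<tau> = F \<tau>"
  shows "disc_exp N e' F'"
  using assms unfolding disc_exp_def by auto

lemma disc_exp_mult:
  assumes "disc_exp N e F" "disc_exp N e' F'"
  shows "disc_exp N (e + e') (\<lambda>\<tau>. F \<tau> * F' \<tau>)"
proof -
  obtain G where G: "G holomorphic_on ball 0 1" "\<And>w. norm w < 1 \<Longrightarrow> G w \<noteq> 0"
    "\<And>\<tau>. Im \<tau> > 0 \<Longrightarrow> F \<tau> = ep (\<tau> / of_nat N) powi e * G (ep (\<tau> / of_nat N))"
    by (rule disc_expE[OF assms(1)]) (rule that)
  obtain G' where G': "G' holomorphic_on ball 0 1" "\<And>w. norm w < 1 \<Longrightarrow> G' w \<noteq> 0"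
    "\<And>\<tau>. Im \<tau> > 0 \<Longrightarrow> F' \<tau> = ep (\<tau> / of_nat N) powi e' * G' (ep (\<tau> / of_nat N))"
    by (rule disc_expE[OF assms(2)]) (rule that)
  show ?thesis
    by (rule disc_expI[of "\<lambda>w. G w * G' w"])
      (auto intro!: holomorphic_intros G G' simp: G(2,3) G'(2,3) power_int_add)
qed

lemma disc_exp_powi:
  assumes "disc_exp N e F"
  shows "disc_exp N (e * n) (\<lambda>\<tau>. F \<tau> powi n)"
proof -
  obtain G where G: "G holomorphic_on ball 0 1" "\<And>w. norm w < 1 \<Longrightarrow> G w \<noteq> 0"
    "\<And>\<tau>. Im \<tau> > 0 \<Longrightarrow> F \<tau> = ep (\<tau> / of_nat N) powi e * G (ep (\<tau> / of_nat N))"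
    by (rule disc_expE[OF assms(1)]) (rule that)
  show ?thesis
    by (rule disc_expI[of "\<lambda>w. G w powi n"])
      (auto intro!: holomorphic_intros G simp: G(2,3) power_int_mult_distrib power_int_not_zero power_int_mult)
qed

lemma disc_exp_prod:
  assumes "\<And>j. j \<in> A \<Longrightarrow> disc_exp N (e j) (F j)"
  shows "disc_exp N (\<Sum>j\<in>A. e j) (\<lambda>\<tau>. \<Prod>j\<in>A. F j \<tau>)"
  using assms
  by (induction A rule: infinite_finite_induct)
    (auto intro: disc_exp_const disc_exp_mult)

lemma disc_exp_ep:
  "disc_exp N n (\<lambda>\<tau>. ep (c + of_int n * \<tau> / of_nat N))"
  by (rule disc_expI[of "\<lambda>_. ep c"]) (auto simp: ep_add ep_powi)

text \<open>For A = 0 the first factor is the constant 1 - ep c, nonzero as c is not an integer; all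
  other factors are 1 minus something of norm less than 1.\<close>

lemma disc_exp_qpoch:
  assumes c: "Im c = 0" and b: "Im b = 0" and B: "B > 0" and A: "A > 0 \<or> A = 0 \<and> c \<notin> \<int>"
  shows "disc_exp N 0 (\<lambda>\<tau>. qpoch_inf (ep (c + of_nat A * \<tau> / of_nat N)) (ep (b + of_nat B * \<tau> / of_nat N)))"
proof (rule disc_expI[of "\<lambda>w. qpoch_inf (ep c * w ^ A) (ep b * w ^ B)"])
  have n: "norm (ep c) = 1" "norm (ep b) = 1" using c b by (simp_all add: norm_ep)
  have Q: "norm (ep b * w ^ B) < 1" if "norm w < 1" for w
    using that B n by (simp add: norm_mult norm_power power_less_one_iff)
  show "(\<lambda>w. qpoch_inf (ep c * w ^ A) (ep b * w ^ B)) holomorphic_on ball 0 1"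
    by (intro qpoch_holomorphic holomorphic_intros) (use Q in auto)
  fix w :: complex assume w: "norm w < 1"
  show "qpoch_inf (ep c * w ^ A) (ep b * w ^ B) \<noteq> 0"
  proof (cases "A = 0")
    case False
    then show ?thesis
      using w n Q[OF w] by (intro qpoch_nonzero) (simp_all add: norm_mult norm_power power_less_one_iff)
  next
    case True
    then have "ep c \<noteq> 1" using A by (simp add: ep_eq_1_iff)
    moreover have "qpoch_inf (ep c * (ep b * w ^ B)) (ep b * w ^ B) \<noteq> 0"
      using Q[OF w] n by (intro qpoch_nonzero) (simp_all add: norm_mult)
    ultimately show ?thesis using qpoch_rec[OF Q[OF w], of "ep c"] True by simp
  qed
next
  show "qpoch_inf (ep (c + of_nat A * \<tau> / of_nat N)) (ep (b + of_nat B * \<tau> / of_nat N)) =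
    ep (\<tau> / of_nat N) powi 0 * qpoch_inf (ep c * ep (\<tau> / of_nat N) ^ A) (ep b * ep (\<tau> / of_nat N) ^ B)" for \<tau>
    by (simp add: ep_add ep_power)
qed

text \<open>Since N = g D, the argument is B/D + g^2 \<tau>/N, whose nome is a root of unity times
  w^(g^2).\<close>

lemma eta2_disc_exp:
  fixes B :: int and g D N :: nat
  assumes N: "N = g * D" "N > 0"
  shows "disc_exp N (int g ^ 2) (\<lambda>\<tau>. eta2 ((of_nat g * \<tau> + of_int B) / of_nat D) ^ 12)"
proof -
  have nz: "of_nat g \<noteq> (0 :: complex)" "of_nat D \<noteq> (0 :: complex)" using N by auto
  define b where "b = of_int B / (of_nat D :: complex)"
  have \<tau>': "(of_nat g * \<tau> + of_int B) / of_nat D = b + of_nat (g ^ 2) * \<tau> / of_nat N" for \<tau>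
    using nz by (simp add: b_def N field_simps power2_eq_square)
  have b: "Im b = 0" by (simp add: b_def)
  let ?q = "\<lambda>\<tau>. ep (b + of_nat (g ^ 2) * \<tau> / of_nat N)"
  have "disc_exp N (int g ^ 2 + 0 * 24) (\<lambda>\<tau>. ep (b + of_int (int g ^ 2) * \<tau> / of_nat N) * qpoch_inf (?q \<tau>) (?q \<tau>) powi 24)"
    using N by (intro disc_exp_mult disc_exp_powi disc_exp_qpoch b disc_exp_ep) auto
  moreover have "eta2 \<tau> ^ 12 = ep \<tau> * qpoch_inf (ep \<tau>) (ep \<tau>) powi 24" for \<tau>
    by (simp add: eta2_def power_mult_distrib ep_power flip: power_mult)
  ultimately show ?thesis unfolding \<tau>' by simp
qed

text \<open>Reducing y modulo g to t brings the first coordinate u = t/g into [0, 1), where both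
  q-products have nonnegative powers of w. What remains is the exponent 6 g^2 u(u - 1) = 6 t(t - g).
  The condition on v keeps the Klein form away from the zero of the theta function when t =
  0.\<close>

lemma klein_disc_exp:
  fixes B y :: int and g D N :: nat and v :: complex
  assumes N: "N = g * D" "N > 0" and v: "Im v = 0" and nz: "int g dvd y \<Longrightarrow> v \<notin> \<int>"
  shows "disc_exp N (6 * ((y mod int g) * (y mod int g - int g)))
    (\<lambda>\<tau>. klein (of_int y / of_nat g) v ((of_nat g * \<tau> + of_int B) / of_nat D) ^ 12)"
proof -
  have g0: "g > 0" using N by simp
  have cnz: "of_nat g \<noteq> (0 :: complex)" "of_nat D \<noteq> (0 :: complex)" using N by auto
  define l where "l = y div int g"
  define t where "t = nat (y mod int g)"
  have t: "int t = y mod int g" "t < g" using g0 by (auto simp: t_def nat_less_iff)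
  define b where "b = of_int B / (of_nat D :: complex)"
  have b: "Im b = 0" by (simp add: b_def)
  define u where "u = of_nat t / (of_nat g :: complex)"
  have u: "Im u = 0" by (simp add: u_def)
  define T where "T = (\<lambda>\<tau>. b + of_nat (g ^ 2) * \<tau> / of_nat N)"
  have T: "(of_nat g * \<tau> + of_int B) / of_nat D = T \<tau>" for \<tau>
    using cnz by (simp add: b_def N field_simps power2_eq_square T_def)
  have ImT: "Im (T \<tau>) > 0" if "Im \<tau> > 0" for \<tau>
    using that N by (simp add: T_def b)
  define c where "c = u * b + v"
  define c' where "c' = b - c"
  have c: "Im c = 0" "Im c' = 0" using u b v by (simp_all add: c_def c'_def)
  have z: "u * T \<tau> + v = c + of_nat (g * t) * \<tau> / of_nat N" for \<tau>
    using cnz by (simp add: T_def c_def u_def N field_simps power2_eq_square)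
  have z': "T \<tau> - (u * T \<tau> + v) = c' + of_nat (g * (g - t)) * \<tau> / of_nat N" for \<tau>
    using cnz t unfolding z by (simp add: T_def c'_def N field_simps power2_eq_square of_nat_diff)
  have yu: "of_int y / of_nat g = u + of_int l"
  proof -
    have "of_int y = of_nat t + of_nat g * (of_int l :: complex)"
      unfolding l_def by (metis mult_div_mod_eq of_int_add of_int_mult of_int_of_nat_eq t(1) add.commute)
    then show ?thesis using cnz by (simp add: u_def field_simps)
  qed
  let ?q = "\<lambda>\<tau>. ep (b + of_nat (g ^ 2) * \<tau> / of_nat N)"
  define C where "C = ep (6 * (of_int l - of_int l * v) + 6 * (u - 1) * (u * b + v))"
  have eq: "klein (of_int y / of_nat g) v (T \<tau>) ^ 12 =
     C * ep (0 + of_int (6 * (int t * (int t - int g))) * \<tau> / of_nat N) *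
     (qpoch_inf (ep (c + of_nat (g * t) * \<tau> / of_nat N)) (?q \<tau>) powi 12 *
     (qpoch_inf (ep (c' + of_nat (g * (g - t)) * \<tau> / of_nat N)) (?q \<tau>) powi 12 *
      qpoch_inf (?q \<tau>) (?q \<tau>) powi (- 24)))" if \<tau>: "Im \<tau> > 0" for \<tau>
  proof -
    have "klein (of_int y / of_nat g) v (T \<tau>) = klein (u + of_int l) (v + of_int 0) (T \<tau>)"
      by (simp add: yu)
    also have "\<dots> ^ 12 = ep (6 * (of_int l - of_int l * v)) * klein u v (T \<tau>) ^ 12"
      unfolding klein_add_int[OF ImT[OF \<tau>]] power_mult_distrib ep_power
      by (rule arg_cong[of _ _ "\<lambda>x. ep x * _"]) simp
    also have "klein u v (T \<tau>) ^ 12 = ep (6 * u * (u * T \<tau> + v)) * jtheta (u * T \<tau> + v) (T \<tau>) ^ 12"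
      unfolding klein_def power_mult_distrib ep_power
      by (rule arg_cong[of _ _ "\<lambda>x. ep x * _"]) simp
    also have "jtheta (u * T \<tau> + v) (T \<tau>) ^ 12 = ep (- 6 * (u * T \<tau> + v)) *
        (qpoch_inf (ep (u * T \<tau> + v)) (ep (T \<tau>)) powi 12 *
        (qpoch_inf (ep (T \<tau> - (u * T \<tau> + v))) (ep (T \<tau>)) powi 12 *
         qpoch_inf (ep (T \<tau>)) (ep (T \<tau>)) powi (- 24)))"
    proof -
      have "ep (- (u * T \<tau> + v) / 2) ^ 12 = ep (- 6 * (u * T \<tau> + v))"
        unfolding ep_power by (rule arg_cong[of _ _ ep]) simp
      then show ?thesis
        unfolding jtheta_def ep_diff
        by (simp add: power_mult_distrib power_divide power_int_minus field_simps flip: power_mult)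
    qed
    finally have "klein (of_int y / of_nat g) v (T \<tau>) ^ 12 =
       (ep (6 * (of_int l - of_int l * v)) * ep (6 * u * (u * T \<tau> + v)) * ep (- 6 * (u * T \<tau> + v))) *
        (qpoch_inf (ep (u * T \<tau> + v)) (ep (T \<tau>)) powi 12 *
        (qpoch_inf (ep (T \<tau> - (u * T \<tau> + v))) (ep (T \<tau>)) powi 12 *
         qpoch_inf (ep (T \<tau>)) (ep (T \<tau>)) powi (- 24)))"
      by (simp only: mult.assoc)
    also have "ep (6 * (of_int l - of_int l * v)) * ep (6 * u * (u * T \<tau> + v)) * ep (- 6 * (u * T \<tau> + v)) =
       C * ep (0 + of_int (6 * (int t * (int t - int g))) * \<tau> / of_nat N)"
    proof -
      have e1: "u * (u - 1) * (of_nat (g ^ 2) * \<tau> / of_nat N) = of_int (int t * (int t - int g)) * \<tau> / of_nat N"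
        using cnz by (simp add: u_def N field_simps power2_eq_square)
      have e2: "6 * (of_int l - of_int l * v) + 6 * u * (u * T \<tau> + v) + - 6 * (u * T \<tau> + v) =
         6 * (of_int l - of_int l * v) + 6 * (u - 1) * (u * b + v) + 6 * (u * (u - 1) * (of_nat (g ^ 2) * \<tau> / of_nat N))"
        unfolding T_def by (simp add: algebra_simps diff_divide_distrib)
      show ?thesis unfolding C_def ep_add[symmetric] e2 e1 by (simp add: mult.assoc)
    qed
    finally show ?thesis unfolding z' unfolding z by (simp only: T_def)
  qed
  have tc: "0 < g * t \<or> g * t = 0 \<and> c \<notin> \<int>"
  proof (cases "t = 0")
    case True
    then have "int g dvd y" using t by (simp add: dvd_eq_mod_eq_0)
    then show ?thesis using nz True by (simp add: c_def u_def)
  qed (use g0 in auto)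
  have "disc_exp N (0 + 6 * (int t * (int t - int g)) + (0 * 12 + (0 * 12 + 0 * - 24)))
     (\<lambda>\<tau>. C * ep (0 + of_int (6 * (int t * (int t - int g))) * \<tau> / of_nat N) *
     (qpoch_inf (ep (c + of_nat (g * t) * \<tau> / of_nat N)) (?q \<tau>) powi 12 *
     (qpoch_inf (ep (c' + of_nat (g * (g - t)) * \<tau> / of_nat N)) (?q \<tau>) powi 12 *
      qpoch_inf (?q \<tau>) (?q \<tau>) powi (- 24))))"
    by (intro disc_exp_mult disc_exp_powi disc_exp_qpoch b c disc_exp_ep disc_exp_const tc)
      (use g0 t in \<open>auto simp: C_def\<close>)
  then show ?thesis
    unfolding T by (rule disc_exp_cong) (simp add: t(1), rule eq)
qed

text \<open>Twelve times the order of the product at the cusp \<open>y / c\<close>, where \<open>gcd (c, N) = g\<close>, in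
  the parameter \<open>exp (2\<pi>i\<tau> / N)\<close>.\<close>

definition cusp_exp :: "nat \<Rightarrow> nat \<Rightarrow> int vec \<Rightarrow> int \<Rightarrow> int \<Rightarrow> int" where
  "cusp_exp N k a g y = g\<^sup>2 * (int k + (\<Sum>j = 1..N div 2. a $ (j - 1))) +
     (\<Sum>j = 1..N div 2. 6 * ((int j * y) mod g * ((int j * y) mod g - g)) * a $ (j - 1))"

text \<open>\<open>N\<gamma>\<tau> = \<gamma>'((g\<tau> + B) / D)\<close> with \<open>\<gamma>'\<close> in \<open>SL\<^sub>2(\<int>)\<close> and \<open>g D = N\<close>.\<close>

lemma product_form_cusp_exp:
  assumes N: "N \<ge> 2" and \<gamma>: "(p, q, r, s) \<in> SL2Z"
  shows "disc_exp N (cusp_exp N k a (gcd r (int N)) p)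
    (\<lambda>\<tau>. slash k (p, q, r, s) (product_form N (2 * k) a) \<tau> ^ 12)"
proof -
  define m where "m = N div 2"
  define \<alpha> where "\<alpha> = (\<lambda>j. a $ (j - 1))"
  define S1 where "S1 = (\<Sum>j = 1..m. \<alpha> j)"
  define g where "g = nat (gcd r (int N))"
  have det: "p * s - q * r = 1" using \<gamma> by (simp add: SL2Z_def)
  have g: "int g = gcd r (int N)" "g > 0" using N by (auto simp: g_def)
  have "int g dvd int N" "int g dvd r" unfolding g(1) by simp_all
  then obtain D r' where D: "N = g * D" and r': "r = int g * r'" by (auto elim!: dvdE)
  have D0: "D > 0" using D N by (cases "D = 0") auto
  have "coprime (int D) r'"
  proof -
    have "gcd (int g * r') (int g * int D) = int g"
      using g(1) r' D by simp
    then have "gcd r' (int D) = 1" using g(2) by (simp add: gcd_mult_distrib_int[symmetric])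
    then show ?thesis by (simp add: coprime_iff_gcd_eq_1 gcd.commute)
  qed
  moreover have cpr: "coprime p r"
  proof (rule coprimeI)
    fix x assume "x dvd p" "x dvd r"
    then have "x dvd p * s - q * r" by simp
    then show "is_unit x" using det by simp
  qed
  then have "coprime p r'" using r' by simp
  ultimately have "coprime (int D * p) r'" by simp
  then obtain x y where xy: "x * (int D * p) + y * r' = 1"
    using bezout_int[of "int D * p" r'] by (auto simp: coprime_iff_gcd_eq_1)
  \<comment> \<open>B' and D' complete the first column (Dp, r') of \<gamma>' to a matrix of
    determinant 1, and B is the upper right entry of the inverse of \<gamma>' times diag(N, 1)
    \<gamma>.\<close>
  define D' where "D' = x"
  define B' where "B' = - y"
  define B where "B = D' * int N * q - B' * s"
  have det': "(int D * p) * D' - B' * r' = 1" using xy by (simp add: D'_def B'_def mult_ac)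
  define T where "T = (\<lambda>\<tau>. (of_nat g * \<tau> + of_int B) / (of_nat D :: complex))"
  define J where "J = (\<lambda>\<tau> :: complex. of_int r * \<tau> + of_int s)"
  have cnz: "of_nat g \<noteq> (0 :: complex)" "of_nat D \<noteq> (0 :: complex)" using D0 g by auto
  have ImT: "Im (T \<tau>) > 0" if "Im \<tau> > 0" for \<tau>
    using that g D0 by (simp add: T_def)
  have bot: "of_int r' * T \<tau> + of_int D' = J \<tau> / of_nat D" for \<tau>
  proof -
    have "r' * B + D' * int D = r' * D' * int N * q - (B' * r') * s + D' * int D"
      by (simp add: B_def algebra_simps)
    also have "\<dots> = r' * D' * int N * q - (int D * p * D' - 1) * s + D' * int D"
      using det' by (simp add: algebra_simps)
    also have "\<dots> = D' * int D * (q * r - p * s + 1) + s"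
      by (simp add: D r' algebra_simps)
    also have "\<dots> = s" using det by simp
    finally have "of_int r' * of_int B + of_int D' * of_nat D = (of_int s :: complex)"
      by (metis of_int_add of_int_mult of_int_of_nat_eq)
    then have "of_int r' * (of_nat g * \<tau> + of_int B) + of_int D' * of_nat D = J \<tau>"
      by (simp add: J_def r' algebra_simps)
    then show ?thesis using cnz by (simp add: T_def field_simps)
  qed
  have top: "of_int (int D * p) * T \<tau> + of_int B' = of_nat g * (of_int p * \<tau> + of_int q)" for \<tau>
  proof -
    have "p * B + B' = p * D' * int N * q - B' * (p * s - 1)"
      by (simp add: B_def algebra_simps)
    also have "p * s - 1 = q * r" using det by simp
    also have "p * D' * int N * q - B' * (q * r) = int g * q * (int D * p * D' - B' * r')"
      by (simp add: D r' algebra_simps)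
    finally have "p * B + B' = int g * q" using det' by simp
    then have "of_int p * of_int B + of_int B' = of_nat g * (of_int q :: complex)"
      by (metis of_int_add of_int_mult of_int_of_nat_eq)
    moreover have "of_int (int D * p) * T \<tau> = of_int p * (of_nat g * \<tau> + of_int B)"
      using cnz by (simp add: T_def)
    ultimately show ?thesis by (simp add: algebra_simps)
  qed
  have J: "J \<tau> \<noteq> 0" "Im ((of_int p * \<tau> + of_int q) / J \<tau>) > 0" if "Im \<tau> > 0" for \<tau>
    using mobius_Im[OF det that] by (auto simp: J_def)
  have mob: "of_nat N * ((of_int p * \<tau> + of_int q) / J \<tau>) =
     (of_int (int D * p) * T \<tau> + of_int B') / (of_int r' * T \<tau> + of_int D')" if "Im \<tau> > 0" for \<tau>
    unfolding bot top using cnz J(1)[OF that] by (simp add: D field_simps)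
  have et: "eta2 (of_nat N * ((of_int p * \<tau> + of_int q) / J \<tau>)) ^ 12 =
      (J \<tau> / of_nat D) ^ 12 * eta2 (T \<tau>) ^ 12" if "Im \<tau> > 0" for \<tau>
    unfolding mob[OF that] eta2_modular[OF det' ImT[OF that]] unfolding bot ..
  have kf: "klein_form N j ((of_int p * \<tau> + of_int q) / J \<tau>) =
      klein (of_int (int j * p) / of_nat g) (of_int (int j * B') / of_nat N) (T \<tau>) / (J \<tau> / of_nat D)"
    if "Im \<tau> > 0" for \<tau> j
  proof -
    have v: "of_nat j / of_nat N * of_int (int D * p) + 0 * of_int r' = of_int (int j * p) / (of_nat g :: complex)"
      "of_nat j / of_nat N * of_int B' + 0 * of_int D' = of_int (int j * B') / (of_nat N :: complex)"
      using cnz by (simp_all add: D field_simps)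
    show ?thesis
      unfolding klein_form_def mob[OF that] klein_modular[OF det' ImT[OF that]] v unfolding bot ..
  qed
  have eq: "slash k (p, q, r, s) (product_form N (2 * k) a) \<tau> ^ 12 =
     (1 / of_nat D) ^ (12 * k) * ((eta2 (T \<tau>) ^ 12) powi (int k + S1) *
      (\<Prod>j = 1..m. (klein (of_int (int j * p) / of_nat g) (of_int (int j * B') / of_nat N) (T \<tau>) ^ 12) powi \<alpha> j))"
    if \<tau>: "Im \<tau> > 0" for \<tau>
  proof -
    let ?M = "(of_int p * \<tau> + of_int q) / J \<tau>"
    define K where "K = (\<lambda>j. klein (of_int (int j * p) / of_nat g) (of_int (int j * B') / of_nat N) (T \<tau>))"
    define j where "j = J \<tau> / of_nat D"
    have j: "j \<noteq> 0" using J(1)[OF \<tau>] cnz by (simp add: j_def)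
    have pw: "(x powi n) ^ 12 = (x ^ 12) powi n" for x :: complex and n
      by (simp add: power_int_power power_int_power' mult.commute)
    have "product_form N (2 * k) a ?M ^ 12 =
       (eta2 (of_nat N * ?M) ^ 12) powi (int k + S1) * (\<Prod>j = 1..m. (klein_form N j ?M ^ 12) powi \<alpha> j)"
      unfolding product_form_klein[OF J(2)[OF \<tau>] N] power_mult_distrib prod_power_distrib pw
      by (simp add: S1_def m_def \<alpha>_def)
    also have "\<dots> = (j ^ 12 * eta2 (T \<tau>) ^ 12) powi (int k + S1) * (\<Prod>i = 1..m. ((K i / j) ^ 12) powi \<alpha> i)"
      unfolding et[OF \<tau>] kf[OF \<tau>] by (simp add: j_def K_def)
    also have "\<dots> = (j ^ 12) powi (int k + S1) * ((eta2 (T \<tau>) ^ 12) powi (int k + S1) *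
        ((\<Prod>i = 1..m. (K i ^ 12) powi \<alpha> i) / (j ^ 12) powi S1))"
      using j by (simp add: power_int_mult_distrib power_divide power_int_divide_distrib prod_dividef
          prod_powi_const S1_def)
    also have "\<dots> = j ^ (12 * k) * ((eta2 (T \<tau>) ^ 12) powi (int k + S1) * (\<Prod>i = 1..m. (K i ^ 12) powi \<alpha> i))"
      using j by (simp add: power_int_add power_mult)
    finally have A: "product_form N (2 * k) a ?M ^ 12 =
       j ^ (12 * k) * ((eta2 (T \<tau>) ^ 12) powi (int k + S1) * (\<Prod>i = 1..m. (K i ^ 12) powi \<alpha> i))" .
    have B: "slash k (p, q, r, s) (product_form N (2 * k) a) \<tau> ^ 12 = product_form N (2 * k) a ?M ^ 12 / J \<tau> ^ (12 * k)"
      by (simp add: slash_def J_def power_divide mult.commute[of 12 k] power_mult)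
    have C: "j ^ (12 * k) / J \<tau> ^ (12 * k) = (1 / of_nat D) ^ (12 * k)"
      using J(1)[OF \<tau>] by (simp add: j_def power_divide)
    show ?thesis unfolding B A times_divide_eq_left[symmetric] C K_def ..
  qed
  \<comment> \<open>No argument is a lattice point: if both coordinates were integral, g would
    divide j and D would divide j/g, so N would divide j, although 0 < j < N.\<close>
  have nz: "of_int (int j * B') / of_nat N \<notin> (\<int> :: complex set)" if "int g dvd int j * p" "j \<in> {1..m}" for j
  proof
    assume "of_int (int j * B') / of_nat N \<in> (\<int> :: complex set)"
    then obtain z where "of_int (int j * B') / of_nat N = (of_int z :: complex)" by (auto simp: Ints_def)
    then have "of_int (int j * B') = (of_int (z * int N) :: complex)" using N by (simp add: field_simps)
    then have jB: "int j * B' = z * int N" by (simp only: of_int_eq_iff)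
    have "coprime (int g) p" using cpr r' by (simp add: coprime_commute)
    then have "int g dvd int j" using that coprime_dvd_mult_left_iff by blast
    then obtain j' where j': "int j = int g * j'" by (rule dvdE)
    have "int D dvd j' * B'" using jB g(2) by (auto simp: j' D)
    moreover have "coprime (int D) B'"
    proof (rule coprimeI)
      fix x assume "x dvd int D" "x dvd B'"
      then have "x dvd int D * p * D' - B' * r'" by simp
      then show "is_unit x" using det' by simp
    qed
    ultimately have "int D dvd j'" using coprime_dvd_mult_left_iff by blast
    then have "int N dvd int j" unfolding D j' by simp
    then have "N \<le> j" using that by (auto dest!: zdvd_imp_le)
    then show False using that N by (auto simp: m_def)
  qed
  have "disc_exp N (0 + (int g ^ 2 * (int k + S1) + (\<Sum>j = 1..m. 6 * ((int j * p) mod int g * ((int j * p) mod int g - int g)) * \<alpha> j)))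
     (\<lambda>\<tau>. (1 / of_nat D) ^ (12 * k) * ((eta2 (T \<tau>) ^ 12) powi (int k + S1) *
      (\<Prod>j = 1..m. (klein (of_int (int j * p) / of_nat g) (of_int (int j * B') / of_nat N) (T \<tau>) ^ 12) powi \<alpha> j)))"
    unfolding T_def
    by (intro disc_exp_mult disc_exp_const disc_exp_powi disc_exp_prod eta2_disc_exp klein_disc_exp D nz)
      (use N cnz in auto)
  then show ?thesis
    by (rule disc_exp_cong) (simp add: cusp_exp_def S1_def m_def \<alpha>_def g(1), rule eq)
qed

section \<open>Modularity of the products\<close>

lemma disc_param_surj:
  assumes "w \<noteq> 0" "norm w < 1" "N > 0"
  obtains \<tau> where "Im \<tau> > 0" "ep (\<tau> / of_nat N) = w"
proof
  define \<tau> where "\<tau> = of_nat N * Ln w / (2 * of_real pi * \<i>)"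
  show *: "ep (\<tau> / of_nat N) = w"
    using assms by (simp add: ep_def \<tau>_def)
  have "Im (\<tau> / of_nat N) > 0"
    using assms(2) * norm_ep_less_1 by metis
  then show "Im \<tau> > 0" using assms(3) by (simp add: zero_less_divide_iff)
qed

text \<open>The series defines a holomorphic h on the disc with h^12 = w^e G, so e is twelve times
  the order of h at 0. This is the source of both the integrality and the nonnegativity of the
  orders.\<close>

lemma expansion_order:
  assumes F: "disc_exp N e (\<lambda>\<tau>. F \<tau> ^ 12)" and N: "N > 0"
    and b: "\<And>\<tau>. Im \<tau> > 0 \<Longrightarrow>
      (\<lambda>n. b n * exp (2 * of_real pi * \<i> * of_nat n * \<tau> / of_nat N)) sums F \<tau>"
  shows "12 dvd e" "e \<ge> 0"
proof -
  obtain G where G: "G holomorphic_on ball 0 1" "\<And>w. norm w < 1 \<Longrightarrow> G w \<noteq> 0"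
    "\<And>\<tau>. Im \<tau> > 0 \<Longrightarrow> F \<tau> ^ 12 = ep (\<tau> / of_nat N) powi e * G (ep (\<tau> / of_nat N))"
    by (rule disc_expE[OF F]) (rule that)
  have b': "(\<lambda>n. b n * ep (\<tau> / of_nat N) ^ n) sums F \<tau>" if "Im \<tau> > 0" for \<tau>
    using b[OF that] unfolding ep_power by (simp add: ep_def mult_ac)
  define h where "h = (\<lambda>w. \<Sum>n. b n * w ^ n)"
  have hF: "h (ep (\<tau> / of_nat N)) = F \<tau>" if "Im \<tau> > 0" for \<tau>
    using b'[OF that] by (simp add: h_def sums_iff)
  have hG: "h w ^ 12 = G w * (w - 0) powi e" if w: "w \<in> ball 0 1" "w \<noteq> 0" for w
  proof -
    obtain \<tau> where "Im \<tau> > 0" "ep (\<tau> / of_nat N) = w"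
      by (rule disc_param_surj[of w N]) (use w N in auto)
    then show ?thesis using G(3)[of \<tau>] hF[of \<tau>] by simp
  qed
  have hol: "h holomorphic_on ball 0 1"
  proof (rule power_series_holomorphic)
    fix w :: complex assume w: "w \<in> ball 0 1"
    have "summable (\<lambda>n. b n * w ^ n)"
    proof (cases "w = 0")
      case False
      obtain \<tau> where "Im \<tau> > 0" "ep (\<tau> / of_nat N) = w"
        by (rule disc_param_surj[of w N]) (use w N False in auto)
      then show ?thesis using b'[of \<tau>] by (simp add: sums_iff)
    qed simp
    then show "(\<lambda>n. b n * (w - 0) ^ n) sums h w"
      by (simp add: h_def summable_sums)
  qed
  have nz: "h w \<noteq> 0" if "w \<in> ball 0 1" "w \<noteq> 0" for w
  proof
    assume "h w = 0"
    then have "G w * w powi e = 0" using hG[OF that] by simp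
    then show False using G(2)[of w] that by simp
  qed
  have fr: "frequently (\<lambda>w. h w \<noteq> 0) (at 0)"
    by (rule eventually_frequently)
      (use nz in \<open>auto simp: eventually_at intro!: exI[of _ 1]\<close>)
  have an: "h analytic_on {0}"
    using hol by (auto simp: analytic_at intro!: exI[of _ "ball 0 1"])
  have "zorder (\<lambda>w. h w ^ 12) 0 = e"
    by (rule zorder_eqI[OF _ _ G(1)]) (use G(2) hG in auto)
  moreover have "zorder (\<lambda>w. h w ^ 12) 0 = 12 * zorder h 0"
    using zorder_power[OF analytic_on_imp_meromorphic_on[OF an] fr, of 12] by simp
  moreover have "zorder h 0 \<ge> 0" by (rule zorder_ge_0[OF an fr])
  ultimately show "12 dvd e" "e \<ge> 0" by auto
qed

text \<open>Up to a root of unity, which is constant by continuity, \<open>F\<close> is a holomorphic twelfth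
  root on the disc.\<close>

lemma expansion_exists:
  assumes F: "disc_exp N (12 * int n) (\<lambda>\<tau>. F \<tau> ^ 12)"
    and N: "N > 0" and cont: "continuous_on {\<tau>. Im \<tau> > 0} F"
  shows "\<exists>b. \<forall>\<tau>. Im \<tau> > 0 \<longrightarrow>
      (\<lambda>n. b n * exp (2 * of_real pi * \<i> * of_nat n * \<tau> / of_nat N)) sums F \<tau>"
proof -
  obtain G where G: "G holomorphic_on ball 0 1" "\<And>w. norm w < 1 \<Longrightarrow> G w \<noteq> 0"
    "\<And>\<tau>. Im \<tau> > 0 \<Longrightarrow> F \<tau> ^ 12 = ep (\<tau> / of_nat N) powi (12 * int n) * G (ep (\<tau> / of_nat N))"
    by (rule disc_expE[OF F]) (rule that)
  \<comment> \<open>G has no zeros on the disc and therefore a holomorphic logarithm l; then w^n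
    exp(l/12) is a twelfth root of w^(12n) G.\<close>
  obtain l where l: "l holomorphic_on ball 0 1" "\<And>w. w \<in> ball 0 1 \<Longrightarrow> G w = exp (l w)"
    using contractible_imp_holomorphic_log[OF G(1)] G(2) convex_imp_contractible[OF convex_ball]
    by (metis mem_ball_0)
  define H where "H = (\<lambda>w. w ^ n * exp (l w / 12))"
  have H: "H holomorphic_on ball 0 1" unfolding H_def by (intro holomorphic_intros l) auto
  have w1: "ep (\<tau> / of_nat N) \<in> ball 0 1" if "Im \<tau> > 0" for \<tau>
    using that N by (simp add: norm_ep_less_1)
  have Hnz: "H (ep (\<tau> / of_nat N)) \<noteq> 0" for \<tau> by (simp add: H_def)
  have H12: "H (ep (\<tau> / of_nat N)) ^ 12 = F \<tau> ^ 12" if "Im \<tau> > 0" for \<tau>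
    using G(3)[OF that] l(2)[OF w1[OF that]]
    by (simp add: H_def power_mult_distrib ep_power ep_powi mult_ac flip: exp_of_nat_mult)
  let ?c = "\<lambda>\<tau>. F \<tau> / H (ep (\<tau> / of_nat N))"
  have "?c constant_on {\<tau>. Im \<tau> > 0}"
  proof (rule continuous_finite_range_constant)
    show "connected {\<tau>. Im \<tau> > 0}" by (intro convex_connected convex_halfspace_Im_gt)
    have "continuous_on {\<tau>. Im \<tau> > 0} (\<lambda>\<tau>. ep (\<tau> / of_nat N))"
      using N by (intro holomorphic_on_imp_continuous_on holomorphic_intros) auto
    then have "continuous_on {\<tau>. Im \<tau> > 0} (\<lambda>\<tau>. H (ep (\<tau> / of_nat N)))"
      by (rule continuous_on_compose2[OF holomorphic_on_imp_continuous_on[OF H]]) (use w1 in auto)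
    then show "continuous_on {\<tau>. Im \<tau> > 0} ?c"
      using Hnz by (intro continuous_intros cont) auto
    have "?c \<tau> ^ 12 = 1" if "Im \<tau> > 0" for \<tau>
      using H12[OF that] Hnz[of \<tau>] by (metis power_divide divide_self power_not_zero)
    then have "?c ` {\<tau>. Im \<tau> > 0} \<subseteq> {z. z ^ 12 = 1}"
      by (auto simp only: image_subset_iff mem_Collect_eq)
    from finite_subset[OF this] show "finite (?c ` {\<tau>. Im \<tau> > 0})"
      using finite_nth_roots[of 12 1] by simp
  qed
  then obtain c where "?c \<tau> = c" if "Im \<tau> > 0" for \<tau> by (auto simp: constant_on_def)
  then have c: "F \<tau> = c * H (ep (\<tau> / of_nat N))" if "Im \<tau> > 0" for \<tau>
    using that Hnz by (simp add: field_simps)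
  define K where "K = (\<lambda>w. c * H w)"
  have K: "K holomorphic_on ball 0 1" unfolding K_def by (intro holomorphic_intros H)
  have "(\<lambda>n. (deriv ^^ n) K 0 / fact n * exp (2 * of_real pi * \<i> * of_nat n * \<tau> / of_nat N)) sums F \<tau>"
    if "Im \<tau> > 0" for \<tau>
    using holomorphic_power_series[OF K w1[OF that]] c[OF that]
    unfolding diff_zero ep_power by (simp add: K_def ep_def mult_ac)
  then show ?thesis by (intro exI[of _ "\<lambda>n. (deriv ^^ n) K 0 / fact n"]) blast
qed

text \<open>Modulo 2g, t(t - g) does not change when a multiple of g is added to t. So the residues
  may be replaced by jy, and the sum becomes y^2 S - y g L, to which the two conditions apply. The
  factor g next to 12 is needed because the order at the cusp is the exponent divided by
  12g.\<close>

lemma cusp_exp_dvd: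
  assumes c12: "12 dvd int k + (\<Sum>j = 1..N div 2. a $ (j - 1))"
    and cN: "int N * gcd 2 (int N) dvd (\<Sum>j = 1..N div 2. (int j)\<^sup>2 * a $ (j - 1))"
    and g: "g dvd int N" "g > 0"
  shows "12 * g dvd cusp_exp N k a g y"
proof -
  define m where "m = N div 2"
  define \<alpha> where "\<alpha> = (\<lambda>j. a $ (j - 1))"
  define S where "S = (\<Sum>j = 1..m. (int j)\<^sup>2 * \<alpha> j)"
  define L where "L = (\<Sum>j = 1..m. int j * \<alpha> j)"
  define t where "t = (\<lambda>j. (int j * y) mod g)"
  have cN': "int N dvd S" "even N \<Longrightarrow> 2 * int N dvd S"
    using cN dvd_mult_left[of "int N" "gcd 2 (int N)"] by (auto simp: S_def m_def \<alpha>_def mult_ac)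
  have SL: "even (S - L)" unfolding S_def L_def by (rule sum_square_parity)
  have "2 * g dvd y\<^sup>2 * S - y * g * L"
  proof (cases "even N")
    case True
    have "2 * g dvd 2 * int N" using g by simp
    then have "2 * g dvd S" using cN'(2)[OF True] dvd_trans by blast
    moreover have "even S" using cN'(2)[OF True] dvd_mult_left by blast
    then have "even L" using SL by simp
    then have "2 * g dvd y * g * L" by (auto elim!: evenE)
    ultimately show ?thesis by (simp add: dvd_diff)
  next
    case False
    then have "odd g" using g dvd_trans[of 2 g "int N"] by auto
    have "g dvd S" using cN'(1) g dvd_trans by blast
    then have "g dvd y\<^sup>2 * S - y * g * L" by (simp add: dvd_diff)
    moreover have "2 dvd y\<^sup>2 * S - y * g * L"
      using SL \<open>odd g\<close> by (auto simp: power2_eq_square)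
    moreover have "coprime 2 g" using \<open>odd g\<close> by simp
    ultimately show ?thesis by (simp add: divides_mult)
  qed
  moreover have "2 * g dvd (\<Sum>j = 1..m. t j * (t j - g) * \<alpha> j) - (y\<^sup>2 * S - y * g * L)"
  proof -
    have "(\<Sum>j = 1..m. t j * (t j - g) * \<alpha> j) - (y\<^sup>2 * S - y * g * L) =
      (\<Sum>j = 1..m. (t j * (t j - g) - (int j * y) * (int j * y - g)) * \<alpha> j)"
      unfolding S_def L_def sum_distrib_left sum_subtractf[symmetric]
      by (rule sum.cong) (simp_all add: algebra_simps power2_eq_square)
    also have "2 * g dvd \<dots>"
    proof (intro dvd_sum dvd_mult2)
      fix j
      obtain z where z: "int j * y = t j + g * z"
        unfolding t_def by (metis mod_mult_div_eq)
      have "even (z * (z - 1))" by auto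
      then obtain z' where z': "z * (z - 1) = 2 * z'" by (metis evenE)
      have "t j * (t j - g) - (t j + g * z) * (t j + g * z - g) = - (2 * g) * (t j * z) - g * g * (z * (z - 1))"
        by (simp add: algebra_simps)
      then show "2 * g dvd t j * (t j - g) - (int j * y) * (int j * y - g)"
        unfolding z z' by (simp add: mult_ac)
    qed
    finally show ?thesis .
  qed
  ultimately have "2 * g dvd (y\<^sup>2 * S - y * g * L) + ((\<Sum>j = 1..m. t j * (t j - g) * \<alpha> j) - (y\<^sup>2 * S - y * g * L))"
    by (rule dvd_add)
  then have "2 * g dvd (\<Sum>j = 1..m. t j * (t j - g) * \<alpha> j)"
    by (simp only: add_diff_cancel_left' add_diff_eq)
  then have "6 * (2 * g) dvd 6 * (\<Sum>j = 1..m. t j * (t j - g) * \<alpha> j)"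
    by (rule mult_dvd_mono[OF dvd_refl])
  moreover have "12 * g dvd g\<^sup>2 * (int k + (\<Sum>j = 1..m. \<alpha> j))"
    using mult_dvd_mono[OF c12 dvd_triv_left[of g g]] by (simp add: power2_eq_square m_def \<alpha>_def mult_ac)
  ultimately have "12 * g dvd g\<^sup>2 * (int k + (\<Sum>j = 1..m. \<alpha> j)) + 6 * (\<Sum>j = 1..m. t j * (t j - g) * \<alpha> j)"
    by (intro dvd_add) (simp_all add: mult_ac)
  then show ?thesis
    by (simp add: cusp_exp_def m_def \<alpha>_def t_def sum_distrib_left mult.assoc)
qed

lemma SL2Z_column:
  assumes "coprime p r"
  obtains q s where "(p, q, r, s) \<in> SL2Z"
proof -
  obtain x y where "x * p + y * r = 1" using bezout_int[of p r] assms by (auto simp: coprime_iff_gcd_eq_1)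
  then have "(p, - y, r, x) \<in> SL2Z" by (simp add: SL2Z_def mult_ac)
  then show ?thesis by (rule that)
qed

text \<open>Two tests force the divisibility conditions. At the cusp 0/1 one has g = 1, so that all
  residues vanish and the exponent is k + sum a_j. The translation \<tau> + 1 multiplies the product
  by \<open>ep e\<close>, which makes its leading exponent e an integer.\<close>

lemma product_form_modular_iff:
  assumes N: "N \<ge> 2"
  shows "product_form N (2 * k) a \<in> modular_forms N k \<longleftrightarrow>
    12 dvd int k + (\<Sum>j = 1..N div 2. a $ (j - 1)) \<and>
    int N * gcd 2 (int N) dvd (\<Sum>j = 1..N div 2. (int j)\<^sup>2 * a $ (j - 1)) \<and>
    (\<forall>p r. coprime p r \<longrightarrow> cusp_exp N k a (gcd r (int N)) p \<ge> 0)" (is "?M \<longleftrightarrow> ?A \<and> ?B \<and> ?C")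
proof
  assume ?M
  then have inv: "\<And>\<gamma> \<tau>. \<gamma> \<in> Gamma1 N \<Longrightarrow> Im \<tau> > 0 \<Longrightarrow> slash k \<gamma> (product_form N (2 * k) a) \<tau> = product_form N (2 * k) a \<tau>"
    and ser: "\<And>\<gamma>. \<gamma> \<in> SL2Z \<Longrightarrow> \<exists>b :: nat \<Rightarrow> complex. \<forall>\<tau>. Im \<tau> > 0 \<longrightarrow>
        (\<lambda>n. b n * exp (2 * of_real pi * \<i> * of_nat n * \<tau> / of_nat N)) sums slash k \<gamma> (product_form N (2 * k) a) \<tau>"
    by (auto simp: modular_forms_def)
  have C: "12 dvd cusp_exp N k a (gcd r (int N)) p \<and> cusp_exp N k a (gcd r (int N)) p \<ge> 0"
    if "coprime p r" for p r
  proof -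
    obtain q s where \<gamma>: "(p, q, r, s) \<in> SL2Z" using SL2Z_column[OF \<open>coprime p r\<close>] .
    obtain b where b: "\<And>\<tau>. Im \<tau> > 0 \<Longrightarrow>
        (\<lambda>n. b n * exp (2 * of_real pi * \<i> * of_nat n * \<tau> / of_nat N)) sums slash k (p, q, r, s) (product_form N (2 * k) a) \<tau>"
      using ser[OF \<gamma>] by auto
    show ?thesis
      using expansion_order[OF product_form_cusp_exp[OF N \<gamma>] _ b] N by auto
  qed
  have "cusp_exp N k a (gcd 1 (int N)) 0 = int k + (\<Sum>j = 1..N div 2. a $ (j - 1))"
    by (simp add: cusp_exp_def)
  then have A: ?A using C[of 0 1] by simp
  moreover have ?B
  proof -
    define m where "m = N div 2"
    define \<alpha> where "\<alpha> = (\<lambda>j. a $ (j - 1))"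
    define S where "S = (\<Sum>j = 1..m. (int j)\<^sup>2 * \<alpha> j)"
    define L where "L = (\<Sum>j = 1..m. int j * \<alpha> j)"
    define S1 where "S1 = (\<Sum>j = 1..m. \<alpha> j)"
    define S2 where "S2 = (\<Sum>j = 1..m. int (j * (N - j)) * \<alpha> j)"
    define e where "e = real N / 24 * real_of_int (int (2 * k) + 2 * S1) - 1 / (2 * real N) * real_of_int S2"
    obtain t where t: "int k + S1 = 12 * t" using A by (auto simp: S1_def m_def \<alpha>_def)
    have T: "(1, 1, 0, 1) \<in> Gamma1 N" by (simp add: Gamma1_def SL2Z_def)
    have pf: "product_form N (2 * k) a \<tau> = ep (\<tau> * of_real e) * qpoch_inf (ep \<tau> ^ N) (ep \<tau> ^ N) ^ (2 * k) *
      (\<Prod>j = 1..m. (qpoch_inf (ep \<tau> ^ j) (ep \<tau> ^ N) * qpoch_inf (ep \<tau> ^ (N - j)) (ep \<tau> ^ N)) powi \<alpha> j)" for \<tau>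
      unfolding product_form_def Let_def m_def[symmetric]
      by (simp add: ep_def e_def S1_def S2_def \<alpha>_def mult_ac)
    have "product_form N (2 * k) a (\<i> + 1) = product_form N (2 * k) a \<i>"
      using inv[OF T, of \<i>] by (simp add: slash_def)
    moreover have "product_form N (2 * k) a (\<i> + 1) = ep (of_real e) * product_form N (2 * k) a \<i>"
      unfolding pf by (simp add: ep_add ring_distribs)
    moreover have "product_form N (2 * k) a \<i> \<noteq> 0" by (rule product_form_nonzero) (use N in auto)
    ultimately have "ep (of_real e) = 1" by simp
    then obtain z where "of_real e = (of_int z :: complex)" by (auto simp: ep_eq_1_iff Ints_def)
    then have "e = of_int z" by (metis of_real_eq_iff of_real_of_int_eq)
    moreover have "e = of_int (int N * t) - of_int S2 / (2 * real N)"
    proof -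
      have "real_of_int (int (2 * k) + 2 * S1) = 24 * of_int t" using arg_cong[OF t, of "\<lambda>x. real_of_int (2 * x)"] by simp
      then show ?thesis by (simp add: e_def)
    qed
    ultimately have "of_int S2 = (of_int (2 * int N * (int N * t - z)) :: real)"
      using N by (simp add: field_simps)
    then have S2: "S2 = 2 * int N * (int N * t - z)" by (simp only: of_int_eq_iff)
    have "S2 = int N * L - S"
      unfolding S2_def L_def S_def sum_distrib_left sum_subtractf[symmetric]
      by (rule sum.cong) (auto simp: m_def of_nat_diff algebra_simps power2_eq_square)
    then have S: "S = int N * L - 2 * int N * (int N * t - z)" using S2 by simp
    have SL: "even (S - L)" unfolding S_def L_def by (rule sum_square_parity)
    \<comment> \<open>For even N, S is even, hence so is L, and N L supplies the additional factor
      2.\<close>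
    have "int N * gcd 2 (int N) dvd S"
    proof (cases "even N")
      case True
      then have "even S" using S by simp
      then have "even L" using SL by simp
      then show ?thesis using True S by (auto elim!: evenE simp: mult_ac)
    next
      case False
      then have "gcd 2 (int N) = 1" by (simp add: coprime_iff_gcd_eq_1[symmetric])
      then show ?thesis using S by simp
    qed
    then show ?thesis by (simp add: S_def m_def \<alpha>_def)
  qed
  ultimately show "?A \<and> ?B \<and> ?C" using C by blast
next
  assume ABC: "?A \<and> ?B \<and> ?C"
  have hol: "product_form N (2 * k) a holomorphic_on {\<tau>. Im \<tau> > 0}"
    by (rule product_form_holomorphic[OF N])
  have ser: "\<exists>b :: nat \<Rightarrow> complex. \<forall>\<tau>. Im \<tau> > 0 \<longrightarrow>
        (\<lambda>n. b n * exp (2 * of_real pi * \<i> * of_nat n * \<tau> / of_nat N)) sums slash k \<gamma> (product_form N (2 * k) a) \<tau>"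
    if "\<gamma> \<in> SL2Z" for \<gamma>
  proof -
    obtain p q r s where \<gamma>: "\<gamma> = (p, q, r, s)" by (cases \<gamma>)
    have det: "p * s - q * r = 1" using that by (simp add: \<gamma> SL2Z_def)
    have "coprime p r"
    proof (rule coprimeI)
      fix x assume "x dvd p" "x dvd r"
      then have "x dvd p * s - q * r" by simp
      then show "is_unit x" using det by simp
    qed
    then have "cusp_exp N k a (gcd r (int N)) p \<ge> 0" using ABC by blast
    moreover have "12 * gcd r (int N) dvd cusp_exp N k a (gcd r (int N)) p"
      by (rule cusp_exp_dvd) (use ABC N in auto)
    then have "12 dvd cusp_exp N k a (gcd r (int N)) p" using dvd_mult_left by blast
    then obtain x where "cusp_exp N k a (gcd r (int N)) p = 12 * x" by blast
    ultimately have n: "cusp_exp N k a (gcd r (int N)) p = 12 * int (nat x)" by simp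
    show ?thesis unfolding \<gamma>
    proof (rule expansion_exists)
      show "disc_exp N (12 * int (nat x)) (\<lambda>\<tau>. slash k (p, q, r, s) (product_form N (2 * k) a) \<tau> ^ 12)"
        unfolding n[symmetric] using product_form_cusp_exp[OF N] that by (simp add: \<gamma>)
      show "N > 0" using N by simp
      show "continuous_on {\<tau>. Im \<tau> > 0} (slash k (p, q, r, s) (product_form N (2 * k) a))"
        unfolding slash_def case_prod_conv
        by (intro continuous_intros continuous_on_compose2[OF holomorphic_on_imp_continuous_on[OF hol]])
          (use mobius_Im[OF det] in auto)
    qed
  qed
  have inv: "slash k \<gamma> (product_form N (2 * k) a) \<tau> = product_form N (2 * k) a \<tau>"
    if "\<gamma> \<in> Gamma1 N" "Im \<tau> > 0" for \<gamma> \<tau>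
  proof -
    obtain p q r s where "\<gamma> = (p, q, r, s)" by (cases \<gamma>)
    then show ?thesis using product_form_Gamma1[OF N] that ABC by simp
  qed
  show ?M unfolding modular_forms_def mem_Collect_eq
    by (intro conjI ballI allI impI hol ser inv)
qed

section \<open>Galois orbits of cusps\<close>

text \<open>Take for t the product of the prime factors of x that do not divide a. Then each prime
  factor of x divides exactly one of a and t c.\<close>

lemma exists_coprime_shift:
  fixes a c x :: int
  assumes "coprime a c" "x \<noteq> 0"
  obtains t where "coprime (a + t * c) x"
proof
  define T where "T = {p \<in> prime_factors x. \<not> p dvd a}"
  have fin: "finite T" by (simp add: T_def)
  show "coprime (a + \<Prod>T * c) x"
  proof (rule ccontr)
    assume "\<not> coprime (a + \<Prod>T * c) x"
    then have "\<not> is_unit (gcd (a + \<Prod>T * c) x)" by (simp add: coprime_iff_gcd_eq_1)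
    then obtain p where p: "prime p" "p dvd gcd (a + \<Prod>T * c) x"
      using prime_divisor_exists[of "gcd (a + \<Prod>T * c) x"] assms by auto
    then have px: "p \<in> prime_factors x" and pd: "p dvd a + \<Prod>T * c"
      using assms by (auto simp: prime_factors_dvd)
    show False
    proof (cases "p dvd a")
      case True
      then have "p dvd \<Prod>T * c" using pd by (simp add: dvd_add_right_iff)
      then have "p dvd \<Prod>T \<or> p dvd c" using p(1) by (simp add: prime_dvd_mult_iff)
      moreover have "\<not> p dvd c"
        using True assms(1) p(1) by (meson coprime_common_divisor not_prime_unit)
      moreover have "\<not> p dvd \<Prod>T"
      proof
        assume "p dvd \<Prod>T"
        then obtain p' where "p' \<in> T" "p dvd p'" using prime_dvd_prod_iff[OF fin p(1)] by auto
        then show False using True p(1) primes_dvd_imp_eq[of p p'] in_prime_factors_imp_prime by (auto simp: T_def)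
      qed
      ultimately show False by blast
    next
      case False
      then have "p \<in> T" using px by (simp add: T_def)
      then have "p dvd \<Prod>T" using fin by (intro dvd_prodI)
      then show False using pd False by (simp add: dvd_add_left_iff)
    qed
  qed
qed

section \<open>Equivalence of cusps\<close>

lemma Gamma1_iff:
  "(p, q, r, s) \<in> Gamma1 N \<longleftrightarrow>
     p * s - q * r = 1 \<and> int N dvd p - 1 \<and> int N dvd s - 1 \<and> int N dvd r"
  by (auto simp: Gamma1_def SL2Z_def mod_eq_dvd_iff)

lemma cusp_memberI:
  assumes "e \<in> {1, -1}" "(p, q, r, s) \<in> Gamma1 N" "x = e * (p * a + q * c)" "y = e * (r * a + s * c)"
  shows "(x, y) \<in> cusp N a c"
  unfolding cusp_def using assms by blast

lemma cusp_memberE: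
  assumes "(x, y) \<in> cusp N a c"
  obtains e p q r s where "e \<in> {1, -1}" "(p, q, r, s) \<in> Gamma1 N" "x = e * (p * a + q * c)" "y = e * (r * a + s * c)"
  using assms unfolding cusp_def by blast

lemma cusp_refl: "(a, c) \<in> cusp N a c"
  by (rule cusp_memberI[of 1 1 0 0 1]) (simp_all add: Gamma1_iff)

lemma cusp_trans:
  assumes "(a', c') \<in> cusp N a c"
  shows "cusp N a' c' \<subseteq> cusp N a c"
proof safe
  fix x y assume xy: "(x, y) \<in> cusp N a' c'"
  obtain e p q r s where 1: "e \<in> {1, -1}" "(p, q, r, s) \<in> Gamma1 N" "a' = e * (p * a + q * c)" "c' = e * (r * a + s * c)"
    by (rule cusp_memberE[OF assms])
  obtain e' p' q' r' s' where 2: "e' \<in> {1, -1}" "(p', q', r', s') \<in> Gamma1 N" "x = e' * (p' * a' + q' * c')" "y = e' * (r' * a' + s' * c')"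
    by (rule cusp_memberE[OF xy])
  show "(x, y) \<in> cusp N a c"
  proof (rule cusp_memberI)
    show "e' * e \<in> {1, -1}" using 1 2 by auto
    obtain k1 k2 k3 where k: "p = 1 + int N * k1" "s = 1 + int N * k2" "r = int N * k3"
      using 1(2) unfolding Gamma1_iff by (metis dvdE add.commute diff_add_cancel)
    obtain k1' k2' k3' where k': "p' = 1 + int N * k1'" "s' = 1 + int N * k2'" "r' = int N * k3'"
      using 2(2) unfolding Gamma1_iff by (metis dvdE add.commute diff_add_cancel)
    have "(p' * p + q' * r) * (r' * q + s' * s) - (p' * q + q' * s) * (r' * p + s' * r) =
        (p' * s' - q' * r') * (p * s - q * r)"
      by (simp add: algebra_simps)
    then have "(p' * p + q' * r) * (r' * q + s' * s) - (p' * q + q' * s) * (r' * p + s' * r) = 1"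
      using 1(2) 2(2) by (simp add: Gamma1_iff)
    moreover have "int N dvd p' * p + q' * r - 1"
    proof -
      have "p' * p + q' * r - 1 = int N * (k1 + k1' + int N * k1 * k1' + q' * k3)"
        unfolding k k' by (simp add: algebra_simps)
      then show ?thesis by simp
    qed
    moreover have "int N dvd r' * q + s' * s - 1"
    proof -
      have "r' * q + s' * s - 1 = int N * (k2 + k2' + int N * k2 * k2' + k3' * q)"
        unfolding k k' by (simp add: algebra_simps)
      then show ?thesis by simp
    qed
    moreover have "int N dvd r' * p + s' * r" unfolding k k' by simp
    ultimately show "(p' * p + q' * r, p' * q + q' * s, r' * p + s' * r, r' * q + s' * s) \<in> Gamma1 N"
      by (simp add: Gamma1_iff)
  qed (use 1 2 in \<open>simp_all add: algebra_simps\<close>)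
qed

lemma cusp_sym:
  assumes "(a', c') \<in> cusp N a c"
  shows "(a, c) \<in> cusp N a' c'"
proof -
  obtain e p q r s where 1: "e \<in> {1, -1}" "(p, q, r, s) \<in> Gamma1 N" "a' = e * (p * a + q * c)" "c' = e * (r * a + s * c)"
    by (rule cusp_memberE[OF assms])
  have det: "p * s - q * r = 1" using 1 by (simp add: Gamma1_iff)
  have e: "e * e = 1" using 1 by auto
  show ?thesis
  proof (rule cusp_memberI)
    show "e \<in> {1, -1}" by fact
    show "(s, - q, - r, p) \<in> Gamma1 N" using 1(2) by (simp add: Gamma1_iff mult.commute)
    have "e * (s * a' + - q * c') = (e * e) * ((p * s - q * r) * a)"
      unfolding 1 by (simp add: algebra_simps)
    then show "a = e * (s * a' + - q * c')" by (simp add: e det)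
    have "e * (- r * a' + p * c') = (e * e) * ((p * s - q * r) * c)"
      unfolding 1 by (simp add: algebra_simps)
    then show "c = e * (- r * a' + p * c')" by (simp add: e det)
  qed
qed

lemma cusp_eqI: "(a', c') \<in> cusp N a c \<Longrightarrow> cusp N a c = cusp N a' c'"
  using cusp_trans cusp_sym by blast

lemma solve_linear_cong:
  fixes c n x :: int
  assumes "gcd c n dvd x"
  obtains t where "n dvd t * c - x"
proof -
  obtain u v where uv: "u * c + v * n = gcd c n" using bezout_int by blast
  obtain k where k: "x = gcd c n * k" using assms by blast
  have "(u * k) * c - x = n * (- v * k)"
    unfolding k uv[symmetric] by (simp add: algebra_simps)
  then show ?thesis by (intro that[of "u * k"]) simp
qed

text \<open>For the converse, (a, c) and e(a', c') are completed to matrices of determinant 1, and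
  the second matrix is multiplied by the inverse of the first. Adding t times the first column of
  the second matrix to its second column leaves this freedom: the quotient lies in \<Gamma>_1(N)
  once t c = d - d1 modulo N, which is solvable because gcd(c, N) divides d - d1.\<close>

lemma cusp_eq_iff:
  assumes "coprime a c" "coprime a' c'"
  shows "cusp N a c = cusp N a' c' \<longleftrightarrow>
    (\<exists>e\<in>{1, -1}. int N dvd c' - e * c \<and> gcd c (int N) dvd a' - e * a)"
proof
  assume "cusp N a c = cusp N a' c'"
  then have "(a', c') \<in> cusp N a c" using cusp_refl by blast
  then obtain e p q r s where 1: "e \<in> {1, -1}" "(p, q, r, s) \<in> Gamma1 N" "a' = e * (p * a + q * c)" "c' = e * (r * a + s * c)"
    by (rule cusp_memberE)
  have "c' - e * c = e * a * r + e * c * (s - 1)" unfolding 1 by (simp add: algebra_simps)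
  then have "int N dvd c' - e * c" using 1(2) by (simp add: Gamma1_iff)
  moreover have "a' - e * a = e * a * (p - 1) + e * q * c" unfolding 1 by (simp add: algebra_simps)
  then have "gcd c (int N) dvd a' - e * a"
    using 1(2) dvd_trans[of "gcd c (int N)" "int N" "p - 1"] by (simp add: Gamma1_iff)
  ultimately show "\<exists>e\<in>{1, -1}. int N dvd c' - e * c \<and> gcd c (int N) dvd a' - e * a" using 1 by blast
next
  assume "\<exists>e\<in>{1, -1}. int N dvd c' - e * c \<and> gcd c (int N) dvd a' - e * a"
  then obtain e where e: "e \<in> {1, -1}" "int N dvd c' - e * c" "gcd c (int N) dvd a' - e * a" by blast
  have ee: "e * e = 1" using e by auto
  define a1 where "a1 = e * a'"
  define c1 where "c1 = e * c'"
  have "c1 - c = e * (c' - e * c)" "a1 - a = e * (a' - e * a)"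
    using ee by (simp_all add: c1_def a1_def right_diff_distrib mult.assoc[symmetric])
  then have c1: "int N dvd c1 - c" and a1: "gcd c (int N) dvd a1 - a" using e by simp_all
  obtain d b where db: "a * d - b * c = 1"
  proof -
    obtain u v where "u * a + v * c = 1" using assms(1) bezout_int[of a c] by (auto simp: coprime_iff_gcd_eq_1)
    then show ?thesis by (intro that[of u "- v"]) (simp add: mult.commute)
  qed
  have "coprime a1 c1" using assms(2) e(1) by (auto simp: a1_def c1_def)
  obtain d1 b1 where db1: "a1 * d1 - b1 * c1 = 1"
  proof -
    obtain u v where "u * a1 + v * c1 = 1" using \<open>coprime a1 c1\<close> bezout_int[of a1 c1] by (auto simp: coprime_iff_gcd_eq_1)
    then show ?thesis by (intro that[of u "- v"]) (simp add: mult.commute)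
  qed
  have "gcd c (int N) dvd d - d1"
  proof -
    have "a * (d - d1) = b * c - b1 * (c1 - c) - b1 * c + (a1 - a) * d1"
      using db db1 by (simp add: algebra_simps)
    moreover have "gcd c (int N) dvd c1 - c" using c1 dvd_trans gcd_dvd2 by blast
    ultimately have "gcd c (int N) dvd a * (d - d1)" using a1 by simp
    moreover have "coprime (gcd c (int N)) a" using assms(1) coprime_divisors by (metis coprime_commute dvd_refl gcd_dvd1)
    ultimately show ?thesis using coprime_dvd_mult_right_iff by blast
  qed
  then obtain t where t: "int N dvd t * c - (d - d1)" by (rule solve_linear_cong)
  obtain k1 where k1: "c1 = c + int N * k1" using c1 by (metis dvdE add.commute diff_add_cancel)
  obtain k2 where k2: "t * c = d - d1 + int N * k2" using t by (metis dvdE add.commute diff_add_cancel)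
  have \<gamma>: "(a1 * d - (b1 + t * a1) * c, (b1 + t * a1) * a - a1 * b,
      c1 * d - (d1 + t * c1) * c, (d1 + t * c1) * a - c1 * b) \<in> Gamma1 N"
    unfolding Gamma1_iff
  proof (intro conjI)
    have "(a1 * d - (b1 + t * a1) * c) * ((d1 + t * c1) * a - c1 * b) -
      ((b1 + t * a1) * a - a1 * b) * (c1 * d - (d1 + t * c1) * c) =
      (a1 * d1 - b1 * c1) * (a * d - b * c)"
      by (simp add: algebra_simps)
    then show "(a1 * d - (b1 + t * a1) * c) * ((d1 + t * c1) * a - c1 * b) -
      ((b1 + t * a1) * a - a1 * b) * (c1 * d - (d1 + t * c1) * c) = 1"
      by (simp add: db db1)
    have "a1 * d - (b1 + t * a1) * c - 1 = a1 * d - b1 * c - a1 * (t * c) - (a1 * d1 - b1 * c1)"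
      unfolding db1 by (simp add: algebra_simps)
    also have "\<dots> = int N * (b1 * k1 - a1 * k2)"
      unfolding k2 k1 by (simp add: algebra_simps)
    finally show "int N dvd a1 * d - (b1 + t * a1) * c - 1" by simp
    have "(d1 + t * c1) * a - c1 * b - 1 = d1 * a + (t * c) * a + t * (c1 - c) * a - (c1 - c) * b - c * b - (a * d - b * c)"
      unfolding db by (simp add: algebra_simps)
    also have "\<dots> = int N * (k2 * a + t * k1 * a - k1 * b)"
      unfolding k2 k1 by (simp add: algebra_simps)
    finally show "int N dvd (d1 + t * c1) * a - c1 * b - 1" by simp
    have "c1 * d - (d1 + t * c1) * c = c1 * d - d1 * c - c1 * (t * c)"
      by (simp add: algebra_simps)
    also have "\<dots> = int N * (k1 * d1 - c1 * k2)"
      unfolding k2 by (simp add: k1 algebra_simps)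
    finally show "int N dvd c1 * d - (d1 + t * c1) * c" by simp
  qed
  have "(a', c') \<in> cusp N a c"
  proof (rule cusp_memberI[OF e(1) \<gamma>])
    have "(a1 * d - (b1 + t * a1) * c) * a + ((b1 + t * a1) * a - a1 * b) * c = a1 * (a * d - b * c)"
      by (simp add: algebra_simps)
    then show "a' = e * ((a1 * d - (b1 + t * a1) * c) * a + ((b1 + t * a1) * a - a1 * b) * c)"
      using ee by (simp add: db a1_def mult.assoc[symmetric])
    have "(c1 * d - (d1 + t * c1) * c) * a + ((d1 + t * c1) * a - c1 * b) * c = c1 * (a * d - b * c)"
      by (simp add: algebra_simps)
    then show "c' = e * ((c1 * d - (d1 + t * c1) * c) * a + ((d1 + t * c1) * a - c1 * b) * c)"
      using ee by (simp add: db c1_def mult.assoc[symmetric])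
  qed
  then show "cusp N a c = cusp N a' c'" by (rule cusp_eqI)
qed

lemma gcd_mult_unit:
  fixes x c n :: int
  assumes "coprime x n"
  shows "gcd (x * c) n = gcd c n"
  using assms by (simp add: gcd_mult_left_left_cancel coprime_commute)

text \<open>The definite description is well defined because the criterion of
  \<open>cusp_eq_iff\<close> survives multiplication of c and c' by x: a unit modulo N does not
  change the gcd with N.\<close>

lemma galois_act_eq:
  assumes ac: "coprime a c" and x: "coprime x (int N)" and ax: "coprime a (x * c)"
  shows "galois_act N x (cusp N a c) = cusp N a (x * c)"
  unfolding galois_act_def
proof (rule the_equality)
  show "\<exists>a' c'. coprime a' c' \<and> coprime a' (x * c') \<and> cusp N a c = cusp N a' c' \<and> cusp N a (x * c) = cusp N a' (x * c')"
    using ac ax by blast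
next
  fix C assume "\<exists>a' c'. coprime a' c' \<and> coprime a' (x * c') \<and> cusp N a c = cusp N a' c' \<and> C = cusp N a' (x * c')"
  then obtain a' c' where 1: "coprime a' c'" "coprime a' (x * c')" "cusp N a c = cusp N a' c'" "C = cusp N a' (x * c')"
    by blast
  obtain e where e: "e \<in> {1, -1}" "int N dvd c' - e * c" "gcd c (int N) dvd a' - e * a"
    using 1(3) cusp_eq_iff[OF ac 1(1)] by blast
  have "int N dvd x * c' - e * (x * c)"
    using dvd_mult[OF e(2), of x] by (simp add: algebra_simps)
  then show "C = cusp N a (x * c)"
    unfolding 1(4) using cusp_eq_iff[OF ax 1(2)] e gcd_mult_unit[OF x] by (metis (no_types, lifting))
qed

text \<open>The quotient of c' by c is determined only modulo N/g, where it is a unit; it is lifted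
  to a unit modulo N by \<open>exists_coprime_shift\<close>.\<close>

lemma unit_multiplier:
  fixes c c' :: int
  assumes "N > 0" "gcd c (int N) = gcd c' (int N)"
  obtains x where "coprime x (int N)" "int N dvd x * c - c'"
proof -
  define g where "g = gcd c (int N)"
  have g: "g > 0" using assms by (simp add: g_def)
  obtain u n where u: "c = g * u" and n: "int N = g * n" using gcd_dvd1 gcd_dvd2 unfolding g_def by (metis dvdE)
  obtain u' where u': "c' = g * u'" using gcd_dvd1[of c' "int N"] assms(2) unfolding g_def by (metis dvdE)
  have "gcd (g * u) (g * n) = g"
    by (simp only: u[symmetric] n[symmetric] g_def[symmetric])
  moreover have "gcd (g * u') (g * n) = g"
    by (simp only: u'[symmetric] n[symmetric] assms(2)[symmetric] g_def[symmetric])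
  ultimately have un: "coprime u n" and u'n: "coprime u' n"
    using g gcd_mult_distrib_int[of g u n] gcd_mult_distrib_int[of g u' n]
    by (simp_all add: coprime_iff_gcd_eq_1)
  obtain x0 where x0: "n dvd x0 * u - u'" using solve_linear_cong[of u n u'] un by (auto simp: coprime_iff_gcd_eq_1)
  have "coprime x0 n"
  proof (rule coprimeI)
    fix d assume "d dvd x0" "d dvd n"
    then have "d dvd x0 * u - u'" "d dvd x0 * u" using x0 dvd_trans by auto
    then have "d dvd u'" by (metis dvd_diff_right_iff)
    then show "is_unit d" using \<open>d dvd n\<close> u'n coprime_common_divisor by blast
  qed
  then obtain t where t: "coprime (x0 + t * n) (int N)"
    using exists_coprime_shift[of x0 n "int N"] assms(1) by auto
  obtain z where z: "x0 * u - u' = n * z" using x0 by blast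
  have "(x0 + t * n) * c - c' = g * (x0 * u - u') + t * u * (g * n)"
    by (simp add: u u' algebra_simps)
  also have "\<dots> = int N * (z + t * u)"
    unfolding z n by (simp add: algebra_simps)
  finally show ?thesis using t by (intro that[of "x0 + t * n"]) simp_all
qed

text \<open>By \<open>unit_multiplier\<close> the action reaches every c' with the same gcd with N,
  so an orbit only remembers g and the class of a modulo g up to sign. Replacing a by a + t c stays
  in the cusp and makes the numerator prime to x.\<close>

lemma galois_orbit_eq:
  assumes N: "N \<ge> 2" and ac: "coprime a c"
  shows "galois_orbit N (cusp N a c) = {cusp N a' c' | a' c'. coprime a' c' \<and>
    gcd c' (int N) = gcd c (int N) \<and> (\<exists>e\<in>{1, -1}. gcd c (int N) dvd a' - e * a)}" (is "_ = ?R")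
proof -
  have act: "\<exists>t. galois_act N x (cusp N a c) = cusp N (a + t * c) (x * c) \<and> coprime (a + t * c) (x * c)"
    if x: "coprime x (int N)" for x
  proof -
    have "x \<noteq> 0" using x N by auto
    then obtain t where t: "coprime (a + t * c) x" using exists_coprime_shift[OF ac] by blast
    have ac': "coprime (a + t * c) c" using ac by (metis coprime_iff_gcd_eq_1 gcd_add_mult add.commute gcd.commute)
    have axc: "coprime (a + t * c) (x * c)" using t ac' by simp
    have "cusp N a c = cusp N (a + t * c) c"
      unfolding cusp_eq_iff[OF ac ac'] by (rule bexI[of _ 1]) auto
    then show ?thesis using galois_act_eq[OF ac' x axc] axc by auto
  qed
  show ?thesis
  proof (intro equalityI subsetI)
    fix C assume "C \<in> galois_orbit N (cusp N a c)"
    then obtain x where x: "coprime x (int N)" "C = galois_act N x (cusp N a c)"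
      by (auto simp: galois_orbit_def)
    obtain t where t: "C = cusp N (a + t * c) (x * c)" "coprime (a + t * c) (x * c)" using act[OF x(1)] x(2) by blast
    have "gcd c (int N) dvd (a + t * c) - 1 * a" by simp
    then show "C \<in> ?R" using t gcd_mult_unit[OF x(1)] by blast
  next
    fix C assume "C \<in> ?R"
    then obtain a' c' e where C: "C = cusp N a' c'" "coprime a' c'" "gcd c' (int N) = gcd c (int N)"
      "e \<in> {1, -1}" "gcd c (int N) dvd a' - e * a" by blast
    have ee: "e * e = 1" using C by auto
    have "gcd c (int N) = gcd (e * c') (int N)" using C(3,4) by auto
    then obtain x where x: "coprime x (int N)" "int N dvd x * c - e * c'"
      using unit_multiplier[of N c "e * c'"] N by auto
    obtain t where t: "galois_act N x (cusp N a c) = cusp N (a + t * c) (x * c)" "coprime (a + t * c) (x * c)"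
      using act[OF x(1)] by blast
    have "cusp N (a + t * c) (x * c) = cusp N a' c'"
      unfolding cusp_eq_iff[OF t(2) C(2)]
    proof (rule bexI[OF _ C(4)], intro conjI)
      have "c' - e * (x * c) = (e * e) * c' - e * (x * c)" using ee by simp
      also have "\<dots> = - e * (x * c - e * c')" by (simp add: algebra_simps)
      finally have "c' - e * (x * c) = - e * (x * c - e * c')" .
      then show "int N dvd c' - e * (x * c)" using x(2) by simp
      have eq: "a' - e * (a + t * c) = (a' - e * a) - e * t * c" by (simp add: algebra_simps)
      show "gcd (x * c) (int N) dvd a' - e * (a + t * c)"
        unfolding gcd_mult_unit[OF x(1)] eq by (intro dvd_diff C(5) dvd_mult gcd_dvd1)
    qed
    then show "C \<in> galois_orbit N (cusp N a c)"
      using t(1) C(1) x(1) unfolding galois_orbit_def by blast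
  qed
qed

lemma sign_cong_sym:
  fixes g a b :: int
  assumes "e \<in> {1, -1}" "g dvd a - e * b"
  shows "g dvd b - e * a"
proof -
  have "b - e * a = - e * (a - e * b)" using assms(1) by auto
  then show ?thesis using assms(2) by simp
qed

lemma sign_cong_trans:
  fixes g a b c :: int
  assumes "e \<in> {1, -1}" "g dvd a - e * b" "e' \<in> {1, -1}" "g dvd b - e' * c"
  shows "\<exists>e\<in>{1, -1}. g dvd a - e * c"
proof (rule bexI[of _ "e * e'"])
  have "a - (e * e') * c = (a - e * b) + e * (b - e' * c)" by (simp add: algebra_simps)
  then show "g dvd a - e * e' * c" using assms by (metis dvd_add dvd_mult)
qed (use assms in auto)

lemma galois_orbit_eq_iff:
  assumes N: "N \<ge> 2" and ac: "coprime a c" and ac': "coprime a' c'"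
  shows "galois_orbit N (cusp N a c) = galois_orbit N (cusp N a' c') \<longleftrightarrow>
    gcd c (int N) = gcd c' (int N) \<and> (\<exists>e\<in>{1, -1}. gcd c (int N) dvd a' - e * a)"
proof
  assume eq: "galois_orbit N (cusp N a c) = galois_orbit N (cusp N a' c')"
  have "\<exists>e\<in>{1, -1}. gcd c (int N) dvd a - e * a" by (rule bexI[of _ 1]) auto
  then have "cusp N a c \<in> galois_orbit N (cusp N a c)"
    unfolding galois_orbit_eq[OF N ac] using ac by blast
  then obtain a2 c2 e where 2: "cusp N a c = cusp N a2 c2" "coprime a2 c2" "gcd c2 (int N) = gcd c' (int N)"
    "e \<in> {1, -1}" "gcd c' (int N) dvd a2 - e * a'"
    unfolding eq galois_orbit_eq[OF N ac'] by blast
  obtain e' where e': "e' \<in> {1, -1}" "int N dvd c2 - e' * c" "gcd c (int N) dvd a2 - e' * a"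
    using 2(1) cusp_eq_iff[OF ac 2(2)] by blast
  have "gcd c2 (int N) = gcd c (int N)"
  proof -
    obtain z where "c2 = e' * c + z * int N" using e'(2) by (metis dvdE add.commute diff_add_cancel mult.commute)
    then have "gcd c2 (int N) = gcd (e' * c) (int N)" by (metis add.commute gcd.commute gcd_add_mult)
    then show ?thesis using e'(1) by auto
  qed
  then have g: "gcd c (int N) = gcd c' (int N)" using 2(3) by simp
  have "gcd c (int N) dvd a' - e * a2" using sign_cong_sym[OF 2(4,5)] g by simp
  then show "gcd c (int N) = gcd c' (int N) \<and> (\<exists>e\<in>{1, -1}. gcd c (int N) dvd a' - e * a)"
    using sign_cong_trans[OF 2(4) _ e'(1,3)] g by blast
next
  assume *: "gcd c (int N) = gcd c' (int N) \<and> (\<exists>e\<in>{1, -1}. gcd c (int N) dvd a' - e * a)"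
  then obtain e where e: "e \<in> {1, -1}" "gcd c (int N) dvd a' - e * a" by blast
  have "(\<exists>e\<in>{1, -1}. gcd c (int N) dvd x - e * a) \<longleftrightarrow> (\<exists>e\<in>{1, -1}. gcd c (int N) dvd x - e * a')" for x
    using sign_cong_trans[OF _ _ e] sign_cong_trans[OF _ _ e(1) sign_cong_sym[OF e]] by blast
  then show "galois_orbit N (cusp N a c) = galois_orbit N (cusp N a' c')"
    unfolding galois_orbit_eq[OF N ac] galois_orbit_eq[OF N ac'] using * by auto
qed

lemma cusp_orbit_reps_coprime:
  "cusp_orbit_reps N a c \<Longrightarrow> r \<le> N div 2 \<Longrightarrow> coprime (a r) (c r)"
  by (simp add: cusp_orbit_reps_def)

lemma cusp_orbit_reps_surj:
  assumes N: "N \<ge> 2" and ac: "cusp_orbit_reps N a c" and pz: "coprime p z"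
  obtains r e where "r \<le> N div 2" "gcd (c r) (int N) = gcd z (int N)" "e \<in> {1, -1}"
    "gcd z (int N) dvd p - e * a r"
proof -
  have "galois_orbit N (cusp N p z) \<in> galois_orbit N ` cusps N"
    using pz by (auto simp: cusps_def)
  then obtain r where r: "r \<le> N div 2" "galois_orbit N (cusp N (a r) (c r)) = galois_orbit N (cusp N p z)"
    using ac unfolding cusp_orbit_reps_def bij_betw_def by (metis (no_types, lifting) atMost_iff imageE)
  have "gcd (c r) (int N) = gcd z (int N) \<and> (\<exists>e\<in>{1, -1}. gcd (c r) (int N) dvd p - e * a r)"
    using galois_orbit_eq_iff[OF N cusp_orbit_reps_coprime[OF ac r(1)] pz] r(2) by (rule iffD1)
  then obtain e where "gcd (c r) (int N) = gcd z (int N)" "e \<in> {1, -1}" "gcd (c r) (int N) dvd p - e * a r"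
    by blast
  then show ?thesis using that[of r e] r(1) by simp
qed

lemma cusp_orbit_reps_inj:
  assumes N: "N \<ge> 2" and ac: "cusp_orbit_reps N a c" and r: "r \<le> N div 2" "r' \<le> N div 2"
    and eq: "gcd (c r) (int N) = gcd (c r') (int N)" "e \<in> {1, -1}" "gcd (c r) (int N) dvd a r' - e * a r"
  shows "r = r'"
proof -
  have "galois_orbit N (cusp N (a r) (c r)) = galois_orbit N (cusp N (a r') (c r'))"
    using galois_orbit_eq_iff[OF N cusp_orbit_reps_coprime[OF ac r(1)] cusp_orbit_reps_coprime[OF ac r(2)]] eq by blast
  then show ?thesis
    using ac r unfolding cusp_orbit_reps_def bij_betw_def inj_on_def by auto
qed

section \<open>Weighted sums over the orbits\<close>

text \<open>This is the reason for the halves in \<open>cusp_mu\<close>: y and -y coincide modulo g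
  exactly for g = 1 and g = 2.\<close>

lemma card_sign_class:
  fixes g y :: int
  assumes "g > 0" "coprime y g"
  shows "card {y mod g, (- y) mod g} = (if g \<le> 2 then 1 else 2)"
proof (cases "g \<le> 2")
  case True
  then have "g = 1 \<or> g = 2" using assms by auto
  moreover have "(- y) mod 2 = y mod 2" by presburger
  ultimately show ?thesis by auto
next
  case False
  have "y mod g \<noteq> (- y) mod g"
  proof
    assume "y mod g = (- y) mod g"
    then have "g dvd y - (- y)" by (simp only: mod_eq_dvd_iff)
    then have "g dvd 2 * y" by simp
    then have "g dvd 2" using assms(2) by (simp add: coprime_commute coprime_dvd_mult_left_iff)
    then show False using False by (auto dest: zdvd_imp_le)
  qed
  then show ?thesis using False by simp
qed

text \<open>The pairs (g, t) with t a unit modulo g are partitioned into the classes of t up to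
  sign, one class for each orbit. \<open>cusp_mu\<close> is half of \<phi>(N/g) times the size of
  the class.\<close>

lemma sum_cusp_mu:
  fixes F :: "nat \<Rightarrow> int \<Rightarrow> rat"
  assumes N: "N \<ge> 2" and ac: "cusp_orbit_reps N a c"
    and F: "\<And>g y y' e. e \<in> {1, -1} \<Longrightarrow> int g dvd y' - e * y \<Longrightarrow> F g y' = F g y"
  shows "(\<Sum>r\<le>N div 2. cusp_mu N c r * F (cusp_g N c r) (a r)) =
    (\<Sum>g | g dvd N. of_nat (totient (N div g)) / 2 * (\<Sum>t | t \<in> {0..<int g} \<and> coprime t (int g). F g t))"
proof -
  define X where "X = (SIGMA g : {g. g dvd N}. {t. t \<in> {0..<int g} \<and> coprime t (int g)})"
  define G where "G = cusp_g N c"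
  define fib where "fib = (\<lambda>r. {G r} \<times> {a r mod int (G r), (- a r) mod int (G r)})"
  define f where "f = (\<lambda>(g, t). of_nat (totient (N div g)) / 2 * F g t)"
  have G: "int (G r) = gcd (c r) (int N)" for r by (simp add: G_def cusp_g_def)
  have G0: "G r > 0" "G r dvd N" for r
  proof -
    show "G r > 0" using G[of r] N by (metis gcd_pos_int of_nat_0_less_iff not_numeral_le_zero of_nat_eq_0_iff)
    have "int (G r) dvd int N" unfolding G by simp
    then show "G r dvd N" by simp
  qed
  have cop: "coprime (a r) (int (G r))" if "r \<le> N div 2" for r
    using cusp_orbit_reps_coprime[OF ac that] unfolding G by (metis coprime_divisors dvd_refl gcd_dvd1)
  have X: "X = (\<Union>r\<le>N div 2. fib r)"
  proof (intro equalityI subsetI)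
    fix x assume "x \<in> X"
    then obtain g t where x: "x = (g, t)" "g dvd N" "0 \<le> t" "t < int g" "coprime t (int g)" by (auto simp: X_def)
    have gcdg: "gcd (int g) (int N) = int g" using x(2) by (simp add: gcd_proj1_iff)
    obtain r e where r: "r \<le> N div 2" "gcd (c r) (int N) = gcd (int g) (int N)" "e \<in> {1, -1}"
        "gcd (int g) (int N) dvd t - e * a r"
      using cusp_orbit_reps_surj[OF N ac x(5)] .
    have "G r = g" using r(2) G[of r] gcdg by simp
    moreover have "t = (e * a r) mod int g"
    proof -
      have "t mod int g = (e * a r) mod int g" using r(4) unfolding gcdg by (simp add: mod_eq_dvd_iff)
      then show ?thesis using x(3,4) by simp
    qed
    ultimately have "x \<in> fib r" using r(3) x(1) by (auto simp: fib_def)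
    then show "x \<in> (\<Union>r\<le>N div 2. fib r)" using r(1) by blast
  next
    fix x assume "x \<in> (\<Union>r\<le>N div 2. fib r)"
    then obtain r where "r \<le> N div 2" "x \<in> fib r" by blast
    then show "x \<in> X" using G0[of r] cop[of r] by (auto simp: X_def fib_def)
  qed
  have disj: "fib r \<inter> fib r' = {}" if "r \<le> N div 2" "r' \<le> N div 2" "r \<noteq> r'" for r r'
  proof (rule ccontr)
    assume "fib r \<inter> fib r' \<noteq> {}"
    then obtain x where x: "x \<in> fib r" "x \<in> fib r'" by blast
    define t where "t = snd x"
    have t: "G r = G r'" "t \<in> {a r mod int (G r), (- a r) mod int (G r)}" "t \<in> {a r' mod int (G r), (- a r') mod int (G r)}"
      using x by (auto simp: fib_def t_def)
    have "\<exists>e\<in>{1, -1}. int (G r) dvd t - e * y" if "t \<in> {y mod int (G r), (- y) mod int (G r)}" for y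
    proof -
      have "t mod int (G r) = (1 * y) mod int (G r) \<or> t mod int (G r) = (-1 * y) mod int (G r)" using that by auto
      then show ?thesis unfolding mod_eq_dvd_iff by blast
    qed
    then obtain e e' where e: "e \<in> {1, -1}" "int (G r) dvd t - e * a r" "e' \<in> {1, -1}" "int (G r) dvd t - e' * a r'"
      using t by meson
    obtain e2 where "e2 \<in> {1, -1}" "int (G r) dvd a r' - e2 * a r"
      using sign_cong_trans[OF e(3) sign_cong_sym[OF e(3,4)] e(1,2)] by blast
    then have "r = r'" using cusp_orbit_reps_inj[OF N ac that(1,2), of e2] t(1) by (simp flip: G)
    then show False using that by simp
  qed
  have fibsum: "(\<Sum>x\<in>fib r. f x) = cusp_mu N c r * F (G r) (a r)" if "r \<le> N div 2" for r
  proof -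
    have "f x = of_nat (totient (N div G r)) / 2 * F (G r) (a r)" if x: "x \<in> fib r" for x
    proof -
      obtain t where t: "x = (G r, t)" "t = a r mod int (G r) \<or> t = (- a r) mod int (G r)"
        using x unfolding fib_def by blast
      then have "t mod int (G r) = (1 * a r) mod int (G r) \<or> t mod int (G r) = (-1 * a r) mod int (G r)" by auto
      then have "\<exists>e\<in>{1, -1}. int (G r) dvd t - e * a r" unfolding mod_eq_dvd_iff by blast
      then have "F (G r) t = F (G r) (a r)" using F by blast
      then show ?thesis by (simp add: f_def t(1))
    qed
    then have "(\<Sum>x\<in>fib r. f x) = (\<Sum>x\<in>fib r. of_nat (totient (N div G r)) / 2 * F (G r) (a r))"
      by (intro sum.cong refl) blast
    also have "\<dots> = of_nat (card (fib r)) * (of_nat (totient (N div G r)) / 2 * F (G r) (a r))"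
      by (rule sum_constant)
    also have "card (fib r) = (if G r \<le> 2 then 1 else 2)"
      using card_sign_class[of "int (G r)" "a r"] G0(1)[of r] cop[OF that]
      unfolding fib_def card_cartesian_product by simp
    also have "of_nat (if G r \<le> 2 then 1 else 2) * (of_nat (totient (N div G r)) / 2 * F (G r) (a r)) =
        cusp_mu N c r * F (G r) (a r)"
      using G0(1)[of r] by (auto simp: cusp_mu_def Let_def G_def)
    finally show ?thesis .
  qed
  have "(\<Sum>r\<le>N div 2. cusp_mu N c r * F (G r) (a r)) = (\<Sum>r\<le>N div 2. \<Sum>x\<in>fib r. f x)"
    by (intro sum.cong) (simp_all add: fibsum)
  also have "\<dots> = sum f X"
    unfolding X by (rule sum.UNION_disjoint[symmetric]) (use disj in \<open>auto simp: fib_def\<close>)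
  also have "\<dots> = (\<Sum>g | g dvd N. \<Sum>t | t \<in> {0..<int g} \<and> coprime t (int g). f (g, t))"
  proof -
    have "finite {t. t \<in> {0..<int g} \<and> coprime t (int g)}" for g
      by (rule finite_subset[of _ "{0..<int g}"]) auto
    then show ?thesis
      unfolding X_def using N by (subst sum.Sigma) (simp_all only: case_prod_eta, simp_all)
  qed
  finally show ?thesis by (simp add: f_def G_def sum_distrib_left)
qed

text \<open>g^2 (B_2(<y/g>) - 1/6), which is an integer.\<close>

definition quad :: "int \<Rightarrow> int \<Rightarrow> int" where
  "quad g y = (y mod g) * (y mod g - g)"

lemma quad_sign_cong:
  assumes "e \<in> {1, -1}" "g dvd y' - e * y"
  shows "quad g y' = quad g y"
proof -
  have "y' mod g = (e * y) mod g" using assms(2) by (simp add: mod_eq_dvd_iff)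
  moreover have "(- y) mod g * ((- y) mod g - g) = y mod g * (y mod g - g)"
  proof (cases "y mod g = 0")
    case True
    then have "(- y) mod g = 0" by (simp add: zmod_zminus1_eq_if)
    then show ?thesis using True by simp
  next
    case False
    then have *: "(- y) mod g = g - y mod g" by (simp add: zmod_zminus1_eq_if)
    show ?thesis unfolding * by (simp add: algebra_simps)
  qed
  ultimately show ?thesis using assms(1) by (auto simp: quad_def)
qed

lemma quad_mod: "quad g (y mod g) = quad g y"
  by (simp add: quad_def)

lemma quad_scale: "quad (h * g) (h * y) = h\<^sup>2 * quad g y"
  by (simp add: quad_def power2_eq_square mult_mod_right[symmetric] algebra_simps)

lemma cusp_exp_quad:
  "cusp_exp N k a g y = g\<^sup>2 * (int k + (\<Sum>j = 1..N div 2. a $ (j - 1))) +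
     (\<Sum>j = 1..N div 2. 6 * quad g (int j * y) * a $ (j - 1))"
  by (simp add: cusp_exp_def quad_def)

lemma cusp_exp_sign_cong:
  assumes "e \<in> {1, -1}" "g dvd y' - e * y"
  shows "cusp_exp N k a g y' = cusp_exp N k a g y"
proof -
  have "quad g (int j * y') = quad g (int j * y)" for j
  proof (rule quad_sign_cong[OF assms(1)])
    show "g dvd int j * y' - e * (int j * y)"
      using dvd_mult[OF assms(2), of "int j"] by (simp add: algebra_simps)
  qed
  then show ?thesis by (simp add: cusp_exp_quad)
qed

section \<open>The weighted sum of the orders\<close>

text \<open>6 B_2(<y/g>).\<close>

definition bern6 :: "nat \<Rightarrow> int \<Rightarrow> rat" where
  "bern6 g y = of_int (6 * quad (int g) y + (int g)\<^sup>2) / of_nat (g\<^sup>2)"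

lemma bern6_scale:
  assumes "h > 0"
  shows "bern6 (h * g) (int h * y) = bern6 g y"
proof -
  have *: "6 * quad (int (h * g)) (int h * y) + (int (h * g))\<^sup>2 =
      int (h\<^sup>2) * (6 * quad (int g) y + (int g)\<^sup>2)"
    unfolding of_nat_mult quad_scale by (simp add: power_mult_distrib algebra_simps)
  show ?thesis
    unfolding bern6_def * using assms by (simp add: power_mult_distrib)
qed

lemma bern6_mod: "bern6 g (y mod int g) = bern6 g y"
  by (simp add: bern6_def quad_mod)

text \<open>The distribution relation of B_2 at 0, where 6 B_2 has the value 1.\<close>

lemma sum_bern6_base:
  assumes "n > 0"
  shows "(\<Sum>y<n. bern6 n (int y)) = 1 / of_nat n"
proof -
  \<comment> \<open>The number k of summands is separated from n so that the induction can keep n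
    fixed.\<close>
  have "(\<Sum>y<k. 6 * (int y * (int y - int n)) + (int n)\<^sup>2) =
      int k * ((int k - 1) * (2 * int k - 1) - 3 * int n * (int k - 1) + (int n)\<^sup>2)" for k
    by (induction k) (simp_all add: algebra_simps power2_eq_square)
  from this[of n] have *: "(\<Sum>y<n. 6 * (int y * (int y - int n)) + (int n)\<^sup>2) = int n"
    by (simp add: algebra_simps power2_eq_square)
  have "(\<Sum>y<n. bern6 n (int y)) = (\<Sum>y<n. of_int (6 * (int y * (int y - int n)) + (int n)\<^sup>2) / of_nat (n\<^sup>2))"
    by (intro sum.cong) (auto simp: bern6_def quad_def)
  also have "\<dots> = of_int (int n) / of_nat (n\<^sup>2)"
    by (simp only: sum_divide_distrib[symmetric] of_int_sum[symmetric] *)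
  finally show ?thesis using assms by (simp add: power2_eq_square)
qed

lemma sum_bern6_unit:
  assumes n: "n > 0" and j: "coprime j (int n)"
  shows "(\<Sum>x<n. bern6 n (j * int x)) = 1 / of_nat n"
proof -
  define f where "f = (\<lambda>x. nat ((j * int x) mod int n))"
  have f: "int (f x) = (j * int x) mod int n" "f x < n" for x
    using n by (auto simp: f_def nat_less_iff)
  have "inj_on f {..<n}"
  proof (rule inj_onI)
    fix x y assume xy: "x \<in> {..<n}" "y \<in> {..<n}" "f x = f y"
    then have "(j * int x) mod int n = (j * int y) mod int n" using f(1) by metis
    then have "int n dvd j * (int x - int y)" by (simp add: mod_eq_dvd_iff algebra_simps)
    then have "int n dvd int x - int y" using j by (simp add: coprime_commute coprime_dvd_mult_right_iff)
    then have "int x mod int n = int y mod int n" by (simp add: mod_eq_dvd_iff)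
    then show "x = y" using xy by simp
  qed
  moreover have "f ` {..<n} \<subseteq> {..<n}" using f(2) by auto
  ultimately have "f ` {..<n} = {..<n}" by (intro endo_inj_surj) auto
  have "(\<Sum>x<n. bern6 n (j * int x)) = (\<Sum>x<n. bern6 n (int (f x)))"
    by (intro sum.cong) (simp_all add: f(1) bern6_mod)
  also have "\<dots> = (\<Sum>y\<in>f ` {..<n}. bern6 n (int y))"
    using \<open>inj_on f {..<n}\<close> by (simp add: sum.reindex)
  finally show ?thesis using \<open>f ` {..<n} = {..<n}\<close> sum_bern6_base[OF n] by simp
qed

text \<open>With h = gcd(j, N) and n = N/h, the fractions jx/N run h times through the multiples of
  1/n modulo 1, so the sum is h/n = h^2/N.\<close>

lemma sum_bern6_full:
  assumes N: "N > 0"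
  shows "(\<Sum>x<N. bern6 N (j * int x)) = of_int ((gcd j (int N))\<^sup>2) / of_nat N"
proof -
  define h where "h = nat (gcd j (int N))"
  have h: "int h = gcd j (int N)" "h > 0" using N by (auto simp: h_def)
  obtain j' where j': "j = int h * j'" unfolding h(1) using gcd_dvd1 by (metis dvdE)
  obtain n where n: "N = h * n"
  proof -
    have "int h dvd int N" unfolding h(1) by simp
    then show ?thesis using that by (auto elim: dvdE)
  qed
  have n0: "n > 0" using N n by simp
  have "gcd (int h * j') (int h * int n) = int h" using h(1) by (simp add: n j'[symmetric])
  then have cop: "coprime j' (int n)"
    using h(2) gcd_mult_distrib_int[of "int h" j' "int n"] by (simp add: coprime_iff_gcd_eq_1)
  have "(\<Sum>x<N. bern6 N (j * int x)) = (\<Sum>x<h * n. bern6 n (j' * int x))"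
    using bern6_scale[OF h(2), of n] by (simp add: n j' mult.assoc)
  also have "\<dots> = (\<Sum>i<h. \<Sum>x = i * n..<i * n + n. bern6 n (j' * int x))"
    by (rule sum.nat_group[symmetric])
  also have "\<dots> = (\<Sum>i<h. \<Sum>x<n. bern6 n (j' * int x))"
  proof (rule sum.cong[OF refl])
    fix i
    have "(\<Sum>x = i * n..<i * n + n. bern6 n (j' * int x)) = (\<Sum>x = 0..<n. bern6 n (j' * int (x + i * n)))"
      using sum.shift_bounds_nat_ivl[of "\<lambda>x. bern6 n (j' * int x)" 0 "i * n" n] by (simp add: add.commute)
    also have "\<dots> = (\<Sum>x = 0..<n. bern6 n (j' * int x))"
    proof (rule sum.cong[OF refl])
      fix x
      have "j' * int (x + i * n) = j' * int x + (j' * int i) * int n" by (simp add: algebra_simps)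
      then have "(j' * int (x + i * n)) mod int n = (j' * int x) mod int n" by (simp only: mod_mult_self1)
      then show "bern6 n (j' * int (x + i * n)) = bern6 n (j' * int x)" using bern6_mod by metis
    qed
    finally show "(\<Sum>x = i * n..<i * n + n. bern6 n (j' * int x)) = (\<Sum>x<n. bern6 n (j' * int x))"
      by (simp add: atLeast0LessThan)
  qed
  also have "\<dots> = of_nat h / of_nat n" by (simp add: sum_bern6_unit[OF n0 cop])
  also have "\<dots> = of_int ((gcd j (int N))\<^sup>2) / of_nat N"
    unfolding h(1)[symmetric] using h(2) n0 by (simp add: n power2_eq_square)
  finally show ?thesis .
qed

definition units_below :: "nat \<Rightarrow> int set" where
  "units_below g = {t. t \<in> {0..<int g} \<and> coprime t (int g)}"

lemma finite_units_below [simp]: "finite (units_below g)"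
  unfolding units_below_def by (rule finite_subset[of _ "{0..<int g}"]) auto

text \<open>Each x/N with 0 \<le> x < N has exactly one reduced form t/g with g dividing N.\<close>

lemma sum_reduced_fractions:
  assumes N: "N > 0"
  shows "(\<Sum>g | g dvd N. \<Sum>t\<in>units_below g. bern6 g (j * t)) = (\<Sum>x<N. bern6 N (j * int x))"
proof -
  have fin: "finite {g. g dvd N}" using N by simp
  have "(\<Sum>g | g dvd N. \<Sum>t\<in>units_below g. bern6 g (j * t)) =
      (\<Sum>(g, t)\<in>(SIGMA g:{g. g dvd N}. units_below g). bern6 g (j * t))"
    by (rule sum.Sigma) (use fin in auto)
  also have "\<dots> = (\<Sum>x<N. bern6 N (j * int x))"
  proof (rule sum.reindex_bij_witness[where
        i = "\<lambda>x. (N div gcd x N, int (x div gcd x N))" and j = "\<lambda>(g, t). nat t * (N div g)"], goal_cases)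
    case (1 p)
    then obtain g t where p: "p = (g, t)" "g dvd N" "0 \<le> t" "t < int g" "coprime t (int g)"
      by (auto simp: units_below_def)
    obtain h where h: "N = g * h" using p(2) by auto
    have h0: "h > 0" and g0: "g > 0" using N h by auto
    have "coprime (nat t) g" using p(3,5) by (metis coprime_int_iff int_nat_eq)
    then have "gcd (nat t * h) N = h" by (simp add: h gcd_mult_distrib_nat mult.commute[of _ h] flip: gcd_mult_distrib_nat)
    then show ?case using p(3) h0 g0 by (simp add: p(1) h)
  next
    case (2 p)
    then obtain g t where p: "p = (g, t)" "g dvd N" "0 \<le> t" "t < int g" "coprime t (int g)"
      by (auto simp: units_below_def)
    obtain h where h: "N = g * h" using p(2) by auto
    have "nat t < g" using p by (simp add: nat_less_iff)
    then show ?case using N by (simp add: p(1) h)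
  next
    case (3 x)
    then show ?case by (simp add: dvd_div_mult_self div_div_eq_right)
  next
    case (4 x)
    define d where "d = gcd x N"
    have d: "d > 0" "d dvd N" "d dvd x" using N by (auto simp: d_def)
    obtain y n where y: "x = d * y" and n: "N = d * n" using d by blast
    have "gcd (d * y) (d * n) = d" using d_def y n by simp
    then have "coprime y n" using d by (simp add: coprime_iff_gcd_eq_1 flip: gcd_mult_distrib_nat)
    moreover have "y < n" using 4 d by (simp add: y n)
    ultimately show ?case using d by (simp add: d_def[symmetric] units_below_def) (simp add: y n)
  next
    case (5 p)
    then obtain g t where p: "p = (g, t)" "g dvd N" "0 \<le> t" "t < int g" "coprime t (int g)"
      by (auto simp: units_below_def)
    obtain h where h: "N = g * h" using p(2) by auto
    have "h > 0" using N h by auto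
    have "bern6 (h * g) (int h * (j * t)) = bern6 g (j * t)" by (rule bern6_scale) fact
    then show ?case using p(3) N by (simp add: p(1) h mult_ac)
  qed
  finally show ?thesis .
qed

text \<open>\<open>primitive_sum j N\<close> is the sum of the values \<open>6 B\<^sub>2(\<langle>jx / N\<rangle>)\<close> over the pairs
  \<open>(x, y)\<close> of order \<open>N\<close> in \<open>(\<int>/N)\<^sup>2\<close>; summing over all divisors of \<open>N\<close> gives
  the sum over all pairs.\<close>

definition primitive_sum :: "int \<Rightarrow> nat \<Rightarrow> rat" where
  "primitive_sum j N = (\<Sum>g | g dvd N. of_nat (totient (N div g)) * (\<Sum>t\<in>units_below g. of_nat g * bern6 g (j * t)))"

text \<open>After the exchange of the two divisors, the totients of the divisors of N/g add up to
  N/g. What is left is N times the sum over all reduced fractions.\<close>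

lemma sum_primitive_sum:
  assumes N: "N > 0"
  shows "(\<Sum>M | M dvd N. primitive_sum j M) = of_int ((gcd j (int N))\<^sup>2)"
proof -
  define T where "T = (\<lambda>g. \<Sum>t\<in>units_below g. of_nat g * bern6 g (j * t))"
  have fin: "finite {g. g dvd M}" if "M dvd N" for M using N that by (metis finite_divisors_nat dvd_pos_nat)
  have "(\<Sum>M | M dvd N. primitive_sum j M) =
     (\<Sum>(M, g)\<in>(SIGMA M:{M. M dvd N}. {g. g dvd M}). of_nat (totient (M div g)) * T g)"
    unfolding primitive_sum_def T_def by (rule sum.Sigma) (use fin in auto)
  also have "\<dots> = (\<Sum>(g, e)\<in>(SIGMA g:{g. g dvd N}. {e. e dvd N div g}). of_nat (totient e) * T g)"
  proof (rule sum.reindex_bij_witness[where i = "\<lambda>(g, e). (g * e, g)" and j = "\<lambda>(M, g). (g, M div g)"], goal_cases)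
    case (1 p)
    then show ?case by auto
  next
    case (2 p)
    then show ?case by (auto intro: dvd_trans div_dvd_div)
  next
    case (3 p)
    then have "fst p > 0" using N by (auto intro: dvd_pos_nat)
    then show ?case using 3 by auto
  next
    case (4 p)
    then show ?case using N by (auto elim!: dvdE)
  next
    case (5 p)
    then show ?case by auto
  qed
  also have "\<dots> = (\<Sum>g | g dvd N. \<Sum>e | e dvd N div g. of_nat (totient e) * T g)"
    by (rule sum.Sigma[symmetric]) (use fin N in \<open>auto intro!: fin\<close>)
  also have "\<dots> = (\<Sum>g | g dvd N. of_nat (N div g) * T g)"
    by (intro sum.cong refl) (simp only: sum_distrib_right[symmetric] of_nat_sum[symmetric] totient_divisor_sum)
  also have "\<dots> = (\<Sum>g | g dvd N. of_nat N * (\<Sum>t\<in>units_below g. bern6 g (j * t)))"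
  proof (intro sum.cong refl)
    fix g assume "g \<in> {g. g dvd N}"
    then have "of_nat (N div g) * of_nat g = (of_nat N :: rat)" by (simp flip: of_nat_mult)
    then show "of_nat (N div g) * T g = of_nat N * (\<Sum>t\<in>units_below g. bern6 g (j * t))"
      unfolding T_def sum_distrib_left[symmetric] mult.assoc[symmetric] by simp
  qed
  also have "\<dots> = of_nat N * (of_int ((gcd j (int N))\<^sup>2) / of_nat N)"
    by (simp only: sum_distrib_left[symmetric] sum_reduced_fractions[OF N] sum_bern6_full[OF N])
  finally show ?thesis using N by simp
qed

text \<open>Moebius inversion in the form of an induction. With h = gcd(j, N), the divisors of h
  alone already contribute h^2, which is the total over all divisors of N. The other proper divisors
  contribute 0 by induction, so nothing is left for N itself.\<close>

lemma primitive_sum_eq_0: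
  assumes "N > 0" "\<not> int N dvd j"
  shows "primitive_sum j N = 0"
  using assms
proof (induction N rule: less_induct)
  case (less N)
  define h where "h = nat (gcd j (int N))"
  have h: "int h = gcd j (int N)" "h > 0" using less by (auto simp: h_def)
  have fin: "finite {M. M dvd N}" using less by simp
  have hN: "h dvd N"
  proof -
    have "int h dvd int N" unfolding h(1) by simp
    then show ?thesis by simp
  qed
  have hn: "\<not> N dvd h"
    using less.prems h(1) by (metis dvd_trans gcd_dvd1 int_dvd_int_iff)
  let ?A = "{M. M dvd N \<and> M \<noteq> N \<and> \<not> M dvd h}"
  let ?B = "{M. M dvd h}"
  have fin': "finite ?A" "finite ?B" using fin h by simp_all
  have split: "{M. M dvd N} = insert N (?A \<union> ?B)"
    using hN by (auto intro: dvd_trans)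
  have "N \<notin> ?A \<union> ?B" using hn by simp
  moreover have "?A \<inter> ?B = {}" by blast
  ultimately have sum: "(\<Sum>M | M dvd N. primitive_sum j M) =
      primitive_sum j N + ((\<Sum>M\<in>?A. primitive_sum j M) + (\<Sum>M\<in>?B. primitive_sum j M))"
    unfolding split using fin' by (simp only: sum.insert finite_Un simp_thms sum.union_disjoint)
  have B: "(\<Sum>M\<in>?B. primitive_sum j M) = of_int ((gcd j (int N))\<^sup>2)"
    using sum_primitive_sum[OF h(2), of j] unfolding h(1) by simp
  have A: "(\<Sum>M\<in>?A. primitive_sum j M) = 0"
  proof (rule sum.neutral, intro ballI)
    fix M assume "M \<in> ?A"
    then have M: "M dvd N" "M \<noteq> N" "\<not> M dvd h" by simp_all
    have "M < N" using M(1,2) less.prems(1) dvd_imp_le le_neq_implies_less by blast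
    moreover have "M > 0" using M(1) less.prems(1) dvd_pos_nat by blast
    moreover have "\<not> int M dvd j"
    proof
      assume "int M dvd j"
      then have "int M dvd int h" unfolding h(1) using M by simp
      then show False using M by simp
    qed
    ultimately show "primitive_sum j M = 0" using less.IH by blast
  qed
  show ?case
    using sum sum_primitive_sum[OF less.prems(1), of j] unfolding A B by simp
qed

lemma card_units_below:
  assumes "g > 0"
  shows "card (units_below g) = totient g"
\<comment> \<open>For g = 1 the representatives differ: 0 here, 1 in
  \<open>totatives\<close>.\<close>
proof (cases "g = 1")
  case True
  then have "units_below g = {0}" by (auto simp: units_below_def)
  then show ?thesis using True by simp
next
  case False
  have "units_below g = int ` totatives g"
  proof (intro equalityI subsetI)
    fix t assume "t \<in> units_below g"
    then have t: "0 \<le> t" "t < int g" "coprime t (int g)" by (auto simp: units_below_def)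
    have "t \<noteq> 0" using t(3) False assms by auto
    moreover have "coprime (nat t) g" using t by (metis coprime_int_iff int_nat_eq)
    ultimately have "nat t \<in> totatives g" using t by (auto simp: totatives_def)
    then show "t \<in> int ` totatives g" using t by (metis imageI int_nat_eq)
  next
    fix t assume "t \<in> int ` totatives g"
    then obtain x where "t = int x" "0 < x" "x \<le> g" "coprime x g" by (auto simp: totatives_def)
    moreover have "x \<noteq> g" using \<open>coprime x g\<close> False by auto
    ultimately show "t \<in> units_below g" by (simp add: units_below_def)
  qed
  then show ?thesis by (simp add: totient_def card_image)
qed

lemma R_num_eq:
  assumes "N > 0"
  shows "(\<Sum>g | g dvd N. of_nat (totient (N div g)) / 2 * (\<Sum>t\<in>units_below g. of_nat g / 12)) = R_num N"
proof -
  have "(\<Sum>g | g dvd N. of_nat (totient (N div g)) / 2 * (\<Sum>t\<in>units_below g. of_nat g / 12 :: rat)) =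
     (\<Sum>g | g dvd N. 1 / 24 * of_nat (g * totient g * totient (N div g)))"
    by (intro sum.cong refl) (use assms in \<open>auto simp: card_units_below dvd_pos_nat\<close>)
  then show ?thesis by (simp add: R_num_def sum_distrib_left)
qed

text \<open>The order at y splits into k g/12 and the sum of a_j g B_2(<jy/g>)/2. The first parts
  add up to k R_N; the second give multiples of \<open>primitive_sum j N\<close>, which vanish as 0
  < j < N.\<close>

lemma sum_mu_order:
  assumes N: "N \<ge> 2" and ac: "cusp_orbit_reps N a c"
  shows "(\<Sum>r\<le>N div 2. cusp_mu N c r *
      (of_int (cusp_exp N k v (int (cusp_g N c r)) (a r)) / (12 * of_nat (cusp_g N c r)))) = of_nat k * R_num N"
proof -
  define F where "F = (\<lambda>g y. of_int (cusp_exp N k v (int g) y) / (12 * of_nat g) :: rat)"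
  define m where "m = N div 2"
  define \<alpha> where "\<alpha> = (\<lambda>j. of_int (v $ (j - 1)) :: rat)"
  have F: "F g y = of_nat k * (of_nat g / 12) + (\<Sum>j = 1..m. \<alpha> j * (of_nat g * bern6 g (int j * y) / 12))"
    if "g > 0" for g y
  proof -
    have "of_int (cusp_exp N k v (int g) y) = of_nat k * of_nat (g\<^sup>2) +
        (\<Sum>j = 1..m. \<alpha> j * (of_nat (g\<^sup>2) * bern6 g (int j * y)))"
    proof -
      have "of_nat (g\<^sup>2) * bern6 g z = of_int (6 * quad (int g) z + (int g)\<^sup>2)" for z
        using that by (simp add: bern6_def)
      moreover have "cusp_exp N k v (int g) y = int k * (int g)\<^sup>2 +
          (\<Sum>j = 1..m. v $ (j - 1) * (6 * quad (int g) (int j * y) + (int g)\<^sup>2))"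
        by (simp add: cusp_exp_quad m_def[symmetric] ring_distribs sum.distrib sum_distrib_left mult_ac)
      ultimately show ?thesis by (simp add: \<alpha>_def)
    qed
    then show ?thesis
      using that by (simp add: F_def add_divide_distrib sum_divide_distrib power2_eq_square)
  qed
  have "(\<Sum>r\<le>N div 2. cusp_mu N c r * F (cusp_g N c r) (a r)) =
    (\<Sum>g | g dvd N. of_nat (totient (N div g)) / 2 * (\<Sum>t | t \<in> {0..<int g} \<and> coprime t (int g). F g t))"
  proof (rule sum_cusp_mu[OF N ac])
    fix g y y' and e :: int assume "e \<in> {1, -1}" "int g dvd y' - e * y"
    from cusp_exp_sign_cong[OF this] show "F g y' = F g y" by (simp add: F_def)
  qed
  also have "\<dots> = (\<Sum>g | g dvd N. of_nat k * (of_nat (totient (N div g)) / 2 * (\<Sum>t\<in>units_below g. of_nat g / 12)) +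
     (\<Sum>j = 1..m. \<alpha> j / 24 * (of_nat (totient (N div g)) * (\<Sum>t\<in>units_below g. of_nat g * bern6 g (int j * t)))))"
  proof (intro sum.cong refl)
    fix g assume "g \<in> {g. g dvd N}"
    then have g: "g > 0" using N dvd_pos_nat[of N g] by auto
    have "(\<Sum>t | t \<in> {0..<int g} \<and> coprime t (int g). F g t) =
      (\<Sum>t\<in>units_below g. of_nat k * (of_nat g / 12)) + (\<Sum>t\<in>units_below g. \<Sum>j = 1..m. \<alpha> j * (of_nat g * bern6 g (int j * t) / 12))"
      unfolding units_below_def[symmetric] F[OF g] sum.distrib ..
    also have "(\<Sum>t\<in>units_below g. \<Sum>j = 1..m. \<alpha> j * (of_nat g * bern6 g (int j * t) / 12)) =
       (\<Sum>j = 1..m. \<Sum>t\<in>units_below g. \<alpha> j * (of_nat g * bern6 g (int j * t) / 12))"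
      by (rule sum.swap)
    finally show "of_nat (totient (N div g)) / 2 * (\<Sum>t | t \<in> {0..<int g} \<and> coprime t (int g). F g t) =
      of_nat k * (of_nat (totient (N div g)) / 2 * (\<Sum>t\<in>units_below g. of_nat g / 12)) +
     (\<Sum>j = 1..m. \<alpha> j / 24 * (of_nat (totient (N div g)) * (\<Sum>t\<in>units_below g. of_nat g * bern6 g (int j * t))))"
      by (simp add: sum_distrib_left sum_divide_distrib ring_distribs mult_ac)
  qed
  also have "\<dots> = of_nat k * R_num N + (\<Sum>j = 1..m. \<alpha> j / 24 * primitive_sum (int j) N)"
    unfolding sum.distrib sum_distrib_left[symmetric] R_num_eq[OF less_le_trans[OF zero_less_numeral N]]
    by (subst sum.swap) (simp add: primitive_sum_def sum_distrib_left)
  also have "(\<Sum>j = 1..m. \<alpha> j / 24 * primitive_sum (int j) N) = 0"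
  proof (rule sum.neutral, safe)
    fix j assume "j \<in> {1..m}"
    then have "0 < j" "j < N" using N by (auto simp: m_def)
    then have "\<not> int N dvd int j" by (auto dest: dvd_imp_le)
    then show "\<alpha> j / 24 * primitive_sum (int j) N = 0" using primitive_sum_eq_0[of N "int j"] N by simp
  qed
  finally show ?thesis by (simp add: F_def)
qed

section \<open>Nonsingularity\<close>

lemma cos_eq_Re_ep: "cos (2 * pi * x) = Re (ep (of_real x))"
  by (simp add: ep_def Re_exp)

lemma sum_ep_residues:
  fixes z :: int
  assumes N: "N > 0"
  shows "(\<Sum>x<N. ep (of_nat x * (of_int z / of_nat N))) = (if int N dvd z then of_nat N else 0)"
proof -
  define w where "w = ep (of_int z / of_nat N)"
  have "(\<Sum>x<N. ep (of_nat x * (of_int z / of_nat N))) = (\<Sum>x<N. w ^ x)"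
    by (simp add: w_def ep_power)
  also have "\<dots> = (if w = 1 then of_nat N else (1 - w ^ N) / (1 - w))"
    by (rule sum_gp_strict)
  also have "w ^ N = 1" using N by (simp add: w_def ep_power)
  also have "w = 1 \<longleftrightarrow> int N dvd z"
  proof
    assume "w = 1"
    then obtain y where "of_int z / of_nat N = (of_int y :: complex)" by (auto simp: w_def ep_eq_1_iff Ints_def)
    then have "of_int z = (of_int (int N * y) :: complex)" using N by (simp add: field_simps)
    then have "z = int N * y" by (simp only: of_int_eq_iff)
    then show "int N dvd z" by simp
  next
    assume "int N dvd z"
    then obtain y where "z = int N * y" by blast
    then show "w = 1" using N by (simp add: w_def)
  qed
  finally show ?thesis by simp
qed

lemma sum_cos_residues:
  fixes z :: int
  assumes N: "N > 0"
  shows "(\<Sum>x<N. cos (2 * pi * (of_int z * real x / real N))) = (if int N dvd z then real N else 0)"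
proof -
  have "(\<Sum>x<N. cos (2 * pi * (of_int z * real x / real N))) = Re (\<Sum>x<N. ep (of_nat x * (of_int z / of_nat N)))"
    unfolding cos_eq_Re_ep Re_sum by (simp add: mult.commute)
  then show ?thesis unfolding sum_ep_residues[OF N] by simp
qed

text \<open>A second difference multiplies cos(2 pi n x/N) by -4 sin^2(pi n/N). Dividing by sin^2
  thus yields a function whose second differences are constant away from the multiples of N, as they
  are for B_2(<x/N>).\<close>

definition csc_sum :: "nat \<Rightarrow> int \<Rightarrow> real" where
  "csc_sum N x = (\<Sum>n = 1..<N. cos (2 * pi * (real n * of_int x / real N)) / (sin (pi * real n / real N))\<^sup>2)"

lemma sin_nonzero:
  assumes "n \<in> {1..<N}"
  shows "sin (pi * real n / real N) > 0"
  using assms by (intro sin_gt_zero) (auto simp: field_simps)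

lemma sum_residues_diff:
  assumes N: "N > 0"
  shows "(\<Sum>n = 1..<N. cos (2 * pi * (real n * of_int x / real N))) = (if int N dvd x then real N else 0) - 1"
proof -
  have "{..<N} = insert 0 {1..<N}" using N by auto
  then show ?thesis using sum_cos_residues[OF N, of x] by (simp add: mult.commute[of "real_of_int x"])
qed

text \<open>Both sides of the finite Fourier expansion of \<open>B\<^sub>2\<close> have the same second differences.\<close>

lemma csc_sum_second_diff:
  assumes N: "N > 0"
  shows "csc_sum N (x + 1) - 2 * csc_sum N x + csc_sum N (x - 1) =
    4 - 4 * (if int N dvd x then real N else 0)"
proof -
  have "csc_sum N (x + 1) - 2 * csc_sum N x + csc_sum N (x - 1) =
      (\<Sum>n = 1..<N. - 4 * cos (2 * pi * (real n * of_int x / real N)))"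
    unfolding csc_sum_def sum_distrib_left sum_subtractf[symmetric] sum.distrib[symmetric]
  proof (rule sum.cong[OF refl])
    fix n assume n: "n \<in> {1..<N}"
    define t where "t = pi * real n / real N"
    define u where "u = 2 * pi * (real n * of_int x / real N)"
    have s: "sin t \<noteq> 0" using sin_nonzero[OF n] by (simp add: t_def)
    have 1: "2 * pi * (real n * of_int (x + 1) / real N) = u + 2 * t"
      "2 * pi * (real n * of_int (x - 1) / real N) = u - 2 * t"
      using N by (simp_all add: u_def t_def field_simps)
    have "cos (u + 2 * t) - 2 * cos u + cos (u - 2 * t) = 2 * cos u * (cos (2 * t) - 1)"
      by (simp add: cos_add cos_diff algebra_simps)
    also have "cos (2 * t) = 1 - 2 * (sin t)\<^sup>2" by (rule cos_double_sin)
    finally have "cos (u + 2 * t) - 2 * cos u + cos (u - 2 * t) = - 4 * cos u * (sin t)\<^sup>2" by simp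
    then have "(cos (u + 2 * t) - 2 * cos u + cos (u - 2 * t)) / (sin t)\<^sup>2 = - 4 * cos u" using s by simp
    then show "cos (2 * pi * (real n * of_int (x + 1) / real N)) / (sin (pi * real n / real N))\<^sup>2 -
       2 * (cos (2 * pi * (real n * of_int x / real N)) / (sin (pi * real n / real N))\<^sup>2) +
       cos (2 * pi * (real n * of_int (x - 1) / real N)) / (sin (pi * real n / real N))\<^sup>2 =
       - 4 * cos (2 * pi * (real n * of_int x / real N))"
      unfolding 1 t_def[symmetric] u_def[symmetric] by (simp add: add_divide_distrib diff_divide_distrib)
  qed
  then show ?thesis unfolding sum_distrib_left[symmetric] sum_residues_diff[OF N] by simp
qed

lemma csc_sum_minus: "csc_sum N (- x) = csc_sum N x"
  by (simp add: csc_sum_def)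

text \<open>The second differences determine the function from its value at 0 and its first step;
  evenness supplies the latter, since the values at 1 and -1 agree.\<close>

lemma csc_sum_eq_0:
  assumes N: "N > 0" and x: "x \<le> N"
  shows "csc_sum N (int x) = csc_sum N 0 + 2 * (real x)\<^sup>2 - 2 * real N * real x"
proof -
  define D where "D = (\<lambda>x. csc_sum N (int x) - 2 * (real x)\<^sup>2 + 2 * real N * real x)"
  have "D (Suc y) = D y" if "y < N" for y
    using that
  proof (induction y)
    case 0
    have "csc_sum N 1 - 2 * csc_sum N 0 + csc_sum N (- 1) = 4 - 4 * real N"
      using csc_sum_second_diff[OF N, of 0] by simp
    then show ?case using csc_sum_minus[of N 1] by (simp add: D_def)
  next
    case (Suc y)
    have "\<not> int N dvd int (Suc y)" using Suc.prems by (auto dest: dvd_imp_le simp del: of_nat_Suc)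
    then have "csc_sum N (int (Suc (Suc y))) - 2 * csc_sum N (int (Suc y)) + csc_sum N (int y) = 4"
      using csc_sum_second_diff[OF N, of "int (Suc y)"] by (simp add: algebra_simps)
    then show ?case using Suc by (simp add: D_def algebra_simps power2_eq_square)
  qed
  then have "D y = D 0" if "y \<le> N" for y
    using that by (induction y) auto
  from this[OF x] show ?thesis by (simp add: D_def)
qed

text \<open>The cosine sum has no constant term, so its values over all residues add up to 0; this
  fixes the free constant in \<open>csc_sum_eq_0\<close>.\<close>

lemma csc_sum_0:
  assumes N: "N > 0"
  shows "csc_sum N 0 = ((real N)\<^sup>2 - 1) / 3"
proof -
  have "(\<Sum>x<N. csc_sum N (int x)) = 0"
    unfolding csc_sum_def
  proof (subst sum.swap, rule sum.neutral, safe)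
    fix n assume n: "n \<in> {1..<N}"
    have "(\<Sum>x<N. cos (2 * pi * (real n * of_int (int x) / real N)) / (sin (pi * real n / real N))\<^sup>2) =
        (\<Sum>x<N. cos (2 * pi * (of_int (int n) * real x / real N))) / (sin (pi * real n / real N))\<^sup>2"
      by (simp add: sum_divide_distrib)
    also have "(\<Sum>x<N. cos (2 * pi * (of_int (int n) * real x / real N))) = 0"
      unfolding sum_cos_residues[OF N] using n by (auto dest: dvd_imp_le)
    finally show "(\<Sum>x<N. cos (2 * pi * (real n * of_int (int x) / real N)) / (sin (pi * real n / real N))\<^sup>2) = 0"
      by simp
  qed
  moreover have "(\<Sum>x<N. csc_sum N (int x)) = (\<Sum>x<N. csc_sum N 0 + 2 * (real x)\<^sup>2 - 2 * real N * real x)"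
    by (intro sum.cong refl csc_sum_eq_0 N) simp
  ultimately have S0: "(\<Sum>x<N. csc_sum N 0 + 2 * (real x)\<^sup>2 - 2 * real N * real x) = 0"
    by (simp only:)
  have sumK: "3 * (\<Sum>x<K. csc_sum N 0 + 2 * (real x)\<^sup>2 - 2 * real N * real x) =
      3 * real K * csc_sum N 0 + real K * (real K - 1) * (2 * real K - 1) - 3 * real N * real K * (real K - 1)" for K
    by (induction K) (simp_all add: algebra_simps power2_eq_square)
  have "real N * (3 * csc_sum N 0 + (real N - 1) * (2 * real N - 1) - 3 * real N * (real N - 1)) = 0"
    using sumK[of N] unfolding S0 by (simp add: algebra_simps)
  then have "3 * csc_sum N 0 + (real N - 1) * (2 * real N - 1) - 3 * real N * (real N - 1) = 0"
    using N by simp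
  then show ?thesis by (simp add: field_simps power2_eq_square)
qed

lemma csc_sum_period:
  assumes "N > 0"
  shows "csc_sum N (x mod int N) = csc_sum N x"
  unfolding csc_sum_def
proof (rule sum.cong[OF refl])
  fix n
  have "of_int x = of_int (x mod int N) + real N * of_int (x div int N)"
    by (metis mult_div_mod_eq add.commute of_int_add of_int_mult of_int_of_nat_eq)
  then have "2 * pi * (real n * of_int x / real N) =
      2 * pi * (real n * of_int (x mod int N) / real N) + 2 * pi * of_int (int n * (x div int N))"
    using assms by (simp add: field_simps)
  then have "cos (2 * pi * (real n * of_int x / real N)) = cos (2 * pi * (real n * of_int (x mod int N) / real N))"
    by (simp only: cos_add cos_int_2pin sin_int_2pin)
  then show "cos (2 * pi * (real n * of_int (x mod int N) / real N)) / (sin (pi * real n / real N))\<^sup>2 =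
    cos (2 * pi * (real n * of_int x / real N)) / (sin (pi * real n / real N))\<^sup>2" by simp
qed

lemma quad_eq_csc_sum:
  assumes N: "N > 0"
  shows "6 * real_of_int (quad (int N) x) + (real N)\<^sup>2 = 3 * csc_sum N x + 1"
proof -
  define t where "t = nat (x mod int N)"
  have t: "int t = x mod int N" "t \<le> N" using N by (auto simp: t_def nat_le_iff less_imp_le)
  have "csc_sum N x = csc_sum N (int t)" using csc_sum_period[OF N, of x] t by simp
  also have "\<dots> = ((real N)\<^sup>2 - 1) / 3 + 2 * (real t)\<^sup>2 - 2 * real N * real t"
    by (simp add: csc_sum_eq_0[OF N t(2)] csc_sum_0[OF N])
  finally have "3 * csc_sum N x = (real N)\<^sup>2 - 1 + 6 * (real t)\<^sup>2 - 6 * real N * real t" by simp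
  then show ?thesis
    unfolding quad_def t(1)[symmetric] by (simp add: algebra_simps power2_eq_square)
qed

text \<open>From sin x < x the left side exceeds N^2/pi^2, and pi^2 \<le> 12 follows from pi/6 \<le>
  tan(pi/6) = 1/sqrt 3. The bound is chosen such that the two coefficients at 1 and N - 1 exceed
  N^2/6, which is more than half of the full sum (N^2 - 1)/3.\<close>

lemma csc_squared_1:
  assumes N: "N \<ge> 3"
  shows "1 / (sin (pi / real N))\<^sup>2 > (real N)\<^sup>2 / 12"
proof -
  have "\<bar>pi / 6\<bar> \<le> \<bar>tan (pi / 6)\<bar>" by (rule abs_tan_ge) simp
  then have "pi / 6 \<le> 1 / sqrt 3" by (simp add: tan_30)
  then have "(pi / 6)\<^sup>2 \<le> (1 / sqrt 3)\<^sup>2" by (intro power_mono) auto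
  then have pi: "pi\<^sup>2 \<le> 12" by (simp add: power_divide)
  define y where "y = pi / real N / 2"
  have y: "0 < y" "y < pi / 2" using N by (auto simp: y_def field_simps)
  have cy: "0 < cos y" "cos y < 1" using y cos_gt_zero[of y] cos_monotone_0_pi[of 0 y] by auto
  have "sin (pi / real N) = 2 * sin y * cos y" using sin_double[of y] by (simp add: y_def)
  also have "\<dots> < 2 * sin y * 1"
    using y sin_gt_zero2[of y] cy by (intro mult_strict_left_mono) auto
  also have "\<dots> \<le> 2 * y" using sin_x_le_x[of y] y by simp
  finally have less: "sin (pi / real N) < pi / real N" by (simp add: y_def)
  have pos: "sin (pi / real N) > 0" using sin_nonzero[of 1 N] N by simp
  have "(sin (pi / real N))\<^sup>2 < (pi / real N)\<^sup>2" using less pos by (intro power_strict_mono) auto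
  also have "\<dots> \<le> 12 / (real N)\<^sup>2" using pi by (simp add: power_divide divide_right_mono)
  finally show ?thesis using pos N by (simp add: field_simps)
qed

text \<open>The Fourier coefficients of \<open>B\<^sub>2\<close> are positive, and the two at \<open>n = \<plusminus>1\<close> exceed
  half of their sum; this contradicts the assumption at a maximum of the cosine transform \<open>bh\<close>.\<close>

lemma cusp_exp_kernel:
  assumes N: "N \<ge> 3" and ker: "\<And>x. cusp_exp N 0 b (int N) x = 0" and i: "i \<in> {1..N div 2}"
  shows "b $ (i - 1) = 0"
proof -
  define m where "m = N div 2"
  define \<beta> where "\<beta> = (\<lambda>j. real_of_int (b $ (j - 1)))"
  define bh where "bh = (\<lambda>y :: int. \<Sum>j = 1..m. \<beta> j * cos (2 * pi * (real j * of_int y / real N)))"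
  define c where "c = (\<lambda>n. 1 / (sin (pi * real n / real N))\<^sup>2)"
  have N0: "N > 0" using N by simp
  have c_pos: "c n > 0" if "n \<in> {1..<N}" for n using sin_nonzero[OF that] by (simp add: c_def)
  have sum_c: "(\<Sum>n = 1..<N. c n) = ((real N)\<^sup>2 - 1) / 3"
    using csc_sum_0[OF N0] by (simp add: csc_sum_def c_def)
  \<comment> \<open>The Fourier expansion turns the vanishing orders into relations between values
    of bh; the term bh 0 stems from the constant 1 in \<open>quad_eq_csc_sum\<close>.\<close>
  have eq0: "bh 0 + 3 * (\<Sum>n = 1..<N. c n * bh (int n * x)) = 0" for x
  proof -
    have "0 = real_of_int (cusp_exp N 0 b (int N) x)" by (simp add: ker)
    also have "\<dots> = (\<Sum>j = 1..m. \<beta> j * (6 * real_of_int (quad (int N) (int j * x)) + (real N)\<^sup>2))"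
      by (simp add: cusp_exp_quad m_def[symmetric] \<beta>_def ring_distribs sum.distrib sum_distrib_left mult_ac)
    also have "\<dots> = (\<Sum>j = 1..m. \<beta> j * (3 * csc_sum N (int j * x) + 1))"
      by (simp only: quad_eq_csc_sum[OF N0])
    also have "\<dots> = bh 0 + 3 * (\<Sum>j = 1..m. \<beta> j * csc_sum N (int j * x))"
      by (simp add: bh_def ring_distribs sum.distrib sum_distrib_left mult_ac)
    also have "(\<Sum>j = 1..m. \<beta> j * csc_sum N (int j * x)) =
        (\<Sum>j = 1..m. \<Sum>n = 1..<N. \<beta> j * (cos (2 * pi * (real n * of_int (int j * x) / real N)) * c n))"
      by (simp add: csc_sum_def c_def sum_distrib_left)
    also have "\<dots> = (\<Sum>n = 1..<N. \<Sum>j = 1..m. \<beta> j * (cos (2 * pi * (real n * of_int (int j * x) / real N)) * c n))"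
      by (rule sum.swap)
    also have "\<dots> = (\<Sum>n = 1..<N. c n * bh (int n * x))"
      by (simp add: bh_def sum_distrib_left mult_ac)
    finally show ?thesis by simp
  qed
  have bh_mod: "bh (y mod int N) = bh y" for y
    unfolding bh_def
  proof (rule sum.cong[OF refl])
    fix j
    have "of_int y = of_int (y mod int N) + real N * of_int (y div int N)"
      by (metis mult_div_mod_eq add.commute of_int_add of_int_mult of_int_of_nat_eq)
    then have "2 * pi * (real j * of_int y / real N) =
        2 * pi * (real j * of_int (y mod int N) / real N) + 2 * pi * of_int (int j * (y div int N))"
      using N by (simp add: field_simps)
    then have "cos (2 * pi * (real j * of_int y / real N)) = cos (2 * pi * (real j * of_int (y mod int N) / real N))"
      by (simp only: cos_add cos_int_2pin sin_int_2pin)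
    then show "\<beta> j * cos (2 * pi * (real j * of_int (y mod int N) / real N)) = \<beta> j * cos (2 * pi * (real j * of_int y / real N))"
      by simp
  qed
  have bh_minus: "bh (- y) = bh y" for y by (simp add: bh_def)
  have "Max ((\<lambda>y. \<bar>bh y\<bar>) ` {0..<int N}) \<in> (\<lambda>y. \<bar>bh y\<bar>) ` {0..<int N}"
    using N by (intro Max_in) auto
  then obtain X where "Max ((\<lambda>y. \<bar>bh y\<bar>) ` {0..<int N}) = \<bar>bh X\<bar>" by blast
  then have "\<bar>bh y\<bar> \<le> \<bar>bh X\<bar>" if "y \<in> {0..<int N}" for y
    using that by (metis (no_types, lifting) Max_ge finite_atLeastLessThan_int finite_imageI imageI)
  from this[of "y mod int N" for y] have X: "\<bar>bh y\<bar> \<le> \<bar>bh X\<bar>" for y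
    using N by (simp add: bh_mod)
  have c1: "c (N - 1) = c 1"
  proof -
    have "pi * real (N - 1) / real N = pi - pi * real 1 / real N"
      using N by (simp add: of_nat_diff field_simps)
    then show ?thesis unfolding c_def by (simp only: sin_pi_minus)
  qed
  have bN1: "bh (int (N - 1) * X) = bh X"
  proof -
    have "int (N - 1) * X = - X + X * int N" using N by (simp add: of_nat_diff algebra_simps)
    then have "(int (N - 1) * X) mod int N = (- X) mod int N" by (simp only: mod_mult_self1)
    then show ?thesis using bh_mod bh_minus by metis
  qed
  define R where "R = {1..<N} - {1, N - 1}"
  have split: "(\<Sum>n = 1..<N. f n) = f 1 + f (N - 1) + (\<Sum>n\<in>R. f n)" for f :: "nat \<Rightarrow> real"
  proof -
    have "{1..<N} = insert 1 (insert (N - 1) R)" using N by (auto simp: R_def)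
    moreover have "1 \<notin> insert (N - 1) R" "N - 1 \<notin> R" "finite R" using N by (auto simp: R_def)
    ultimately show ?thesis by simp
  qed
  \<comment> \<open>At the maximiser X, the terms n = 1 and n = N - 1 both equal c 1 * bh X.
    Bounding everything else by |bh X| leaves 12 c 1 |bh X| \<le> N^2 |bh X|.\<close>
  have "6 * c 1 * bh X = - bh 0 - 3 * (\<Sum>n\<in>R. c n * bh (int n * X))"
    using eq0[of X] bN1 unfolding split c1 by (simp add: algebra_simps)
  then have "\<bar>6 * c 1 * bh X\<bar> \<le> \<bar>bh 0\<bar> + 3 * \<bar>\<Sum>n\<in>R. c n * bh (int n * X)\<bar>"
    by linarith
  also have "\<bar>\<Sum>n\<in>R. c n * bh (int n * X)\<bar> \<le> (\<Sum>n\<in>R. c n * \<bar>bh X\<bar>)"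
  proof (rule order_trans[OF sum_abs], rule sum_mono)
    fix n assume "n \<in> R"
    then have "c n > 0" by (intro c_pos) (simp add: R_def)
    then show "\<bar>c n * bh (int n * X)\<bar> \<le> c n * \<bar>bh X\<bar>" using X[of "int n * X"] by (simp add: abs_mult)
  qed
  also have "(\<Sum>n\<in>R. c n * \<bar>bh X\<bar>) = (((real N)\<^sup>2 - 1) / 3 - 2 * c 1) * \<bar>bh X\<bar>"
  proof -
    have "(\<Sum>n\<in>R. c n) = ((real N)\<^sup>2 - 1) / 3 - 2 * c 1" using sum_c unfolding split c1 by linarith
    then show ?thesis unfolding sum_distrib_right[symmetric] by (simp only:)
  qed
  finally have "\<bar>6 * c 1 * bh X\<bar> \<le> \<bar>bh 0\<bar> + 3 * ((((real N)\<^sup>2 - 1) / 3 - 2 * c 1) * \<bar>bh X\<bar>)"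
    by simp
  moreover have "\<bar>6 * c 1 * bh X\<bar> = 6 * c 1 * \<bar>bh X\<bar>" using c_pos[of 1] N by (simp add: abs_mult)
  moreover have "3 * ((((real N)\<^sup>2 - 1) / 3 - 2 * c 1) * \<bar>bh X\<bar>) =
      (real N)\<^sup>2 * \<bar>bh X\<bar> - \<bar>bh X\<bar> - 6 * c 1 * \<bar>bh X\<bar>"
    by (simp add: left_diff_distrib)
  ultimately have "12 * c 1 * \<bar>bh X\<bar> \<le> (real N)\<^sup>2 * \<bar>bh X\<bar>"
    using X[of 0] by linarith
  moreover have "12 * c 1 > (real N)\<^sup>2" using csc_squared_1[OF N] by (simp add: c_def field_simps)
  ultimately have "bh X = 0"
    by (metis abs_eq_0 abs_ge_zero less_eq_real_def linorder_not_less mult_strict_right_mono)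
  then have bh0: "bh y = 0" for y using X[of y] by simp
  \<comment> \<open>Orthogonality of the cosines recovers the coefficient of i, multiplied by N, or
    by 2N if i = N/2; both are nonzero.\<close>
  have "0 = (\<Sum>y<N. bh (int y) * (2 * cos (2 * pi * (real i * real y / real N))))" by (simp add: bh0)
  also have "\<dots> = (\<Sum>y<N. \<Sum>j = 1..m. \<beta> j * (cos (2 * pi * (of_int (int j - int i) * real y / real N)) +
      cos (2 * pi * (of_int (int j + int i) * real y / real N))))"
  proof (rule sum.cong[OF refl])
    fix y
    have "2 * cos (2 * pi * (real j * real y / real N)) * cos (2 * pi * (real i * real y / real N)) =
      cos (2 * pi * (of_int (int j - int i) * real y / real N)) + cos (2 * pi * (of_int (int j + int i) * real y / real N))" for j
      using cos_times_cos[of "2 * pi * (real j * real y / real N)" "2 * pi * (real i * real y / real N)"]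
      by (simp add: ring_distribs add_divide_distrib diff_divide_distrib left_diff_distrib)
    then show "bh (int y) * (2 * cos (2 * pi * (real i * real y / real N))) =
      (\<Sum>j = 1..m. \<beta> j * (cos (2 * pi * (of_int (int j - int i) * real y / real N)) +
      cos (2 * pi * (of_int (int j + int i) * real y / real N))))"
      unfolding bh_def sum_distrib_right by (intro sum.cong refl) (simp add: mult_ac)
  qed
  also have "\<dots> = (\<Sum>j = 1..m. \<Sum>y<N. \<beta> j * (cos (2 * pi * (of_int (int j - int i) * real y / real N)) +
      cos (2 * pi * (of_int (int j + int i) * real y / real N))))"
    by (rule sum.swap)
  also have "\<dots> = (\<Sum>j = 1..m. \<beta> j * ((if int N dvd int j - int i then real N else 0) + (if int N dvd int j + int i then real N else 0)))"
    unfolding sum_distrib_left[symmetric] sum.distrib sum_cos_residues[OF N0] ..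
  also have "\<dots> = (\<Sum>j = 1..m. if j = i then \<beta> i * (real N + (if int N dvd int i + int i then real N else 0)) else 0)"
  proof (rule sum.cong[OF refl])
    fix j assume j: "j \<in> {1..m}"
    show "\<beta> j * ((if int N dvd int j - int i then real N else 0) + (if int N dvd int j + int i then real N else 0)) =
      (if j = i then \<beta> i * (real N + (if int N dvd int i + int i then real N else 0)) else 0)"
    proof (cases "j = i")
      case False
      have b: "2 * j \<le> N" "2 * i \<le> N" "j > 0" "i > 0" using j i by (auto simp: m_def)
      have "\<not> int N dvd int j - int i"
      proof
        assume "int N dvd int j - int i"
        then have "int N \<le> \<bar>int j - int i\<bar>" using dvd_imp_le_int[of "int j - int i" "int N"] False by auto
        then show False using b by auto
      qed
      moreover have "\<not> int N dvd int j + int i"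
      proof
        assume "int N dvd int j + int i"
        then have "int N \<le> int j + int i" using b by (intro zdvd_imp_le) auto
        then show False using b False by auto
      qed
      ultimately show ?thesis using False by simp
    qed simp
  qed
  also have "\<dots> = \<beta> i * (real N + (if int N dvd int i + int i then real N else 0))"
    using i by (simp add: m_def)
  finally have "\<beta> i = 0" using N by (simp split: if_splits)
  then show ?thesis by (simp add: \<beta>_def)
qed

section \<open>The lattice of admissible exponents\<close>

lemma mult_mat_vec_index:
  assumes "A \<in> carrier_mat n k" "b \<in> carrier_vec k" "i < n"
  shows "(A *\<^sub>v b) $ i = (\<Sum>j<k. A $$ (i, j) * b $ j)"
  using assms by (auto simp: scalar_prod_def atLeast0LessThan intro!: sum.cong)

lemma mult_mat_smult_vec:
  fixes A :: "'a :: comm_ring mat"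
  assumes "A \<in> carrier_mat n k" "b \<in> carrier_vec k"
  shows "A *\<^sub>v (x \<cdot>\<^sub>v b) = x \<cdot>\<^sub>v (A *\<^sub>v b)"
proof (rule eq_vecI)
  fix i assume "i < dim_vec (x \<cdot>\<^sub>v (A *\<^sub>v b))"
  then have i: "i < n" using assms by simp
  have "(A *\<^sub>v (x \<cdot>\<^sub>v b)) $ i = (\<Sum>j<k. A $$ (i, j) * (x \<cdot>\<^sub>v b) $ j)"
    by (rule mult_mat_vec_index) (use assms i in auto)
  also have "\<dots> = x * (A *\<^sub>v b) $ i"
    unfolding mult_mat_vec_index[OF assms i] sum_distrib_left
    using assms by (intro sum.cong) (auto simp: mult_ac)
  finally show "(A *\<^sub>v (x \<cdot>\<^sub>v b)) $ i = (x \<cdot>\<^sub>v (A *\<^sub>v b)) $ i" using assms i by simp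
qed (use assms in auto)

definition weighted_sum :: "(nat \<Rightarrow> int) \<Rightarrow> int vec \<Rightarrow> int" where
  "weighted_sum f v = (\<Sum>i<dim_vec v. f i * v $ i)"

lemma weighted_sum_add:
  "u \<in> carrier_vec m \<Longrightarrow> v \<in> carrier_vec m \<Longrightarrow> weighted_sum f (u + v) = weighted_sum f u + weighted_sum f v"
  by (simp add: weighted_sum_def ring_distribs sum.distrib)

lemma weighted_sum_diff:
  "u \<in> carrier_vec m \<Longrightarrow> v \<in> carrier_vec m \<Longrightarrow> weighted_sum f (u - v) = weighted_sum f u - weighted_sum f v"
  by (simp add: weighted_sum_def ring_distribs sum_subtractf)

lemma weighted_sum_smult: "weighted_sum f (c \<cdot>\<^sub>v v) = c * weighted_sum f v"
  by (simp add: weighted_sum_def sum_distrib_left mult_ac)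

lemma weighted_sum_unit: "i < m \<Longrightarrow> weighted_sum f (unit_vec m i) = f i"
  by (simp add: weighted_sum_def if_distrib cong: if_cong)

text \<open>The two divisibility conditions in weight 0; the position i stands for j = i +
  1.\<close>

definition divisor_lattice :: "nat \<Rightarrow> int vec set" where
  "divisor_lattice N = {v \<in> carrier_vec (N div 2). 12 dvd weighted_sum (\<lambda>_. 1) v \<and>
     int N * gcd 2 (int N) dvd weighted_sum (\<lambda>i. (int i + 1)\<^sup>2) v}"

lemma mat_vec_in_divisor_lattice:
  assumes B: "B \<in> carrier_mat (N div 2) n" and cols: "\<And>j. j < n \<Longrightarrow> col B j \<in> divisor_lattice N"
    and b: "b \<in> carrier_vec n"
  shows "B *\<^sub>v b \<in> divisor_lattice N"
proof -
  have "weighted_sum f (B *\<^sub>v b) = (\<Sum>j<n. b $ j * weighted_sum f (col B j))" for f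
  proof -
    have "weighted_sum f (B *\<^sub>v b) = (\<Sum>i<N div 2. \<Sum>j<n. f i * (B $$ (i, j) * b $ j))"
      using B by (simp add: weighted_sum_def mult_mat_vec_index[OF B b] sum_distrib_left del: index_mult_mat_vec)
    also have "\<dots> = (\<Sum>j<n. \<Sum>i<N div 2. f i * (B $$ (i, j) * b $ j))" by (rule sum.swap)
    also have "\<dots> = (\<Sum>j<n. b $ j * weighted_sum f (col B j))"
      using B by (simp add: weighted_sum_def sum_distrib_left mult_ac)
    finally show ?thesis .
  qed
  then show ?thesis
    using cols mult_mat_vec_carrier[OF B b] by (auto simp: divisor_lattice_def intro!: dvd_sum)
qed

section \<open>The columns of B_N for N at least 6\<close>

context
  fixes N m :: nat and M r aN bN :: int
  assumes N: "N \<ge> 6"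
  defines "m \<equiv> N div 2" and "M \<equiv> int N * gcd 2 (int N)"
  defines "r \<equiv> (2 * M) mod 3"
  defines "aN \<equiv> (- M + 5 * r) div 3" and "bN \<equiv> (M - 8 * r) div 3"
begin

text \<open>As m \<ge> 3, the first multiple of 3 is always j_1 = 3 and gives \<open>B_col3\<close>.
  Every other j \<ge> 4 owns exactly one column \<open>B_colj j\<close>, so the columns can be
  indexed by j irrespective of their order in the matrix.\<close>

definition B_col1 :: "int vec" where "B_col1 = 16 \<cdot>\<^sub>v basis_vec N 1 - 4 \<cdot>\<^sub>v basis_vec N 2"
definition B_col2 :: "int vec" where "B_col2 = aN \<cdot>\<^sub>v basis_vec N 1 + bN \<cdot>\<^sub>v basis_vec N 2 + r \<cdot>\<^sub>v basis_vec N 3"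
definition B_col3 :: "int vec" where "B_col3 = ((int 3)\<^sup>2 - 4) \<cdot>\<^sub>v basis_vec N 1 - ((int 3)\<^sup>2 - 1) \<cdot>\<^sub>v basis_vec N 2 + 3 \<cdot>\<^sub>v basis_vec N 3"
definition B_colj :: "nat \<Rightarrow> int vec" where
  "B_colj j = (if \<not> 3 dvd j
     then (((int j)\<^sup>2 - 4) div 3) \<cdot>\<^sub>v basis_vec N 1 - (((int j)\<^sup>2 - 1) div 3) \<cdot>\<^sub>v basis_vec N 2 + basis_vec N j
     else (((int j)\<^sup>2 - (int 3)\<^sup>2) div 3) \<cdot>\<^sub>v (basis_vec N 1 - basis_vec N 2) - basis_vec N 3 + basis_vec N j)"

lemma B_cols_eq:
  "B_cols N = [B_col1, B_col2] @ map B_colj (filter (\<lambda>j. \<not> 3 dvd j) [4..<m + 1]) @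
     [B_col3] @ map B_colj (filter (\<lambda>j. 3 dvd j) [4..<m + 1])"
proof -
  have "m \<ge> 3" using N by (simp add: m_def)
  then have *: "[3..<m + 1] = 3 # [4..<m + 1]" by (simp add: upt_conv_Cons)
  show ?thesis
    unfolding B_cols_def Let_def m_def[symmetric] *
    unfolding M_def[symmetric] r_def[symmetric] aN_def[symmetric] bN_def[symmetric]
    by (simp add: B_col1_def B_col2_def B_col3_def B_colj_def)
qed

lemma length_B_cols: "length (B_cols N) = m"
proof -
  have "m \<ge> 3" using N by (simp add: m_def)
  then show ?thesis
    using sum_length_filter_compl[of "\<lambda>j. 3 dvd j" "[4..<m + 1]"]
    by (simp add: B_cols_eq del: upt_Suc)
qed

lemma set_B_cols: "set (B_cols N) = {B_col1, B_col2, B_col3} \<union> B_colj ` {4..m}"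
proof -
  have "B_colj ` {4..m} = B_colj ` {j \<in> {4..m}. \<not> 3 dvd j} \<union> B_colj ` {j \<in> {4..m}. 3 dvd j}"
    unfolding image_Un[symmetric] by (rule arg_cong[of _ _ "image B_colj"]) auto
  moreover have "set [4..<m + 1] = {4..m}" by auto
  ultimately show ?thesis unfolding B_cols_eq set_append set_map set_filter by auto
qed

lemma basis_vec_carrier [simp]: "basis_vec N j \<in> carrier_vec m"
  by (simp add: basis_vec_def m_def)

lemma B_col_carrier [simp]:
  "B_col1 \<in> carrier_vec m" "B_col2 \<in> carrier_vec m" "B_col3 \<in> carrier_vec m" "B_colj j \<in> carrier_vec m"
  by (auto simp: B_col1_def B_col2_def B_col3_def B_colj_def)

lemma weighted_sum_basis: "1 \<le> j \<Longrightarrow> j \<le> m \<Longrightarrow> weighted_sum f (basis_vec N j) = f (j - 1)"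
  unfolding basis_vec_def m_def[symmetric] by (rule weighted_sum_unit) simp

lemma three_dvd:
  "3 dvd - M + 5 * r" "3 dvd M - 8 * r"
  unfolding r_def by presburger+

lemma B_col1_sums:
  "weighted_sum (\<lambda>_. 1) B_col1 = 12" "weighted_sum (\<lambda>i. (int i + 1)\<^sup>2) B_col1 = 0"
proof -
  have m: "m \<ge> 3" using N by (simp add: m_def)
  have "weighted_sum f B_col1 = 16 * f 0 - 4 * f 1" for f
    using m unfolding B_col1_def
    by (simp add: weighted_sum_diff[where m = m] weighted_sum_smult weighted_sum_basis)
  then show "weighted_sum (\<lambda>_. 1) B_col1 = 12" "weighted_sum (\<lambda>i. (int i + 1)\<^sup>2) B_col1 = 0"
    by simp_all
qed

lemma B_col2_sums:
  "weighted_sum (\<lambda>_. 1) B_col2 = 0" "weighted_sum (\<lambda>i. (int i + 1)\<^sup>2) B_col2 = M"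
proof -
  have m: "m \<ge> 3" using N by (simp add: m_def)
  have 3: "3 * aN = - M + 5 * r" "3 * bN = M - 8 * r" using three_dvd by (simp_all add: aN_def bN_def)
  have "weighted_sum f B_col2 = aN * f 0 + bN * f 1 + r * f 2" for f
    using m unfolding B_col2_def
    by (simp add: weighted_sum_add[where m = m] weighted_sum_smult weighted_sum_basis)
  then show "weighted_sum (\<lambda>_. 1) B_col2 = 0" "weighted_sum (\<lambda>i. (int i + 1)\<^sup>2) B_col2 = M"
    using 3 by simp_all
qed

lemma B_col3_sums:
  "weighted_sum (\<lambda>_. 1) B_col3 = 0" "weighted_sum (\<lambda>i. (int i + 1)\<^sup>2) B_col3 = 0"
proof -
  have m: "m \<ge> 3" using N by (simp add: m_def)
  have "weighted_sum f B_col3 = 5 * f 0 - 8 * f 1 + 3 * f 2" for f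
    using m unfolding B_col3_def
    by (simp add: weighted_sum_add[where m = m] weighted_sum_diff[where m = m] weighted_sum_smult weighted_sum_basis)
  then show "weighted_sum (\<lambda>_. 1) B_col3 = 0" "weighted_sum (\<lambda>i. (int i + 1)\<^sup>2) B_col3 = 0"
    by simp_all
qed

lemma B_colj_sums:
  assumes j: "j \<in> {4..m}"
  shows "weighted_sum (\<lambda>_. 1) (B_colj j) = 0" "weighted_sum (\<lambda>i. (int i + 1)\<^sup>2) (B_colj j) = 0"
proof -
  have m: "m \<ge> 3" using N by (simp add: m_def)
  have "weighted_sum (\<lambda>_. 1) (B_colj j) = 0 \<and> weighted_sum (\<lambda>i. (int i + 1)\<^sup>2) (B_colj j) = 0"
  proof (cases "3 dvd j")
    case False
    define x where "x = ((int j)\<^sup>2 - 4) div 3"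
    define y where "y = ((int j)\<^sup>2 - 1) div 3"
    have "int j mod 3 = 1 \<or> int j mod 3 = 2" using False by presburger
    then have "(int j)\<^sup>2 mod 3 = 1" by (auto simp: power2_eq_square mod_mult_eq[of "int j" 3 "int j", symmetric])
    then have "3 dvd (int j)\<^sup>2 - 4" "3 dvd (int j)\<^sup>2 - 1" by presburger+
    then have 3: "3 * x = (int j)\<^sup>2 - 4" "3 * y = (int j)\<^sup>2 - 1" by (simp_all add: x_def y_def)
    have "weighted_sum f (B_colj j) = x * f 0 - y * f 1 + f (j - 1)" for f
      using m j False unfolding B_colj_def x_def[symmetric] y_def[symmetric]
      by (simp add: weighted_sum_add[where m = m] weighted_sum_diff[where m = m] weighted_sum_smult weighted_sum_basis)
    then show ?thesis using 3 j by (auto simp: of_nat_diff)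
  next
    case True
    define x where "x = ((int j)\<^sup>2 - (int 3)\<^sup>2) div 3"
    have "3 dvd (int j)\<^sup>2 - (int 3)\<^sup>2" using True by (auto simp: power2_eq_square elim!: dvdE)
    then have 3: "3 * x = (int j)\<^sup>2 - 9" by (simp add: x_def)
    have "weighted_sum f (B_colj j) = x * (f 0 - f 1) - f 2 + f (j - 1)" for f
      using m j True unfolding B_colj_def x_def[symmetric]
      by (simp add: weighted_sum_add[where m = m] weighted_sum_diff[where m = m] weighted_sum_smult weighted_sum_basis)
    then show ?thesis using 3 j by (auto simp: of_nat_diff)
  qed
  then show "weighted_sum (\<lambda>_. 1) (B_colj j) = 0" "weighted_sum (\<lambda>i. (int i + 1)\<^sup>2) (B_colj j) = 0"
    by blast+
qed

text \<open>In the rows from the fourth on these columns form an identity matrix. With them all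
  entries of a lattice vector but the first three can be cleared.\<close>

lemma B_colj_index:
  assumes "j \<in> {4..m}" "i < m" "i \<ge> 3"
  shows "B_colj j $ i = (if i = j - 1 then 1 else 0)"
proof -
  have 0: "basis_vec N l $ i = (if i = l - 1 then 1 else 0)" for l
    using assms by (simp add: basis_vec_def m_def[symmetric] unit_vec_def)
  have d: "dim_vec (basis_vec N l) = m" for l by (simp add: basis_vec_def m_def)
  have eq: "B_colj j $ i = (if \<not> 3 dvd j
      then ((int j)\<^sup>2 - 4) div 3 * basis_vec N 1 $ i - ((int j)\<^sup>2 - 1) div 3 * basis_vec N 2 $ i + basis_vec N j $ i
      else ((int j)\<^sup>2 - (int 3)\<^sup>2) div 3 * (basis_vec N 1 $ i - basis_vec N 2 $ i) - basis_vec N 3 $ i + basis_vec N j $ i)"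
    using assms by (simp add: B_colj_def d)
  show ?thesis unfolding eq 0 using assms by auto
qed

lemma B_mat_carrier: "B_mat N \<in> carrier_mat m m"
  using N length_B_cols by (simp add: B_mat_def m_def[symmetric] mat_of_cols_def)

lemma B_mat_cols: "j < m \<Longrightarrow> col (B_mat N) j \<in> set (B_cols N)"
proof -
  assume j: "j < m"
  have "B_cols N ! j \<in> set (B_cols N)" using j length_B_cols by simp
  moreover have "B_cols N ! j \<in> carrier_vec m"
    using \<open>B_cols N ! j \<in> set (B_cols N)\<close> unfolding set_B_cols by auto
  ultimately show ?thesis using j N length_B_cols by (simp add: B_mat_def m_def[symmetric])
qed

lemma B_mat_col_obtain:
  assumes "v \<in> set (B_cols N)"
  obtains b where "b \<in> carrier_vec m" "B_mat N *\<^sub>v b = v"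
proof -
  obtain j where j: "j < m" "v = B_cols N ! j" using assms length_B_cols by (metis in_set_conv_nth)
  have v: "v \<in> carrier_vec m" using assms unfolding set_B_cols by auto
  have "B_mat N *\<^sub>v unit_vec m j = v"
  proof (rule eq_vecI)
    fix i assume "i < dim_vec v"
    then have i: "i < m" using v by simp
    have "(B_mat N *\<^sub>v unit_vec m j) $ i = B_mat N $$ (i, j)"
      unfolding mult_mat_vec_index[OF B_mat_carrier unit_vec_carrier i]
      using j by (simp add: if_distrib cong: if_cong)
    also have "\<dots> = v $ i"
      using i j N length_B_cols by (simp add: B_mat_def m_def[symmetric] mat_of_cols_index)
    finally show "(B_mat N *\<^sub>v unit_vec m j) $ i = v $ i" .
  qed (use v B_mat_carrier in auto)
  then show ?thesis using that[of "unit_vec m j"] by simp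
qed

lemma B_mat_sum_obtain:
  assumes "finite S" "S \<subseteq> {4..m}"
  shows "\<exists>b\<in>carrier_vec m. B_mat N *\<^sub>v b = vec m (\<lambda>i. \<Sum>j\<in>S. x j * B_colj j $ i)"
  using assms
proof (induction S rule: finite_induct)
  case empty
  have "B_mat N *\<^sub>v 0\<^sub>v m = vec m (\<lambda>i. 0)"
    using B_mat_carrier by (intro eq_vecI) (auto simp: scalar_prod_def)
  then show ?case by (intro bexI[of _ "0\<^sub>v m"]) simp_all
next
  case (insert j S)
  then obtain b where b: "b \<in> carrier_vec m" "B_mat N *\<^sub>v b = vec m (\<lambda>i. \<Sum>j\<in>S. x j * B_colj j $ i)" by auto
  obtain b' where b': "b' \<in> carrier_vec m" "B_mat N *\<^sub>v b' = B_colj j"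
    using B_mat_col_obtain[of "B_colj j"] insert.prems set_B_cols by auto
  have "B_mat N *\<^sub>v (x j \<cdot>\<^sub>v b' + b) = x j \<cdot>\<^sub>v B_colj j + vec m (\<lambda>i. \<Sum>j\<in>S. x j * B_colj j $ i)"
    using b b' B_mat_carrier by (simp add: mult_add_distrib_mat_vec[OF B_mat_carrier] mult_mat_smult_vec[OF B_mat_carrier])
  also have "\<dots> = vec m (\<lambda>i. \<Sum>j\<in>insert j S. x j * B_colj j $ i)"
    using insert.hyps by (intro eq_vecI) (simp_all add: carrier_vecD[OF B_col_carrier(4)[of j]])
  finally show ?case using b b' by (intro bexI[of _ "x j \<cdot>\<^sub>v b' + b"]) simp_all
qed

text \<open>Once the entries from the fourth on are cleared, three unknowns remain. The total
  divided by 12 is the coefficient x of \<open>B_col1\<close>, the quadratic sum divided by M is the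
  coefficient y of \<open>B_col2\<close>, and the third entry then determines the coefficient z of
  \<open>B_col3\<close>, up to a divisibility by 3.\<close>

lemma divisor_lattice_range:
  assumes v: "v \<in> divisor_lattice N"
  shows "\<exists>b\<in>carrier_vec m. v = B_mat N *\<^sub>v b"
proof -
  have m: "m \<ge> 3" using N by (simp add: m_def)
  have vc: "v \<in> carrier_vec m" using v by (simp add: divisor_lattice_def m_def)
  obtain b0 where b0: "b0 \<in> carrier_vec m"
    "B_mat N *\<^sub>v b0 = vec m (\<lambda>i. \<Sum>j\<in>{4..m}. v $ (j - 1) * B_colj j $ i)"
    using B_mat_sum_obtain[of "{4..m}" "\<lambda>j. v $ (j - 1)"] by auto
  define w where "w = v - B_mat N *\<^sub>v b0"
  have wc: "w \<in> carrier_vec m" using vc b0 by (simp add: w_def)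
  have cols: "set (B_cols N) \<subseteq> divisor_lattice N"
    unfolding set_B_cols divisor_lattice_def m_def[symmetric] M_def[symmetric]
    using B_col1_sums B_col2_sums B_col3_sums B_colj_sums by auto
  have "B_mat N *\<^sub>v b0 \<in> divisor_lattice N"
    using B_mat_carrier B_mat_cols cols b0(1) by (intro mat_vec_in_divisor_lattice[where n = m]) (auto simp: m_def)
  then have w: "12 dvd weighted_sum (\<lambda>_. 1) w" "M dvd weighted_sum (\<lambda>i. (int i + 1)\<^sup>2) w"
    using v vc b0 by (auto simp: divisor_lattice_def w_def weighted_sum_diff[where m = m] m_def[symmetric] M_def[symmetric])
  have w0: "w $ i = 0" if "i < m" "i \<ge> 3" for i
  proof -
    have "(\<Sum>j\<in>{4..m}. v $ (j - 1) * B_colj j $ i) = (\<Sum>j\<in>{4..m}. if j = i + 1 then v $ i else 0)"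
      using that by (intro sum.cong refl) (auto simp: B_colj_index)
    also have "\<dots> = v $ i" using that by simp
    finally show ?thesis using that vc by (simp add: w_def b0(2))
  qed
  have ws: "weighted_sum f w = f 0 * w $ 0 + f 1 * w $ 1 + f 2 * w $ 2" for f
  proof -
    have "{..<m} = {0, 1, 2} \<union> {3..<m}" using m by auto
    then have "weighted_sum f w = (\<Sum>i\<in>{0, 1, 2}. f i * w $ i) + (\<Sum>i\<in>{3..<m}. f i * w $ i)"
      using wc by (simp add: weighted_sum_def sum.union_disjoint)
    also have "(\<Sum>i\<in>{3..<m}. f i * w $ i) = 0" by (intro sum.neutral) (auto simp: w0)
    finally show ?thesis by simp
  qed
  obtain x where x: "w $ 0 + w $ 1 + w $ 2 = 12 * x" using w(1) unfolding ws by auto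
  obtain y where y: "w $ 0 + 4 * w $ 1 + 9 * w $ 2 = M * y" using w(2) unfolding ws by auto
  \<comment> \<open>Subtracting the two sums gives 3 w_1 + 8 w_2 = M y - 12 x, so that w_2 = 2 M y =
    r y modulo 3. This is why r_N is the residue of 2M.\<close>
  have "3 dvd w $ 2 - y * r"
  proof -
    have "\<exists>z. r = 2 * M + 3 * z" unfolding r_def by presburger
    then obtain z where z: "r = 2 * M + 3 * z" by blast
    have "w $ 2 - y * r = w $ 2 - 2 * (M * y) - 3 * (z * y)" unfolding z by (simp add: algebra_simps)
    also have "\<dots> = w $ 2 - 2 * (12 * x + 3 * w $ 1 + 8 * w $ 2) - 3 * (z * y)"
      using x y by simp
    also have "\<dots> = 3 * (- 8 * x - 2 * w $ 1 - 5 * w $ 2 - z * y)" by simp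
    finally show ?thesis by (rule dvdI)
  qed
  then obtain z where z: "w $ 2 = y * r + 3 * z" by (metis dvdE add.commute diff_add_cancel)
  have 3: "3 * aN = - M + 5 * r" "3 * bN = M - 8 * r" using three_dvd by (simp_all add: aN_def bN_def)
  have e: "y * (3 * bN) = y * (M - 8 * r)" "y * (3 * aN) = y * (- M + 5 * r)" by (simp_all only: 3)
  have "3 * w $ 1 = M * y - 12 * x - 8 * (y * r + 3 * z)" using x y z by simp
  also have "\<dots> = 3 * (y * bN - 4 * x - 8 * z)" using e(1) by (simp add: algebra_simps)
  finally have w1: "w $ 1 = y * bN - 4 * x - 8 * z" by simp
  have "w $ 0 = 12 * x - w $ 1 - w $ 2" using x by simp
  then have "3 * w $ 0 = 3 * (16 * x + y * aN + 5 * z)" unfolding w1 z using e by (simp add: algebra_simps)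
  then have w0': "w $ 0 = 16 * x + y * aN + 5 * z" by simp
  obtain b1 where b1: "b1 \<in> carrier_vec m" "B_mat N *\<^sub>v b1 = B_col1" using B_mat_col_obtain[of B_col1] set_B_cols by auto
  obtain b2 where b2: "b2 \<in> carrier_vec m" "B_mat N *\<^sub>v b2 = B_col2" using B_mat_col_obtain[of B_col2] set_B_cols by auto
  obtain b3 where b3: "b3 \<in> carrier_vec m" "B_mat N *\<^sub>v b3 = B_col3" using B_mat_col_obtain[of B_col3] set_B_cols by auto
  have "w = x \<cdot>\<^sub>v B_col1 + y \<cdot>\<^sub>v B_col2 + z \<cdot>\<^sub>v B_col3"
  proof (rule eq_vecI)
    fix i assume "i < dim_vec (x \<cdot>\<^sub>v B_col1 + y \<cdot>\<^sub>v B_col2 + z \<cdot>\<^sub>v B_col3)"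
    then have i: "i < m" using B_col_carrier(3) by simp
    have u: "basis_vec N l $ i = (if i = l - 1 then 1 else 0)" for l
      using i by (simp add: basis_vec_def m_def[symmetric] unit_vec_def)
    have d: "dim_vec (basis_vec N l) = m" for l by (simp add: basis_vec_def m_def)
    have eq: "(x \<cdot>\<^sub>v B_col1 + y \<cdot>\<^sub>v B_col2 + z \<cdot>\<^sub>v B_col3) $ i =
       x * (16 * basis_vec N 1 $ i - 4 * basis_vec N 2 $ i) +
       y * (aN * basis_vec N 1 $ i + bN * basis_vec N 2 $ i + r * basis_vec N 3 $ i) +
       z * (5 * basis_vec N 1 $ i - 8 * basis_vec N 2 $ i + 3 * basis_vec N 3 $ i)"
      using i by (simp add: B_col1_def B_col2_def B_col3_def d)
    consider "i = 0" | "i = 1" | "i = 2" | "i \<ge> 3" by linarith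
    then show "w $ i = (x \<cdot>\<^sub>v B_col1 + y \<cdot>\<^sub>v B_col2 + z \<cdot>\<^sub>v B_col3) $ i"
      unfolding eq u by cases (use w0' w1 z w0[OF i] in simp_all)
  qed (simp add: carrier_vecD[OF wc] carrier_vecD[OF B_col_carrier(3)])
  also have "\<dots> = B_mat N *\<^sub>v (x \<cdot>\<^sub>v b1 + y \<cdot>\<^sub>v b2 + z \<cdot>\<^sub>v b3)"
    using b1 b2 b3
    by (simp add: mult_add_distrib_mat_vec[OF B_mat_carrier] mult_mat_smult_vec[OF B_mat_carrier] assoc_add_vec[of _ m])
  finally have "w = B_mat N *\<^sub>v (x \<cdot>\<^sub>v b1 + y \<cdot>\<^sub>v b2 + z \<cdot>\<^sub>v b3)" .
  moreover have "v = w + B_mat N *\<^sub>v b0" unfolding w_def b0(2) using vc by (intro eq_vecI) auto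
  moreover have c: "x \<cdot>\<^sub>v b1 + y \<cdot>\<^sub>v b2 + z \<cdot>\<^sub>v b3 \<in> carrier_vec m" using b1 b2 b3 by simp
  ultimately have "v = B_mat N *\<^sub>v (x \<cdot>\<^sub>v b1 + y \<cdot>\<^sub>v b2 + z \<cdot>\<^sub>v b3 + b0)"
    by (simp only: mult_add_distrib_mat_vec[OF B_mat_carrier c b0(1)])
  then show ?thesis using c b0(1) by (intro bexI[of _ "x \<cdot>\<^sub>v b1 + y \<cdot>\<^sub>v b2 + z \<cdot>\<^sub>v b3 + b0"]) simp_all
qed

lemma B_mat_range:
  assumes "b \<in> carrier_vec m"
  shows "B_mat N *\<^sub>v b \<in> divisor_lattice N"
proof (rule mat_vec_in_divisor_lattice)
  show "B_mat N \<in> carrier_mat (N div 2) m" using B_mat_carrier by (simp add: m_def)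
  have "set (B_cols N) \<subseteq> divisor_lattice N"
    unfolding set_B_cols divisor_lattice_def m_def[symmetric] M_def[symmetric]
    using B_col1_sums B_col2_sums B_col3_sums B_colj_sums by auto
  then show "col (B_mat N) j \<in> divisor_lattice N" if "j < m" for j using B_mat_cols[OF that] by blast
qed fact

end

lemma weighted_sum_2: "dim_vec v = 2 \<Longrightarrow> weighted_sum f v = f 0 * v $ 0 + f 1 * v $ 1"
  by (simp add: weighted_sum_def numeral_2_eq_2)

lemma B_mat_5: "B_mat 5 \<in> carrier_mat 2 2"
  by (simp add: B_mat_def mat_of_rows_list_def numeral_2_eq_2)

lemma B_mat_5_mult:
  assumes "b \<in> carrier_vec 2"
  shows "(B_mat 5 *\<^sub>v b) $ 0 = 16 * b $ 0 - 5 * b $ 1" "(B_mat 5 *\<^sub>v b) $ 1 = - 4 * b $ 0 + 5 * b $ 1"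
  using mult_mat_vec_index[OF B_mat_5 assms, of 0] mult_mat_vec_index[OF B_mat_5 assms, of 1]
  by (simp_all add: B_mat_def mat_of_rows_list_def numeral_2_eq_2)

lemma B_mat_carrier_mat:
  assumes "N \<ge> 5"
  shows "B_mat N \<in> carrier_mat (N div 2) (N div 2)"
  using assms B_mat_carrier[of N] B_mat_5 by (cases "N = 5") auto

lemma divisor_lattice_iff:
  assumes N: "N \<ge> 5" and v: "v \<in> carrier_vec (N div 2)"
  shows "v \<in> divisor_lattice N \<longleftrightarrow> (\<exists>b\<in>carrier_vec (N div 2). v = B_mat N *\<^sub>v b)"
proof (cases "N = 5")
  case False
  then have N6: "N \<ge> 6" using N by simp
  show ?thesis
  proof
    assume "v \<in> divisor_lattice N"
    then show "\<exists>b\<in>carrier_vec (N div 2). v = B_mat N *\<^sub>v b" by (rule divisor_lattice_range[OF N6])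
  next
    assume "\<exists>b\<in>carrier_vec (N div 2). v = B_mat N *\<^sub>v b"
    then obtain b where b: "b \<in> carrier_vec (N div 2)" "v = B_mat N *\<^sub>v b" by (rule bexE)
    show "v \<in> divisor_lattice N" unfolding b(2) by (rule B_mat_range[OF N6 b(1)])
  qed
next
  case True
  have v2: "dim_vec v = 2" "v \<in> carrier_vec 2" using v True by auto
  have "gcd 2 (5 :: int) = 1" by (simp add: coprime_iff_gcd_eq_1[symmetric])
  then have lat: "v \<in> divisor_lattice N \<longleftrightarrow> 12 dvd v $ 0 + v $ 1 \<and> 5 dvd v $ 0 + 4 * v $ 1"
    using v by (simp add: divisor_lattice_def True weighted_sum_2[OF v2(1)])
  show ?thesis
  proof
    assume "v \<in> divisor_lattice N"
    then obtain x y where x: "v $ 0 + v $ 1 = 12 * x" and y: "v $ 0 + 4 * v $ 1 = 5 * y"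
      unfolding lat by blast
    \<comment> \<open>With this z the entries are 16x - 5z and -4x + 5z, the combination of the
      columns of B_5.\<close>
    have "5 dvd v $ 1 + 4 * x" using x y by presburger
    then obtain z where z: "v $ 1 + 4 * x = 5 * z" by blast
    define b where "b = vec 2 (\<lambda>i. if i = 0 then x else z)"
    have b: "b \<in> carrier_vec 2" "b $ 0 = x" "b $ 1 = z" by (simp_all add: b_def)
    have "v = B_mat N *\<^sub>v b"
    proof (rule eq_vecI)
      fix i assume "i < dim_vec (B_mat N *\<^sub>v b)"
      then have "i = 0 \<or> i = 1" using B_mat_5 True by auto
      then show "v $ i = (B_mat N *\<^sub>v b) $ i"
        using B_mat_5_mult[OF b(1)] b x z True by auto
    qed (use v2 B_mat_5 True in auto)
    then show "\<exists>b\<in>carrier_vec (N div 2). v = B_mat N *\<^sub>v b" using b True by (intro bexI[of _ b]) auto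
  next
    assume "\<exists>b\<in>carrier_vec (N div 2). v = B_mat N *\<^sub>v b"
    then obtain b where "b \<in> carrier_vec 2" "v = B_mat 5 *\<^sub>v b" using True by auto
    then show "v \<in> divisor_lattice N" unfolding lat using B_mat_5_mult[of b] by auto
  qed
qed

section \<open>Orders at the cusps\<close>

text \<open>\<open>cusp_exp\<close> is 12 times the exponent of ep(\<tau>/N); for N \<ge> 5 a cusp
  with gcd(c, N) = g has width N/g on X_1(N), which accounts for the additional division by
  g.\<close>

definition cusp_order :: "nat \<Rightarrow> (nat \<Rightarrow> int) \<Rightarrow> (nat \<Rightarrow> int) \<Rightarrow> nat \<Rightarrow> int vec \<Rightarrow> nat \<Rightarrow> rat" where
  "cusp_order N a c k v r = of_int (cusp_exp N k v (int (cusp_g N c r)) (a r)) / (12 * of_nat (cusp_g N c r))"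

lemma cusp_g_int: "int (cusp_g N c r) = gcd (c r) (int N)"
  by (simp add: cusp_g_def)

lemma cusp_g_pos: "N > 0 \<Longrightarrow> cusp_g N c r > 0"
  by (simp add: cusp_g_def)

lemma cusp_g_dvd: "cusp_g N c r dvd N"
proof -
  have "int (cusp_g N c r) dvd int N" unfolding cusp_g_int by simp
  then show ?thesis by simp
qed

text \<open>The weight contributes k g/12, the origin of the vector g/12 in
  \<open>alpha_vec\<close>; the remaining part is linear in the exponents and given by A_N.\<close>

lemma cusp_order_weight:
  assumes "N > 0"
  shows "cusp_order N a c k v r = of_nat k * (of_nat (cusp_g N c r) / 12) + cusp_order N a c 0 v r"
proof -
  have "cusp_exp N k v g y = g\<^sup>2 * int k + cusp_exp N 0 v g y" for g y
    by (simp add: cusp_exp_def ring_distribs)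
  then show ?thesis
    using cusp_g_pos[OF assms, of c r] by (simp add: cusp_order_def field_simps power2_eq_square)
qed

lemma sum_1_eq_lessThan: "(\<Sum>j = 1..n. f (j - 1)) = (\<Sum>i<n. f i)" for f :: "nat \<Rightarrow> 'a :: comm_monoid_add"
  using sum.atLeast1_atMost_eq[of "\<lambda>j. f (j - 1)" n] by simp

lemma cusp_exp_0_eq:
  "cusp_exp N 0 v g y = (\<Sum>i<N div 2. (6 * quad g (int (i + 1) * y) + g\<^sup>2) * v $ i)"
proof -
  have "cusp_exp N 0 v g y = (\<Sum>j = 1..N div 2. (6 * quad g (int j * y) + g\<^sup>2) * v $ (j - 1))"
    by (simp add: cusp_exp_quad ring_distribs sum.distrib sum_distrib_left)
  also have "\<dots> = (\<Sum>j = 1..N div 2. (\<lambda>i. (6 * quad g (int (i + 1) * y) + g\<^sup>2) * v $ i) (j - 1))"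
    by (intro sum.cong refl) auto
  finally show ?thesis
    by (simp only: sum_1_eq_lessThan[of "\<lambda>i. (6 * quad g (int (i + 1) * y) + g\<^sup>2) * v $ i"])
qed

lemma bernoulli2_frac:
  assumes "g > 0"
  shows "of_nat g / 2 * bernoulli2 (frac (of_int y / of_nat g)) =
    of_int (6 * quad (int g) y + (int g)\<^sup>2) / (12 * of_nat g)"
proof -
  define t where "t = y mod int g"
  have "\<lfloor>of_int y / of_int (int g) :: rat\<rfloor> = y div int g" by (rule floor_divide_of_int_eq)
  then have "frac (of_int y / of_nat g :: rat) = of_int y / of_nat g - of_int (y div int g)"
    by (simp add: frac_def)
  also have "\<dots> = of_int (y - int g * (y div int g)) / of_nat g" using assms by (simp add: field_simps)
  also have "y - int g * (y div int g) = t" by (simp add: t_def minus_mult_div_eq_mod)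
  finally have *: "frac (of_int y / of_nat g :: rat) = of_int t / of_nat g" .
  show ?thesis
    unfolding bernoulli2_def * quad_def t_def[symmetric] using assms by (simp add: field_simps power2_eq_square)
qed

lemma A_mat_carrier: "A_mat N a c \<in> carrier_mat (N div 2) (N div 2)"
  by (simp add: A_mat_def)

lemma A_mat_mult:
  assumes N: "N > 0" and v: "v \<in> carrier_vec (N div 2)" and r: "r < N div 2"
  shows "(A_mat N a c *\<^sub>v map_vec of_int v) $ r = cusp_order N a c 0 v r"
proof -
  define g where "g = cusp_g N c r"
  have g: "g > 0" using cusp_g_pos[OF N] by (simp add: g_def)
  have "(A_mat N a c *\<^sub>v map_vec of_int v) $ r =
     (\<Sum>j<N div 2. A_mat N a c $$ (r, j) * map_vec of_int v $ j)"
    by (rule mult_mat_vec_index) (use A_mat_carrier v r in auto)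
  also have "\<dots> = (\<Sum>j<N div 2. of_int ((6 * quad (int g) (int (j + 1) * a r) + (int g)\<^sup>2) * v $ j) / (12 * of_nat g))"
  proof (rule sum.cong[OF refl])
    fix j assume j: "j \<in> {..<N div 2}"
    have "A_mat N a c $$ (r, j) = of_nat g / 2 * bernoulli2 (frac (of_int (int (j + 1) * a r) / of_nat g))"
      using j r by (simp add: A_mat_def Let_def g_def)
    then show "A_mat N a c $$ (r, j) * map_vec of_int v $ j =
        of_int ((6 * quad (int g) (int (j + 1) * a r) + (int g)\<^sup>2) * v $ j) / (12 * of_nat g)"
      unfolding bernoulli2_frac[OF g] using j v by simp
  qed
  also have "\<dots> = cusp_order N a c 0 v r"
    by (simp only: cusp_order_def cusp_exp_0_eq g_def sum_divide_distrib[symmetric] of_int_sum)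
  finally show ?thesis .
qed

lemma cusp_mu_pos:
  assumes "N > 0"
  shows "cusp_mu N c r > 0"
proof -
  have "cusp_g N c r \<le> N" using cusp_g_dvd[of N c r] assms by (rule dvd_imp_le)
  then have "N div cusp_g N c r > 0" using cusp_g_pos[OF assms, of c r] by (simp add: div_greater_zero_iff)
  then show ?thesis using assms by (auto simp: cusp_mu_def Let_def)
qed

lemma cusp_exp_scale: "cusp_exp N 0 v (h * g) (h * y) = h\<^sup>2 * cusp_exp N 0 v g y"
proof -
  have "quad (h * g) (int j * (h * y)) = h\<^sup>2 * quad g (int j * y)" for j
    using quad_scale[of h g "int j * y"] by (simp add: mult_ac)
  then show ?thesis
    unfolding cusp_exp_0_eq sum_distrib_left by (simp only: power_mult_distrib) (simp add: ring_distribs mult_ac)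
qed

text \<open>The weighted sum makes the order at the last cusp vanish as well, since its weight is
  positive. Then the orders vanish at every cusp with denominator dividing N, and hence
  \<open>cusp_exp\<close> of level N vanishes at every residue, as \<open>cusp_exp_kernel\<close>
  requires.\<close>

lemma cusp_order_kernel:
  assumes N: "N \<ge> 5" and ac: "cusp_orbit_reps N a c" and v: "v \<in> carrier_vec (N div 2)"
    and ker: "\<And>r. r < N div 2 \<Longrightarrow> cusp_order N a c 0 v r = 0"
  shows "v = 0\<^sub>v (N div 2)"
proof -
  define m where "m = N div 2"
  have N0: "N > 0" and N2: "N \<ge> 2" and N3: "N \<ge> 3" using N by auto
  have "(\<Sum>r\<le>m. cusp_mu N c r * cusp_order N a c 0 v r) = 0"
    using sum_mu_order[OF N2 ac, of 0 v] by (simp add: cusp_order_def m_def)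
  also have "(\<Sum>r\<le>m. cusp_mu N c r * cusp_order N a c 0 v r) = cusp_mu N c m * cusp_order N a c 0 v m"
    using ker by (simp add: m_def lessThan_Suc_atMost[symmetric])
  finally have "cusp_order N a c 0 v m = 0" using cusp_mu_pos[OF N0, of c m] by simp
  then have ord0: "cusp_order N a c 0 v r = 0" if "r \<le> m" for r
    using that ker by (cases "r = m") (auto simp: m_def)
  have zero: "cusp_exp N 0 v (int (cusp_g N c r)) (a r) = 0" if "r \<le> m" for r
    using ord0[OF that] cusp_g_pos[OF N0, of c r] by (simp add: cusp_order_def)
  have all: "cusp_exp N 0 v (int N) x = 0" for x
  proof -
    \<comment> \<open>x/N is reduced to p/z with z dividing N; the cusp p/z lies in the orbit of
      some representative.\<close>
    define h where "h = gcd x (int N)"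
    have h: "h > 0" using N by (simp add: h_def)
    obtain p where p: "x = h * p" using gcd_dvd1[of x "int N"] unfolding h_def by (rule dvdE)
    obtain z where z: "int N = h * z" using gcd_dvd2[of x "int N"] unfolding h_def by (rule dvdE)
    have "gcd (h * p) (h * z) = h" unfolding p[symmetric] z[symmetric] by (rule h_def[symmetric])
    then have cop: "coprime p z" using h gcd_mult_distrib_int[of h p z] by (simp add: coprime_iff_gcd_eq_1)
    obtain r e where r: "r \<le> m" "gcd (c r) (int N) = gcd z (int N)" "e \<in> {1, -1}" "gcd z (int N) dvd p - e * a r"
      using cusp_orbit_reps_surj[OF N2 ac cop] unfolding m_def .
    have "h * z > 0" using z N0 by simp
    then have "z > 0" using h by (rule zero_less_mult_pos)
    then have gz: "gcd z (int N) = z" using z by (simp add: gcd_proj1_iff)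
    have "cusp_exp N 0 v (int N) x = h\<^sup>2 * cusp_exp N 0 v z p" unfolding p z by (rule cusp_exp_scale)
    also have "cusp_exp N 0 v z p = cusp_exp N 0 v z (a r)"
      by (rule cusp_exp_sign_cong[OF r(3)]) (use r(4) gz in simp)
    also have "z = int (cusp_g N c r)" using r(2) gz by (simp add: cusp_g_int)
    finally show ?thesis using zero[OF r(1)] by simp
  qed
  show ?thesis
  proof (rule eq_vecI)
    fix i assume "i < dim_vec (0\<^sub>v (N div 2) :: int vec)"
    then show "v $ i = 0\<^sub>v (N div 2) $ i"
      using cusp_exp_kernel[OF N3 all, of "i + 1"] by simp
  qed (use v in simp)
qed

lemma cusp_order_add:
  assumes "u \<in> carrier_vec (N div 2)" "v \<in> carrier_vec (N div 2)"
  shows "cusp_order N a c 0 (u + v) r = cusp_order N a c 0 u r + cusp_order N a c 0 v r"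
proof -
  have "cusp_exp N 0 (u + v) g y = cusp_exp N 0 u g y + cusp_exp N 0 v g y" for g y
    using assms by (simp add: cusp_exp_0_eq ring_distribs sum.distrib)
  then show ?thesis by (simp add: cusp_order_def add_divide_distrib)
qed

lemma cusp_order_diff:
  assumes "u \<in> carrier_vec (N div 2)" "v \<in> carrier_vec (N div 2)"
  shows "cusp_order N a c 0 (u - v) r = cusp_order N a c 0 u r - cusp_order N a c 0 v r"
proof -
  have "cusp_exp N 0 (u - v) g y = cusp_exp N 0 u g y - cusp_exp N 0 v g y" for g y
    using assms by (simp add: cusp_exp_0_eq right_diff_distrib sum_subtractf)
  then show ?thesis by (simp add: cusp_order_def diff_divide_distrib)
qed

text \<open>Modulo a large prime the map is surjective, hence injective by counting.\<close>

lemma int_linear_map_injective: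
  fixes B :: "nat \<Rightarrow> nat \<Rightarrow> int"
  assumes K: "K \<noteq> 0"
    and X: "\<And>i l. i < m \<Longrightarrow> l < m \<Longrightarrow> (\<Sum>j<m. B i j * X l j) = (if i = l then K else 0)"
    and z: "\<And>i. i < m \<Longrightarrow> (\<Sum>j<m. B i j * z j) = 0" and j: "j < m"
  shows "z j = 0"
proof -
  \<comment> \<open>The prime exceeds |K|, so that K is invertible modulo it, and |z j|, so that
    vanishing modulo it gives z j = 0.\<close>
  obtain q :: nat where q: "prime q" "q > nat (\<bar>K\<bar> + \<bar>z j\<bar>)" using bigger_prime by blast
  define p where "p = int q"
  have p: "p > \<bar>K\<bar>" "p > \<bar>z j\<bar>" "prime p" using q by (auto simp: p_def)
  have "\<not> p dvd K" using p K by (auto dest!: dvd_imp_le_int)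
  then have "coprime K p" using prime_imp_coprime[OF p(3), of K] coprime_commute by blast
  then obtain L where L: "[K * L = 1] (mod p)" using cong_solve_coprime_int by blast
  define S where "S = {..<m} \<rightarrow>\<^sub>E {0..<p}"
  define f where "f = (\<lambda>v. \<lambda>i\<in>{..<m}. (\<Sum>j<m. B i j * v j) mod p)"
  have fin: "finite S" unfolding S_def by (intro finite_PiE) auto
  have red: "(\<Sum>j<m. B i j * (y j mod p)) mod p = (\<Sum>j<m. B i j * y j) mod p" for i y
  proof -
    have "[(\<Sum>j<m. B i j * (y j mod p)) = (\<Sum>j<m. B i j * y j)] (mod p)"
      by (rule cong_sum, rule cong_scalar_left) (simp add: cong_def)
    then show ?thesis by (simp only: cong_def)
  qed
  have p0: "p > 0" using p(1) by simp
  have rS: "(\<lambda>i\<in>{..<m}. g i mod p) \<in> S" for g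
    unfolding S_def restrict_PiE_iff using p0 by simp
  have "f ` S \<subseteq> S" by (rule image_subsetI) (simp only: f_def rS)
  moreover have "S \<subseteq> f ` S"
  proof
    fix w assume w: "w \<in> S"
    \<comment> \<open>L inverts K modulo p, so these coefficients combine the preimages X l of K
      times the unit vectors to a preimage of w.\<close>
    define y where "y = (\<lambda>j. \<Sum>l<m. w l * L * X l j)"
    define v where "v = (\<lambda>j\<in>{..<m}. y j mod p)"
    have "v \<in> S" by (simp only: v_def rS)
    moreover have "f v = w"
    proof
      fix i
      show "f v i = w i"
      proof (cases "i < m")
        case True
        have "(\<Sum>j<m. B i j * y j) = (\<Sum>j<m. \<Sum>l<m. w l * L * (B i j * X l j))"
          by (simp add: y_def sum_distrib_left mult_ac)
        also have "\<dots> = (\<Sum>l<m. \<Sum>j<m. w l * L * (B i j * X l j))" by (rule sum.swap)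
        also have "\<dots> = (\<Sum>l<m. w l * L * (if i = l then K else 0))"
          unfolding sum_distrib_left[symmetric] using X True by (intro sum.cong refl) simp
        also have "\<dots> = w i * (K * L)" using True by (simp add: if_distrib mult_ac cong: if_cong)
        finally have "[(\<Sum>j<m. B i j * y j) = w i] (mod p)" using cong_scalar_left[OF L, of "w i"] by simp
        moreover have "f v i = (\<Sum>j<m. B i j * (y j mod p)) mod p" using True by (simp add: f_def v_def)
        moreover have "w i mod p = w i" using PiE_mem[OF w[unfolded S_def], of i] True by simp
        ultimately show ?thesis unfolding red by (simp add: cong_def)
      next
        case False
        then show ?thesis using PiE_arb[OF w[unfolded S_def], of i] by (simp add: f_def)
      qed
    qed
    ultimately show "w \<in> f ` S" by blast
  qed
  ultimately have inj: "inj_on f S" using fin by (intro eq_card_imp_inj_on) auto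
  define v where "v = (\<lambda>j\<in>{..<m}. z j mod p)"
  define u where "u = (\<lambda>j\<in>{..<m}. 0 :: int)"
  have uv: "u \<in> S" "v \<in> S" using rS[of "\<lambda>_. 0"] rS[of z] by (simp_all only: u_def v_def mod_0)
  have "f v i = f u i" for i
    using red[of i z] z[of i] by (cases "i < m") (auto simp: f_def u_def v_def)
  then have "f v = f u" by (rule ext)
  then have "v = u" by (rule inj_onD[OF inj _ uv(2) uv(1)])
  then have "v j = u j" by (rule fun_cong)
  then have "z j mod p = 0" using j by (simp add: u_def v_def)
  then have "p dvd z j" by (simp add: mod_eq_0_iff_dvd)
  then show ?thesis using p(2) dvd_imp_le_int[of "z j" p] by linarith
qed

text \<open>K times any unit vector satisfies both divisibility conditions and so lies in the range
  of B_N. This gives B_N a right inverse up to the factor K.\<close>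

lemma B_mat_injective:
  assumes N: "N \<ge> 5" and z: "z \<in> carrier_vec (N div 2)" and Bz: "B_mat N *\<^sub>v z = 0\<^sub>v (N div 2)"
  shows "z = 0\<^sub>v (N div 2)"
proof -
  define m where "m = N div 2"
  define K where "K = 12 * (int N * gcd 2 (int N))"
  have K: "K \<noteq> 0" using N by (simp add: K_def)
  have B: "B_mat N \<in> carrier_mat m m" using B_mat_carrier_mat[OF N] by (simp add: m_def)
  have "\<exists>b\<in>carrier_vec m. K \<cdot>\<^sub>v unit_vec m i = B_mat N *\<^sub>v b" if "i < m" for i
  proof -
    have "K \<cdot>\<^sub>v unit_vec m i \<in> divisor_lattice N"
      using that by (simp add: divisor_lattice_def m_def[symmetric] weighted_sum_smult K_def)
    then show ?thesis using divisor_lattice_iff[OF N, of "K \<cdot>\<^sub>v unit_vec m i"] by (simp add: m_def)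
  qed
  then obtain X where X: "\<And>i. i < m \<Longrightarrow> X i \<in> carrier_vec m" "\<And>i. i < m \<Longrightarrow> K \<cdot>\<^sub>v unit_vec m i = B_mat N *\<^sub>v X i"
    by metis
  have "z $ j = 0" if "j < m" for j
  proof (rule int_linear_map_injective[OF K _ _ that])
    show "(\<Sum>j<m. B_mat N $$ (i, j) * X l $ j) = (if i = l then K else 0)" if "i < m" "l < m" for i l
      unfolding mult_mat_vec_index[OF B X(1)[OF that(2)] that(1), symmetric] X(2)[OF that(2), symmetric]
      using that by simp
    show "(\<Sum>j<m. B_mat N $$ (i, j) * z $ j) = 0" if "i < m" for i
      using mult_mat_vec_index[OF B _ that, of z] z Bz that by (simp add: m_def)
  qed
  then show ?thesis using z by (intro eq_vecI) (auto simp: m_def)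
qed

lemma weighted_sum_eq:
  assumes "v \<in> carrier_vec (N div 2)"
  shows "(\<Sum>j = 1..N div 2. v $ (j - 1)) = weighted_sum (\<lambda>_. 1) v"
    "(\<Sum>j = 1..N div 2. (int j)\<^sup>2 * v $ (j - 1)) = weighted_sum (\<lambda>i. (int i + 1)\<^sup>2) v"
proof -
  show "(\<Sum>j = 1..N div 2. v $ (j - 1)) = weighted_sum (\<lambda>_. 1) v"
    using assms by (subst sum_1_eq_lessThan) (simp add: weighted_sum_def)
  have "(\<Sum>j = 1..N div 2. (int j)\<^sup>2 * v $ (j - 1)) = (\<Sum>j = 1..N div 2. (\<lambda>i. (int i + 1)\<^sup>2 * v $ i) (j - 1))"
    by (intro sum.cong refl) (auto simp: of_nat_diff)
  also have "\<dots> = weighted_sum (\<lambda>i. (int i + 1)\<^sup>2) v"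
    using assms by (subst sum_1_eq_lessThan) (simp add: weighted_sum_def)
  finally show "(\<Sum>j = 1..N div 2. (int j)\<^sup>2 * v $ (j - 1)) = weighted_sum (\<lambda>i. (int i + 1)\<^sup>2) v" .
qed

lemma a1_vec_carrier: "N \<ge> 5 \<Longrightarrow> a1_vec N \<in> carrier_vec (N div 2)"
  by (cases "N = 5") (simp_all add: a1_vec_def basis_vec_def carrier_vecI)

text \<open>\<open>a1_vec\<close> is a particular solution in weight 1. Its quadratic sum is 5 for N
  = 5 and 0 otherwise.\<close>

lemma a1_vec_sums:
  assumes N: "N \<ge> 5"
  shows "weighted_sum (\<lambda>_. 1) (a1_vec N) = - 1"
    "int N * gcd 2 (int N) dvd weighted_sum (\<lambda>i. (int i + 1)\<^sup>2) (a1_vec N)"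
proof -
  have "weighted_sum (\<lambda>_. 1) (a1_vec N) = - 1 \<and>
    int N * gcd 2 (int N) dvd weighted_sum (\<lambda>i. (int i + 1)\<^sup>2) (a1_vec N)"
  proof (cases "N = 5")
    case True
    have "gcd 2 (5 :: int) = 1" by (simp add: coprime_iff_gcd_eq_1[symmetric])
    then show ?thesis by (simp add: True a1_vec_def weighted_sum_2 vec_of_list_index)
  next
    case False
    then have m: "N div 2 \<ge> 3" using N by simp
    have "weighted_sum f (a1_vec N) = - 3 * f 0 + 3 * f 1 - f 2" for f
      using m False unfolding a1_vec_def basis_vec_def
      by (simp add: weighted_sum_add[where m = "N div 2"] weighted_sum_diff[where m = "N div 2"] weighted_sum_smult weighted_sum_unit)
    then show ?thesis by simp
  qed
  then show "weighted_sum (\<lambda>_. 1) (a1_vec N) = - 1"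
    "int N * gcd 2 (int N) dvd weighted_sum (\<lambda>i. (int i + 1)\<^sup>2) (a1_vec N)" by blast+
qed

lemma modular_coset_iff:
  assumes N: "N \<ge> 5" and v: "v \<in> carrier_vec (N div 2)"
  shows "12 dvd int k + (\<Sum>j = 1..N div 2. v $ (j - 1)) \<and>
      int N * gcd 2 (int N) dvd (\<Sum>j = 1..N div 2. (int j)\<^sup>2 * v $ (j - 1)) \<longleftrightarrow>
    (\<exists>b\<in>carrier_vec (N div 2). v = int k \<cdot>\<^sub>v a1_vec N + B_mat N *\<^sub>v b)"
proof -
  define m where "m = N div 2"
  have vc: "v \<in> carrier_vec m" and a1: "a1_vec N \<in> carrier_vec m" and B: "B_mat N \<in> carrier_mat m m"
    using v a1_vec_carrier[OF N] B_mat_carrier_mat[OF N] by (auto simp: m_def)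
  define u where "u = v - int k \<cdot>\<^sub>v a1_vec N"
  have u: "u \<in> carrier_vec m" using vc a1 by (simp add: u_def)
  obtain z where z: "weighted_sum (\<lambda>i. (int i + 1)\<^sup>2) (a1_vec N) = int N * gcd 2 (int N) * z"
    using a1_vec_sums(2)[OF N] by blast
  have "weighted_sum (\<lambda>_. 1) u = int k + weighted_sum (\<lambda>_. 1) v"
    "weighted_sum (\<lambda>i. (int i + 1)\<^sup>2) u = weighted_sum (\<lambda>i. (int i + 1)\<^sup>2) v - int N * gcd 2 (int N) * (int k * z)"
    using vc a1 a1_vec_sums(1)[OF N] z
    by (simp_all add: u_def weighted_sum_diff[where m = m] weighted_sum_smult mult_ac)
  then have A: "u \<in> divisor_lattice N \<longleftrightarrow> 12 dvd int k + (\<Sum>j = 1..N div 2. v $ (j - 1)) \<and>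
      int N * gcd 2 (int N) dvd (\<Sum>j = 1..N div 2. (int j)\<^sup>2 * v $ (j - 1))"
    unfolding weighted_sum_eq[OF v] using u by (simp add: divisor_lattice_def m_def[symmetric] dvd_diff_left_iff)
  have B': "u \<in> divisor_lattice N \<longleftrightarrow> (\<exists>b\<in>carrier_vec m. u = B_mat N *\<^sub>v b)"
    using divisor_lattice_iff[OF N, of u] u by (simp add: m_def)
  have C: "u = B_mat N *\<^sub>v b \<longleftrightarrow> v = int k \<cdot>\<^sub>v a1_vec N + B_mat N *\<^sub>v b" if "b \<in> carrier_vec m" for b
  proof
    assume "u = B_mat N *\<^sub>v b"
    then show "v = int k \<cdot>\<^sub>v a1_vec N + B_mat N *\<^sub>v b"
      unfolding \<open>u = B_mat N *\<^sub>v b\<close>[symmetric] u_def using vc a1 by (intro eq_vecI) auto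
  next
    assume "v = int k \<cdot>\<^sub>v a1_vec N + B_mat N *\<^sub>v b"
    then show "u = B_mat N *\<^sub>v b" unfolding u_def using a1 B that by (intro eq_vecI) auto
  qed
  have D: "(\<exists>b\<in>carrier_vec m. u = B_mat N *\<^sub>v b) \<longleftrightarrow>
      (\<exists>b\<in>carrier_vec m. v = int k \<cdot>\<^sub>v a1_vec N + B_mat N *\<^sub>v b)"
    by (rule bex_cong[OF refl]) (rule C)
  show ?thesis using trans[OF A[symmetric] trans[OF B' D]] unfolding m_def .
qed

text \<open>\<open>cusp_exp\<close> depends only on g and on the numerator modulo g up to sign, so
  nonnegativity at all cusps can be tested at the m + 1 representatives.\<close>

lemma L_set_iff:
  assumes N: "N \<ge> 5" and ac: "cusp_orbit_reps N a c"
  shows "v \<in> L_set N k \<longleftrightarrow> v \<in> carrier_vec (N div 2) \<and>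
    (\<exists>b\<in>carrier_vec (N div 2). v = int k \<cdot>\<^sub>v a1_vec N + B_mat N *\<^sub>v b) \<and>
    (\<forall>r\<le>N div 2. cusp_order N a c k v r \<ge> 0)"
proof (cases "v \<in> carrier_vec (N div 2)")
  case True
  have N2: "N \<ge> 2" and N0: "N > 0" using N by auto
  have "(\<forall>p z. coprime p z \<longrightarrow> cusp_exp N k v (gcd z (int N)) p \<ge> 0) \<longleftrightarrow>
    (\<forall>r\<le>N div 2. cusp_order N a c k v r \<ge> 0)"
  proof
    assume *: "\<forall>p z. coprime p z \<longrightarrow> cusp_exp N k v (gcd z (int N)) p \<ge> 0"
    show "\<forall>r\<le>N div 2. cusp_order N a c k v r \<ge> 0"
    proof (intro allI impI)
      fix r assume "r \<le> N div 2"
      then have "cusp_exp N k v (int (cusp_g N c r)) (a r) \<ge> 0"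
        unfolding cusp_g_int using * cusp_orbit_reps_coprime[OF ac] by blast
      then show "cusp_order N a c k v r \<ge> 0" by (simp add: cusp_order_def)
    qed
  next
    assume *: "\<forall>r\<le>N div 2. cusp_order N a c k v r \<ge> 0"
    show "\<forall>p z. coprime p z \<longrightarrow> cusp_exp N k v (gcd z (int N)) p \<ge> 0"
    proof (intro allI impI)
      fix p z :: int assume cop: "coprime p z"
      obtain r e where r: "r \<le> N div 2" "gcd (c r) (int N) = gcd z (int N)" "e \<in> {1, -1}" "gcd z (int N) dvd p - e * a r"
        using cusp_orbit_reps_surj[OF N2 ac cop] .
      have g: "gcd z (int N) = int (cusp_g N c r)" by (simp add: cusp_g_int r(2))
      have "cusp_exp N k v (int (cusp_g N c r)) (a r) \<ge> 0"
        using * r(1) cusp_g_pos[OF N0, of c r] by (auto simp: cusp_order_def zero_le_divide_iff)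
      then show "cusp_exp N k v (gcd z (int N)) p \<ge> 0"
        using cusp_exp_sign_cong[OF r(3,4)] g by simp
    qed
  qed
  then show ?thesis
    by (simp only: L_set_def mem_Collect_eq True simp_thms product_form_modular_iff[OF N2]
        modular_coset_iff[OF N True, symmetric] conj_assoc)
qed (simp add: L_set_def)

lemma cusp_order_integral:
  assumes N: "N \<ge> 5" and v: "v \<in> carrier_vec (N div 2)"
    and b: "b \<in> carrier_vec (N div 2)" "v = int k \<cdot>\<^sub>v a1_vec N + B_mat N *\<^sub>v b"
  shows "cusp_order N a c k v r \<in> \<int>"
proof -
  have N0: "N > 0" using N by simp
  have "12 * int (cusp_g N c r) dvd cusp_exp N k v (int (cusp_g N c r)) (a r)"
  proof (rule cusp_exp_dvd)
    show "int (cusp_g N c r) dvd int N" using cusp_g_dvd by simp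
  qed (use modular_coset_iff[OF N v, of k] b cusp_g_pos[OF N0] in auto)
  then obtain z where "cusp_exp N k v (int (cusp_g N c r)) (a r) = 12 * int (cusp_g N c r) * z" by blast
  then have "cusp_order N a c k v r = of_int z" using cusp_g_pos[OF N0, of c r] by (simp add: cusp_order_def)
  then show ?thesis by simp
qed

section \<open>Counting\<close>

lemma invertible_mat_obtain:
  fixes A :: "int mat"
  assumes "invertible_mat A" "A \<in> carrier_mat m m"
  obtains B where "B \<in> carrier_mat m m" "A * B = 1\<^sub>m m" "B * A = 1\<^sub>m m"
proof -
  obtain B where B: "A * B = 1\<^sub>m m" "B * A = 1\<^sub>m (dim_row B)"
    using assms by (auto simp: invertible_mat_def inverts_mat_def)
  have "dim_col B = m" using arg_cong[OF B(1), of dim_col] by simp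
  moreover have "dim_row B = m" using arg_cong[OF B(2), of dim_col] assms(2) by simp
  ultimately show ?thesis using that[of B] B by (metis carrier_matI)
qed

text \<open>Formulated with sums because an integer matrix acts here on numbers that are a priori
  only rational, the orders at the cusps.\<close>

lemma int_mat_kernel:
  fixes P P' :: "int mat" and x :: "nat \<Rightarrow> rat"
  assumes P: "P \<in> carrier_mat m m" "P' \<in> carrier_mat m m" "P' * P = 1\<^sub>m m"
    and x: "\<And>i. i < m \<Longrightarrow> (\<Sum>r<m. of_int (P $$ (i, r)) * x r) = 0" and r: "r < m"
  shows "x r = 0"
proof -
  have "(\<Sum>i<m. of_int (P' $$ (r, i)) * (\<Sum>l<m. of_int (P $$ (i, l)) * x l)) = 0"
    using x by (simp del: mult_eq_0_iff)
  also have "(\<Sum>i<m. of_int (P' $$ (r, i)) * (\<Sum>l<m. of_int (P $$ (i, l)) * x l)) =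
      (\<Sum>i<m. \<Sum>l<m. of_int (P' $$ (r, i) * P $$ (i, l)) * x l)"
    by (simp add: sum_distrib_left mult_ac)
  also have "\<dots> = (\<Sum>l<m. \<Sum>i<m. of_int (P' $$ (r, i) * P $$ (i, l)) * x l)" by (rule sum.swap)
  also have "\<dots> = (\<Sum>l<m. of_int ((P' * P) $$ (r, l)) * x l)"
  proof (rule sum.cong[OF refl])
    fix l assume "l \<in> {..<m}"
    then have "(P' * P) $$ (r, l) = (\<Sum>i<m. P' $$ (r, i) * P $$ (i, l))"
      using P(1,2) r by (simp add: scalar_prod_def atLeast0LessThan)
    then show "(\<Sum>i<m. of_int (P' $$ (r, i) * P $$ (i, l)) * x l) = of_int ((P' * P) $$ (r, l)) * x l"
      by (simp add: sum_distrib_right)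
  qed
  also have "\<dots> = (\<Sum>l<m. if l = r then x l else 0)"
    using r by (intro sum.cong) (auto simp: P(3))
  also have "\<dots> = x r" using r by simp
  finally show ?thesis by simp
qed

context
  fixes N m :: nat and a c :: "nat \<Rightarrow> int" and P Q :: "int mat" and d :: "nat \<Rightarrow> nat"
  assumes N: "N \<ge> 5" and m: "m = N div 2" and ac: "cusp_orbit_reps N a c"
    and snf: "smith_normal_form m (class_mat N a c) P Q d"
begin

lemma P_carrier: "P \<in> carrier_mat m m" and Q_carrier: "Q \<in> carrier_mat m m"
  and P_inv: "invertible_mat P" and Q_inv: "invertible_mat Q"
  and PVQ: "map_mat of_int P * class_mat N a c * map_mat of_int Q =
    mat m m (\<lambda>(i, j). if i = j then of_nat (d i) else 0)"
  using snf by (simp_all add: smith_normal_form_def)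

definition lattice_point :: "nat \<Rightarrow> int vec \<Rightarrow> int vec" where
  "lattice_point k y = int k \<cdot>\<^sub>v a1_vec N + B_mat N *\<^sub>v (Q *\<^sub>v y)"

lemma lattice_point_carrier: "y \<in> carrier_vec m \<Longrightarrow> lattice_point k y \<in> carrier_vec m"
  using B_mat_carrier_mat[OF N] a1_vec_carrier[OF N] Q_carrier
  by (auto simp: lattice_point_def m intro!: add_carrier_vec mult_mat_vec_carrier)

text \<open>In the coordinates \<open>y\<close> of the Smith normal form the orders become \<open>d\<^sub>iy\<^sub>i\<close>, up to a shift.\<close>

lemma order_transform:
  assumes y: "y \<in> carrier_vec m" and i: "i < m"
  shows "(\<Sum>r<m. of_int (P $$ (i, r)) * cusp_order N a c k (lattice_point k y) r) =
    - of_nat k * alpha_vec N a c P $ i + of_nat (d i) * of_int (y $ i)"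
proof -
  define hP :: "rat mat" where "hP = map_mat of_int P"
  define hQ :: "rat mat" where "hQ = map_mat of_int Q"
  define hB :: "rat mat" where "hB = map_mat of_int (B_mat N)"
  define A where "A = A_mat N a c"
  define V where "V = A * hB"
  define hy :: "rat vec" where "hy = map_vec of_int y"
  define a1 where "a1 = a1_vec N"
  \<comment> \<open>The orders of \<open>lattice_point k y\<close> are k w + V(Q y), and -P w is the
    vector \<open>alpha_vec\<close>.\<close>
  define w where "w = (1 / 12) \<cdot>\<^sub>v vec m (\<lambda>r. of_nat (cusp_g N c r)) + A *\<^sub>v map_vec of_int a1"
  define b where "b = Q *\<^sub>v y"
  have N0: "N > 0" using N by simp
  have B: "B_mat N \<in> carrier_mat m m" using B_mat_carrier_mat[OF N] m by simp
  have A: "A \<in> carrier_mat m m" using A_mat_carrier by (simp add: A_def m)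
  have a1: "a1 \<in> carrier_vec m" using a1_vec_carrier[OF N] by (simp add: a1_def m)
  have b: "b \<in> carrier_vec m" using Q_carrier y by (simp add: b_def)
  have hP: "hP \<in> carrier_mat m m" and hQ: "hQ \<in> carrier_mat m m" and hB: "hB \<in> carrier_mat m m"
    and hy: "hy \<in> carrier_vec m" and V: "V \<in> carrier_mat m m" and w: "w \<in> carrier_vec m"
    using P_carrier Q_carrier B y A a1 by (auto simp: hP_def hQ_def hB_def hy_def V_def w_def intro!: add_carrier_vec mult_mat_vec_carrier)
  have Vhb: "A *\<^sub>v map_vec of_int (B_mat N *\<^sub>v b) = V *\<^sub>v (hQ *\<^sub>v hy)"
  proof -
    have "map_vec rat_of_int (B_mat N *\<^sub>v b) = hB *\<^sub>v (hQ *\<^sub>v hy)"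
      unfolding hB_def hQ_def hy_def b_def
      using of_int_hom.mult_mat_vec_hom[OF B] of_int_hom.mult_mat_vec_hom[OF Q_carrier y] Q_carrier y
      by (metis mult_mat_vec_carrier)
    then show ?thesis unfolding V_def using assoc_mult_mat_vec[OF A hB, of "hQ *\<^sub>v hy"] hQ hy by simp
  qed
  define o' where "o' = of_nat k \<cdot>\<^sub>v w + V *\<^sub>v (hQ *\<^sub>v hy)"
  have o_eq: "cusp_order N a c k (lattice_point k y) r = o' $ r" if r: "r < m" for r
  proof -
    have c1: "int k \<cdot>\<^sub>v a1 \<in> carrier_vec (N div 2)" "B_mat N *\<^sub>v b \<in> carrier_vec (N div 2)"
      using a1 B b by (auto simp: m)
    have r': "r < N div 2" using r m by simp
    have "cusp_order N a c k (lattice_point k y) r = of_nat k * (of_nat (cusp_g N c r) / 12) +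
      (cusp_order N a c 0 (int k \<cdot>\<^sub>v a1) r + cusp_order N a c 0 (B_mat N *\<^sub>v b) r)"
      unfolding cusp_order_weight[OF N0, of a c k] lattice_point_def a1_def[symmetric] b_def[symmetric]
      by (simp only: cusp_order_add[OF c1])
    also have "cusp_order N a c 0 (int k \<cdot>\<^sub>v a1) r = (A *\<^sub>v map_vec of_int (int k \<cdot>\<^sub>v a1)) $ r"
      unfolding A_def by (rule A_mat_mult[OF N0 c1(1) r', symmetric])
    also have "map_vec rat_of_int (int k \<cdot>\<^sub>v a1) = of_nat k \<cdot>\<^sub>v map_vec of_int a1"
      by (intro eq_vecI) auto
    also have "A *\<^sub>v (of_nat k \<cdot>\<^sub>v map_vec of_int a1) = of_nat k \<cdot>\<^sub>v (A *\<^sub>v map_vec of_int a1)"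
      by (rule mult_mat_smult_vec[OF A]) (use a1 in simp)
    also have "cusp_order N a c 0 (B_mat N *\<^sub>v b) r = (A *\<^sub>v map_vec of_int (B_mat N *\<^sub>v b)) $ r"
      unfolding A_def by (rule A_mat_mult[OF N0 c1(2) r', symmetric])
    also have "of_nat k * (of_nat (cusp_g N c r) / 12) +
       ((of_nat k \<cdot>\<^sub>v (A *\<^sub>v map_vec of_int a1)) $ r + (A *\<^sub>v map_vec of_int (B_mat N *\<^sub>v b)) $ r) = o' $ r"
      unfolding Vhb o'_def w_def using r A V by (simp add: ring_distribs)
    finally show ?thesis .
  qed
  have o': "o' \<in> carrier_vec m"
    unfolding o'_def using w V hQ hy by (intro add_carrier_vec smult_carrier_vec mult_mat_vec_carrier) auto
  have "(\<Sum>r<m. of_int (P $$ (i, r)) * cusp_order N a c k (lattice_point k y) r) = (\<Sum>r<m. hP $$ (i, r) * o' $ r)"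
    using P_carrier i by (intro sum.cong) (auto simp: o_eq hP_def)
  also have "\<dots> = (hP *\<^sub>v o') $ i" by (rule mult_mat_vec_index[OF hP o' i, symmetric])
  also have "hP *\<^sub>v o' = of_nat k \<cdot>\<^sub>v (hP *\<^sub>v w) + hP *\<^sub>v (V *\<^sub>v (hQ *\<^sub>v hy))"
    unfolding o'_def using w V hQ hy
    by (simp add: mult_add_distrib_mat_vec[OF hP] mult_mat_smult_vec[OF hP])
  also have "hP *\<^sub>v (V *\<^sub>v (hQ *\<^sub>v hy)) = (hP * V * hQ) *\<^sub>v hy"
    using assoc_mult_mat_vec[OF hP V, of "hQ *\<^sub>v hy"] assoc_mult_mat_vec[OF mult_carrier_mat[OF hP V] hQ hy] hQ hy
    by simp
  also have "hP * V * hQ = mat m m (\<lambda>(i, j). if i = j then of_nat (d i) else 0)"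
    using PVQ by (simp add: hP_def V_def A_def hB_def hQ_def class_mat_def)
  also have "(of_nat k \<cdot>\<^sub>v (hP *\<^sub>v w) + mat m m (\<lambda>(i, j). if i = j then of_nat (d i) else 0) *\<^sub>v hy) $ i =
      of_nat k * (hP *\<^sub>v w) $ i + (\<Sum>j<m. (if i = j then of_nat (d i) else 0) * hy $ j)"
    using i hP w hy mult_mat_vec_index[OF mat_carrier hy i, of "\<lambda>(i, j). if i = j then of_nat (d i) else 0"]
    by (simp del: index_mult_mat_vec)
  also have "(\<Sum>j<m. (if i = j then of_nat (d i) else 0) * hy $ j) = of_nat (d i) * of_int (y $ i)"
    using i y by (simp add: hy_def if_distrib if_distribR cong: if_cong)
  also have "(hP *\<^sub>v w) $ i = - alpha_vec N a c P $ i"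
    using i hP unfolding alpha_vec_def m[symmetric] hP_def[symmetric] A_def[symmetric] a1_def[symmetric] w_def[symmetric]
    by simp
  finally show ?thesis by simp
qed

lemma lattice_point_order_integral:
  assumes "y \<in> carrier_vec m"
  shows "cusp_order N a c k (lattice_point k y) r \<in> \<int>"
proof (rule cusp_order_integral[OF N])
  show "lattice_point k y \<in> carrier_vec (N div 2)" using lattice_point_carrier[OF assms] m by simp
  show "Q *\<^sub>v y \<in> carrier_vec (N div 2)" using Q_carrier assms m by simp
qed (simp add: lattice_point_def)

text \<open>For k = 1 and y = 0, \<open>order_transform\<close> expresses alpha as an integral
  combination of the orders of the product with exponents a^(1), and these are integers.\<close>

lemma alpha_integral:
  assumes "i < m"
  shows "alpha_vec N a c P $ i = of_int \<lfloor>alpha_vec N a c P $ i\<rfloor>"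
proof -
  have "alpha_vec N a c P $ i = - (\<Sum>r<m. of_int (P $$ (i, r)) * cusp_order N a c 1 (lattice_point 1 (0\<^sub>v m)) r)"
    using order_transform[OF zero_carrier_vec assms, of 1] assms by simp
  also have "\<dots> \<in> \<int>"
    by (intro Ints_minus Ints_sum Ints_mult lattice_point_order_integral) auto
  finally show ?thesis by (metis Ints_cases floor_of_int)
qed

text \<open>If d_i were 0, the i-th unit vector would give exponents of weight 0 all of whose orders
  vanish. By \<open>cusp_order_kernel\<close> the exponents are 0, against the injectivity of B_N
  and Q.\<close>

lemma invariant_factor_pos:
  assumes i: "i < m"
  shows "d i > 0"
proof (rule ccontr)
  assume "\<not> d i > 0"
  then have di: "d i = 0" by simp
  define y :: "int vec" where "y = unit_vec m i"
  have y: "y \<in> carrier_vec m" by (simp add: y_def)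
  obtain P' where P': "P' \<in> carrier_mat m m" "P' * P = 1\<^sub>m m"
    using invertible_mat_obtain[OF P_inv P_carrier] by blast
  obtain Q' where Q': "Q' \<in> carrier_mat m m" "Q' * Q = 1\<^sub>m m"
    using invertible_mat_obtain[OF Q_inv Q_carrier] by blast
  have B: "B_mat N \<in> carrier_mat m m" using B_mat_carrier_mat[OF N] m by simp
  have Qy: "Q *\<^sub>v y \<in> carrier_vec m" using Q_carrier y by simp
  have BQy: "B_mat N *\<^sub>v (Q *\<^sub>v y) \<in> carrier_vec m" using B Qy by simp
  have "int 0 \<cdot>\<^sub>v a1_vec N = 0\<^sub>v m"
    by (intro eq_vecI) (simp_all add: carrier_vecD[OF a1_vec_carrier[OF N]] m)
  then have l0: "lattice_point 0 y = B_mat N *\<^sub>v (Q *\<^sub>v y)"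
    using BQy by (simp add: lattice_point_def)
  have "cusp_order N a c 0 (lattice_point 0 y) r = 0" if "r < m" for r
  proof (rule int_mat_kernel[OF P_carrier P' _ that])
    fix i' assume "i' < m"
    then show "(\<Sum>r<m. of_int (P $$ (i', r)) * cusp_order N a c 0 (lattice_point 0 y) r) = 0"
      using order_transform[OF y, of i' 0] di i by (simp add: y_def unit_vec_def)
  qed
  then have "B_mat N *\<^sub>v (Q *\<^sub>v y) = 0\<^sub>v (N div 2)"
    unfolding l0 using BQy m by (intro cusp_order_kernel[OF N ac]) auto
  then have "Q *\<^sub>v y = 0\<^sub>v m"
    using B_mat_injective[OF N, of "Q *\<^sub>v y"] Qy m by simp
  then have "Q' *\<^sub>v (Q *\<^sub>v y) = 0\<^sub>v m" using Q'(1) by (intro eq_vecI) (auto simp: scalar_prod_def)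
  then have "y = 0\<^sub>v m"
    using assoc_mult_mat_vec[OF Q'(1) Q_carrier y] y by (simp add: Q'(2))
  then have "y $ i = 0" using i by simp
  then show False using i by (simp add: y_def)
qed

lemma cusp_mu_last: "cusp_mu N c m > 0"
  using cusp_mu_pos[of N c m] N by simp

lemma L_set_lattice_point:
  "v \<in> L_set N k \<longleftrightarrow> (\<exists>y\<in>carrier_vec m. v = lattice_point k y) \<and> (\<forall>r\<le>m. cusp_order N a c k v r \<ge> 0)"
proof -
  obtain Q' where Q': "Q' \<in> carrier_mat m m" "Q * Q' = 1\<^sub>m m"
    using invertible_mat_obtain[OF Q_inv Q_carrier] by blast
  have "(\<exists>b\<in>carrier_vec m. v = int k \<cdot>\<^sub>v a1_vec N + B_mat N *\<^sub>v b) \<longleftrightarrow> (\<exists>y\<in>carrier_vec m. v = lattice_point k y)"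
  proof
    assume "\<exists>b\<in>carrier_vec m. v = int k \<cdot>\<^sub>v a1_vec N + B_mat N *\<^sub>v b"
    then obtain b where b: "b \<in> carrier_vec m" "v = int k \<cdot>\<^sub>v a1_vec N + B_mat N *\<^sub>v b" by blast
    have "Q *\<^sub>v (Q' *\<^sub>v b) = b" using assoc_mult_mat_vec[OF Q_carrier Q'(1) b(1)] b(1) by (simp add: Q'(2))
    then show "\<exists>y\<in>carrier_vec m. v = lattice_point k y"
      using Q'(1) b by (intro bexI[of _ "Q' *\<^sub>v b"]) (simp_all add: lattice_point_def)
  next
    assume "\<exists>y\<in>carrier_vec m. v = lattice_point k y"
    then obtain y where y: "y \<in> carrier_vec m" "v = lattice_point k y" by blast
    then show "\<exists>b\<in>carrier_vec m. v = int k \<cdot>\<^sub>v a1_vec N + B_mat N *\<^sub>v b"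
      using Q_carrier by (intro bexI[of _ "Q *\<^sub>v y"]) (simp_all add: lattice_point_def)
  qed
  then show ?thesis
    unfolding L_set_iff[OF N ac] m[symmetric] using lattice_point_carrier by blast
qed

section \<open>Tuples of orders and character sums\<close>

definition order_tuples :: "nat \<Rightarrow> (nat \<Rightarrow> nat) set" where
  "order_tuples k = {v \<in> {..m} \<rightarrow>\<^sub>E UNIV. (\<Sum>r\<le>m. cusp_mu N c r * of_nat (v r)) = of_nat k * R_num N}"

text \<open>If v consists of the orders of \<open>lattice_point k y\<close>, this number is d_i y_i.
  Its divisibility by d_i is therefore the condition under which y can be recovered from v.\<close>

definition twist :: "nat \<Rightarrow> (nat \<Rightarrow> nat) \<Rightarrow> nat \<Rightarrow> int" where
  "twist k v i = int k * \<lfloor>alpha_vec N a c P $ i\<rfloor> + (\<Sum>r<m. P $$ (i, r) * int (v r))"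

definition admissible_tuples :: "nat \<Rightarrow> (nat \<Rightarrow> nat) set" where
  "admissible_tuples k = {v \<in> order_tuples k. \<forall>i<m. int (d i) dvd twist k v i}"

text \<open>Positive weights bound each entry. Finiteness is essential, as \<open>W\<close> sums
  over this set and a sum over an infinite set would be 0 by convention.\<close>

lemma finite_order_tuples: "finite (order_tuples k)"
proof (rule finite_subset)
  define K where "K = (\<lambda>r. nat \<lfloor>of_nat k * R_num N / cusp_mu N c r\<rfloor>)"
  have mu: "cusp_mu N c r > 0" for r using cusp_mu_pos[of N c r] N by simp
  show "order_tuples k \<subseteq> (\<Pi>\<^sub>E r\<in>{..m}. {..K r})"
  proof
    fix v assume "v \<in> order_tuples k"
    then have v: "v \<in> {..m} \<rightarrow>\<^sub>E UNIV" "(\<Sum>r\<le>m. cusp_mu N c r * of_nat (v r)) = of_nat k * R_num N"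
      by (auto simp: order_tuples_def)
    have "v r \<le> K r" if "r \<le> m" for r
    proof -
      have "cusp_mu N c r * of_nat (v r) \<le> (\<Sum>r\<le>m. cusp_mu N c r * of_nat (v r))"
        by (rule member_le_sum) (use that less_imp_le[OF mu] in auto)
      then have "of_nat (v r) \<le> of_nat k * R_num N / cusp_mu N c r"
        using v(2) mu[of r] by (simp add: field_simps)
      then have "int (v r) \<le> \<lfloor>of_nat k * R_num N / cusp_mu N c r\<rfloor>" by (simp add: le_floor_iff)
      then show ?thesis unfolding K_def by linarith
    qed
    then show "v \<in> (\<Pi>\<^sub>E r\<in>{..m}. {..K r})" using v(1) by (auto simp: PiE_def)
  qed
  show "finite (\<Pi>\<^sub>E r\<in>{..m}. {..K r})" by (intro finite_PiE) auto
qed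

text \<open>An admissible tuple determines y by d_i y_i = \<open>twist\<close>. Inverting P then
  shows that the first m orders of the corresponding exponents are as prescribed, and the weighted
  sum settles the last one. Injectivity is \<open>cusp_order_kernel\<close> applied to a
  difference.\<close>

lemma bij_betw_L_set:
  "bij_betw (\<lambda>v. \<lambda>r\<in>{..m}. nat \<lfloor>cusp_order N a c k v r\<rfloor>) (L_set N k) (admissible_tuples k)"
proof -
  define \<phi> where "\<phi> = (\<lambda>v. \<lambda>r\<in>{..m}. nat \<lfloor>cusp_order N a c k v r\<rfloor>)"
  have N2: "N \<ge> 2" and N0: "N > 0" using N by auto
  have phi: "of_nat (\<phi> v r) = cusp_order N a c k v r" if "v \<in> L_set N k" "r \<le> m" for v r
  proof -
    have *: "(\<exists>y\<in>carrier_vec m. v = lattice_point k y) \<and> (\<forall>r\<le>m. cusp_order N a c k v r \<ge> 0)"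
      by (rule iffD1[OF L_set_lattice_point that(1)])
    then obtain y where y: "y \<in> carrier_vec m" "v = lattice_point k y" by blast
    have "cusp_order N a c k v r \<in> \<int>" unfolding y(2) by (rule lattice_point_order_integral[OF y(1)])
    then obtain z where "cusp_order N a c k v r = of_int z" by (rule Ints_cases)
    moreover have "cusp_order N a c k v r \<ge> 0" using * that(2) by blast
    ultimately show ?thesis using that(2) by (simp add: \<phi>_def)
  qed
  have sum: "(\<Sum>r\<le>m. cusp_mu N c r * cusp_order N a c k v r) = of_nat k * R_num N" for v
    unfolding cusp_order_def m by (rule sum_mu_order[OF N2 ac])
  obtain P' where P': "P' \<in> carrier_mat m m" "P' * P = 1\<^sub>m m"
    using invertible_mat_obtain[OF P_inv P_carrier] by blast
  have trans: "of_int (twist k w i) = (\<Sum>r<m. of_int (P $$ (i, r)) * (of_nat (w r) - cusp_order N a c k (lattice_point k y) r)) + of_int (int (d i) * y $ i)"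
    if "y \<in> carrier_vec m" "i < m" for w y i
  proof -
    have "of_int (twist k w i) = of_nat k * alpha_vec N a c P $ i + (\<Sum>r<m. of_int (P $$ (i, r)) * of_nat (w r))"
      using alpha_integral[OF that(2)] by (simp add: twist_def)
    then show ?thesis
      using order_transform[OF that, of k] by (simp add: right_diff_distrib sum_subtractf)
  qed
  have "\<phi> ` L_set N k \<subseteq> admissible_tuples k"
  proof safe
    fix v assume v: "v \<in> L_set N k"
    from iffD1[OF L_set_lattice_point v] have "\<exists>y\<in>carrier_vec m. v = lattice_point k y" by (rule conjunct1)
    then obtain y where y: "y \<in> carrier_vec m" "v = lattice_point k y" by blast
    have "\<phi> v \<in> {..m} \<rightarrow>\<^sub>E UNIV" by (auto simp: \<phi>_def)
    moreover have "(\<Sum>r\<le>m. cusp_mu N c r * of_nat (\<phi> v r)) = of_nat k * R_num N"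
      using sum[of v] phi[OF v] by simp
    moreover have "int (d i) dvd twist k (\<phi> v) i" if "i < m" for i
    proof -
      have "of_int (twist k (\<phi> v) i) = (of_int (int (d i) * y $ i) :: rat)"
        using trans[OF y(1) that, of "\<phi> v"] phi[OF v] by (simp add: y(2)[symmetric])
      then have "twist k (\<phi> v) i = int (d i) * y $ i" by (simp only: of_int_eq_iff)
      then show ?thesis by simp
    qed
    ultimately show "\<phi> v \<in> admissible_tuples k" by (simp add: admissible_tuples_def order_tuples_def)
  qed
  moreover have "admissible_tuples k \<subseteq> \<phi> ` L_set N k"
  proof
    fix w assume "w \<in> admissible_tuples k"
    then have w: "w \<in> {..m} \<rightarrow>\<^sub>E UNIV" "(\<Sum>r\<le>m. cusp_mu N c r * of_nat (w r)) = of_nat k * R_num N"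
      "\<And>i. i < m \<Longrightarrow> int (d i) dvd twist k w i"
      by (auto simp: admissible_tuples_def order_tuples_def)
    define y where "y = vec m (\<lambda>i. twist k w i div int (d i))"
    have y: "y \<in> carrier_vec m" by (simp add: y_def)
    define v where "v = lattice_point k y"
    have dy: "int (d i) * y $ i = twist k w i" if "i < m" for i using w(3)[OF that] that by (simp add: y_def)
    have "of_nat (w r) - cusp_order N a c k v r = 0" if "r < m" for r
    proof (rule int_mat_kernel[OF P_carrier P' _ that])
      show "(\<Sum>r<m. of_int (P $$ (i, r)) * (of_nat (w r) - cusp_order N a c k v r)) = 0" if "i < m" for i
        using trans[OF y that, of w] dy[OF that] by (simp add: v_def)
    qed
    then have less: "cusp_order N a c k v r = of_nat (w r)" if "r < m" for r using that by simp
    \<comment> \<open>The weighted sum is the same for v and for w, and all terms but the last are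
      known to agree.\<close>
    have "cusp_mu N c m * cusp_order N a c k v m = cusp_mu N c m * of_nat (w m)"
    proof -
      have *: "(\<Sum>r<m. cusp_mu N c r * cusp_order N a c k v r) = (\<Sum>r<m. cusp_mu N c r * of_nat (w r))"
        by (intro sum.cong) (auto simp: less)
      show ?thesis
        using sum[of v] w(2) unfolding lessThan_Suc_atMost[symmetric] sum.lessThan_Suc * by linarith
    qed
    then have "cusp_order N a c k v m = of_nat (w m)" using cusp_mu_last by simp
    then have eq: "cusp_order N a c k v r = of_nat (w r)" if "r \<le> m" for r
      using less that by (cases "r = m") auto
    have "v \<in> L_set N k" unfolding L_set_lattice_point using y eq by (auto simp: v_def)
    moreover have "\<phi> v = w"
    proof
      fix r show "\<phi> v r = w r"
        using eq[of r] w(1) by (cases "r \<le> m") (auto simp: \<phi>_def PiE_def extensional_def)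
    qed
    ultimately show "w \<in> \<phi> ` L_set N k" by blast
  qed
  moreover have "inj_on \<phi> (L_set N k)"
  proof (rule inj_onI)
    fix v v' assume v: "v \<in> L_set N k" "v' \<in> L_set N k" "\<phi> v = \<phi> v'"
    have vc: "v \<in> carrier_vec m" "v' \<in> carrier_vec m" using v by (auto simp: L_set_def m)
    have "cusp_order N a c k v r = cusp_order N a c k v' r" if "r < m" for r
      using phi[OF v(1), of r] phi[OF v(2), of r] v(3) that by simp
    then have "cusp_order N a c 0 (v - v') r = 0" if "r < N div 2" for r
      using that vc cusp_order_diff[of v N v' a c r] cusp_order_weight[OF N0, of a c k v r] cusp_order_weight[OF N0, of a c k v' r]
      by (simp add: m)
    then have "v - v' = 0\<^sub>v (N div 2)" using vc m by (intro cusp_order_kernel[OF N ac]) auto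
    then have "(v - v') $ i = 0" if "i < m" for i using that m by simp
    then show "v = v'" using vc by (intro eq_vecI) auto
  qed
  ultimately show ?thesis by (auto simp: bij_betw_def \<phi>_def)
qed

lemma omega_ep: "omega d i = ep (1 / of_nat (d i))"
  by (simp add: omega_def ep_def)

text \<open>Collecting the powers of the same root of unity gives the exponent j_i (k alpha_i +
  sum_r P_ir v_r), that is, j_i times \<open>twist\<close>.\<close>

lemma character_product:
  "xi N a c P d j ^ k * (\<Prod>r\<le>m. chi N P d r j ^ v r) =
    (\<Prod>i<m. ep (of_nat (j i) * (of_int (twist k v i) / of_nat (d i))))"
proof -
  define \<alpha> where "\<alpha> = (\<lambda>i. \<lfloor>alpha_vec N a c P $ i\<rfloor>)"
  have om: "(omega d i powi (int (j i) * x)) ^ n = ep (of_nat (j i) * of_int (x * int n) / of_nat (d i))" for i x n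
    by (simp add: omega_ep ep_powi ep_power mult_ac)
  have "xi N a c P d j ^ k = (\<Prod>i<m. ep (of_nat (j i) * of_int (\<alpha> i * int k) / of_nat (d i)))"
    by (simp only: xi_def m[symmetric] \<alpha>_def prod_power_distrib om)
  moreover have "(\<Prod>r\<le>m. chi N P d r j ^ v r) =
      (\<Prod>i<m. ep (\<Sum>r<m. of_nat (j i) * of_int (P $$ (i, r) * int (v r)) / of_nat (d i)))"
  proof -
    \<comment> \<open>The factor for r = m is 1, so the order at the last cusp does not enter the
      congruences.\<close>
    have "(\<Prod>r\<le>m. chi N P d r j ^ v r) = (\<Prod>r<m. chi N P d r j ^ v r)"
      by (simp add: lessThan_Suc_atMost[symmetric] chi_def m[symmetric])
    also have "\<dots> = (\<Prod>r<m. \<Prod>i<m. ep (of_nat (j i) * of_int (P $$ (i, r) * int (v r)) / of_nat (d i)))"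
      by (intro prod.cong refl) (simp only: chi_def m[symmetric] lessThan_iff if_True prod_power_distrib om)
    also have "\<dots> = (\<Prod>i<m. \<Prod>r<m. ep (of_nat (j i) * of_int (P $$ (i, r) * int (v r)) / of_nat (d i)))"
      by (rule prod.swap)
    finally show ?thesis by (simp only: ep_sum)
  qed
  ultimately have "xi N a c P d j ^ k * (\<Prod>r\<le>m. chi N P d r j ^ v r) =
     (\<Prod>i<m. ep (of_nat (j i) * of_int (\<alpha> i * int k) / of_nat (d i) +
       (\<Sum>r<m. of_nat (j i) * of_int (P $$ (i, r) * int (v r)) / of_nat (d i))))"
    by (simp only: prod.distrib[symmetric] ep_add)
  also have "\<dots> = (\<Prod>i<m. ep (of_nat (j i) * (of_int (twist k v i) / of_nat (d i))))"
  proof (intro prod.cong refl arg_cong[of _ _ ep])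
    fix i
    show "of_nat (j i) * of_int (\<alpha> i * int k) / of_nat (d i) +
       (\<Sum>r<m. of_nat (j i) * of_int (P $$ (i, r) * int (v r)) / of_nat (d i)) =
       (of_nat (j i) * (of_int (twist k v i) / of_nat (d i)) :: complex)"
      unfolding sum_divide_distrib[symmetric] sum_distrib_left[symmetric] of_int_sum[symmetric]
      by (simp add: twist_def \<alpha>_def ring_distribs add_divide_distrib mult_ac)
  qed
  finally show ?thesis .
qed

text \<open>Summed over all j, the product of exponentials factors into geometric sums over Z/d_i,
  each of which is d_i or 0 according to whether d_i divides \<open>twist\<close>.\<close>

lemma character_sum:
  "(\<Sum>j \<in> (\<Pi>\<^sub>E i\<in>{..<m}. {..<d i}). xi N a c P d j ^ k * W N c P d j (of_nat k * R_num N)) =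
    of_nat (card (admissible_tuples k)) * of_nat (\<Prod>i<m. d i)"
proof -
  have W: "W N c P d j (of_nat k * R_num N) = (\<Sum>v\<in>order_tuples k. \<Prod>r\<le>m. chi N P d r j ^ v r)" for j
    unfolding W_def order_tuples_def m[symmetric] ..
  have "(\<Sum>j \<in> (\<Pi>\<^sub>E i\<in>{..<m}. {..<d i}). xi N a c P d j ^ k * W N c P d j (of_nat k * R_num N)) =
    (\<Sum>j \<in> (\<Pi>\<^sub>E i\<in>{..<m}. {..<d i}). \<Sum>v\<in>order_tuples k.
      \<Prod>i<m. ep (of_nat (j i) * (of_int (twist k v i) / of_nat (d i))))"
    by (simp only: W sum_distrib_left character_product)
  also have "\<dots> = (\<Sum>v\<in>order_tuples k. \<Sum>j \<in> (\<Pi>\<^sub>E i\<in>{..<m}. {..<d i}).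
      \<Prod>i<m. ep (of_nat (j i) * (of_int (twist k v i) / of_nat (d i))))"
    by (rule sum.swap)
  also have "\<dots> = (\<Sum>v\<in>order_tuples k. \<Prod>i<m. \<Sum>x<d i. ep (of_nat x * (of_int (twist k v i) / of_nat (d i))))"
    by (intro sum.cong refl prod_sum_PiE[symmetric]) auto
  also have "\<dots> = (\<Sum>v\<in>order_tuples k. if \<forall>i<m. int (d i) dvd twist k v i then of_nat (\<Prod>i<m. d i) else 0)"
  proof (rule sum.cong[OF refl])
    fix v
    have "(\<Prod>i<m. \<Sum>x<d i. ep (of_nat x * (of_int (twist k v i) / of_nat (d i)))) =
        (\<Prod>i<m. if int (d i) dvd twist k v i then of_nat (d i) else 0)"
      by (intro prod.cong refl sum_ep_residues invariant_factor_pos) simp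
    also have "\<dots> = (if \<forall>i<m. int (d i) dvd twist k v i then of_nat (\<Prod>i<m. d i) else 0)"
      by auto
    finally show "(\<Prod>i<m. \<Sum>x<d i. ep (of_nat x * (of_int (twist k v i) / of_nat (d i)))) =
      (if \<forall>i<m. int (d i) dvd twist k v i then of_nat (\<Prod>i<m. d i) else 0)" .
  qed
  also have "\<dots> = (\<Sum>v\<in>admissible_tuples k. of_nat (\<Prod>i<m. d i))"
    unfolding admissible_tuples_def by (rule sum.inter_filter[OF finite_order_tuples, symmetric])
  finally show ?thesis by simp
qed

lemma L_set_count:
  "finite (L_set N k) \<and> of_nat (card (L_set N k)) = 1 / of_nat (\<Prod>i<m. d i) *
    (\<Sum>j \<in> (\<Pi>\<^sub>E i\<in>{..<m}. {..<d i}). xi N a c P d j ^ k * W N c P d j (of_nat k * R_num N))"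
proof
  have "finite (admissible_tuples k)"
    unfolding admissible_tuples_def using finite_order_tuples by simp
  then show "finite (L_set N k)" using bij_betw_finite[OF bij_betw_L_set] by simp
  have "(\<Prod>i<m. d i) \<noteq> 0" using invariant_factor_pos by simp
  then have "(of_nat (\<Prod>i<m. d i) :: complex) \<noteq> 0" by (simp only: of_nat_eq_0_iff not_False_eq_True)
  then show "of_nat (card (L_set N k)) = 1 / of_nat (\<Prod>i<m. d i) *
    (\<Sum>j \<in> (\<Pi>\<^sub>E i\<in>{..<m}. {..<d i}). xi N a c P d j ^ k * W N c P d j (of_nat k * R_num N))"
    unfolding character_sum bij_betw_same_card[OF bij_betw_L_set] by simp
qed

end

theorem theorem4p1:
  fixes N k m :: nat
    and a c :: "nat \<Rightarrow> int"
    and P Q :: "int mat"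
    and d :: "nat \<Rightarrow> nat"
  assumes "N \<ge> 5"
    and "m = N div 2"
    and "cusp_orbit_reps N a c"
    and "smith_normal_form m (class_mat N a c) P Q d"
  shows "finite (L_set N k) \<and>
    of_nat (card (L_set N k)) =
      1 / of_nat (\<Prod>i<m. d i) *
      (\<Sum>j \<in> (\<Pi>\<^sub>E i\<in>{..<m}. {..<d i}).
         xi N a c P d j ^ k * W N c P d j (of_nat k * R_num N))"
  using assms by (rule L_set_count)

end
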